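(* Assume the standing assumptions (A) on $p,Q,r,s$ hold and that the preminimal operator $\mathrm{L}_{00}$ is bounded from below in $L^2(\mathbb{R})$. Suppose there is a sequence of intervals $\Delta_n=[a_n,b_n]$, $n\in\mathbb{Z}$, with $-\infty<a_n<b_n<\infty$, $b_n\to-\infty$ as $n\to-\infty$, $a_n\to\infty$ as $n\to\infty$, such that (i) $p_n:=p|_{\Delta_n}\in W^1_2(\Delta_n)$ and $p_n>0$ on $\Delta_n$; (ii) there is $C>0$ with $p_n(x)\le C|\Delta_n|^2$ for all $x\in\Delta_n$ and all $n\in\mathbb{Z}$, where $|\Delta_n|=b_n-a_n$. Then $\mathrm{L}_{00}$ is essentially self-adjoint and $\mathrm{L}_{00}^*=\mathrm{L}=\mathrm{L}^*$.
   Context: Standing assumptions (A): $p,Q,r,s:\mathbb{R}\to\mathbb{R}$ are real-valued measurable functions with $\frac{1}{\sqrt{|p|}},\frac{Q}{\sqrt{|p|}},\frac{r}{\sqrt{|p|}}\in L^2_{loc}(\mathbb{R})$, $s\in L^1_{loc}(\mathbb{R})$, $\frac1p\neq0$ a.e.; set $q=Q'+s$ (distributional derivative). Quasi-derivatives: $u^{[0]}:=u$, $u^{[1]}:=pu'-(Q+ir)u$, $u^{[2]}:=(u^{[1]})'+\frac{Q-ir}{p}u^{[1]}+\left(\frac{Q^2+r^2}{p}-s\right)u$, and $l[u]:=-u^{[2]}$ for $u$ with $u,u^{[1]}\in\mathrm{AC}_{loc}(\mathbb{R})$ (this realizes $-(pu')'+qu+i((ru)'+ru')$). Maximal operator: $\mathrm{L}u:=l[u]$,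 $\mathrm{Dom}(\mathrm{L}):=\{u\in L^2(\mathbb{R}): u,u^{[1]}\in\mathrm{AC}_{loc}(\mathbb{R}),\ l[u]\in L^2(\mathbb{R})\}$. Preminimal operator $\mathrm{L}_{00}$: restriction of $\mathrm{L}$ to compactly supported elements of $\mathrm{Dom}(\mathrm{L})$. Bounded from below means: $\exists\gamma\in\mathbb{R}$ with $(\mathrm{L}_{00}u,u)\ge\gamma\|u\|^2$ for all $u\in\mathrm{Dom}(\mathrm{L}_{00})$. *)

theory Defs
  imports "HOL-Analysis.Analysis"
begin

definition L2 :: "(real \<Rightarrow> complex) \<Rightarrow> bool" where
  "L2 f \<longleftrightarrow> f \<in> borel_measurable lebesgue \<and> integrable lebesgue (\<lambda>x. (cmod (f x))\<^sup>2)"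

definition L2_norm_sq :: "(real \<Rightarrow> complex) \<Rightarrow> real" where
  "L2_norm_sq f = integral\<^sup>L lebesgue (\<lambda>x. (cmod (f x))\<^sup>2)"

definition L2_inner :: "(real \<Rightarrow> complex) \<Rightarrow> (real \<Rightarrow> complex) \<Rightarrow> complex" where
  "L2_inner f g = integral\<^sup>L lebesgue (\<lambda>x. f x * cnj (g x))"

definition L2_loc :: "(real \<Rightarrow> real) \<Rightarrow> bool" where
  "L2_loc f \<longleftrightarrow> f \<in> borel_measurable lebesgue \<and>
     (\<forall>a b. set_integrable lebesgue {a..b} (\<lambda>x. (f x)\<^sup>2))"

definition L1_loc :: "(real \<Rightarrow> real) \<Rightarrow> bool" where
  "L1_loc f \<longleftrightarrow> f \<in> borel_measurable lebesgue \<and> (\<forall>a b. set_integrable lebesgue {a..b} f)"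

definition AC_loc_with :: "(real \<Rightarrow> complex) \<Rightarrow> (real \<Rightarrow> complex) \<Rightarrow> bool" where
  "AC_loc_with u g \<longleftrightarrow> g \<in> borel_measurable lebesgue \<and>
     (\<forall>a b. set_integrable lebesgue {a..b} g) \<and>
     (\<forall>x y. x \<le> y \<longrightarrow> u y - u x = (LINT t:{x..y}|lebesgue. g t))"

definition quasi ::
  "(real \<Rightarrow> real) \<Rightarrow> (real \<Rightarrow> real) \<Rightarrow> (real \<Rightarrow> real) \<Rightarrow> (real \<Rightarrow> real) \<Rightarrow>
   (real \<Rightarrow> complex) \<Rightarrow> (real \<Rightarrow> complex) \<Rightarrow> (real \<Rightarrow> complex) \<Rightarrow> bool" where
  "quasi p Q r s u u1 u2 \<longleftrightarrow>
     (\<exists>g h. AC_loc_with u g \<and> AC_loc_with u1 h \<and>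
        (AE x in lebesgue. u1 x = of_real (p x) * g x - (of_real (Q x) + \<i> * of_real (r x)) * u x) \<and>
        (AE x in lebesgue. u2 x = h x + (of_real (Q x) - \<i> * of_real (r x)) / of_real (p x) * u1 x
              + of_real (((Q x)\<^sup>2 + (r x)\<^sup>2) / p x - s x) * u x))"

section \<open>Operators in L2(R) as graphs (sets of pairs of representatives)\<close>

text \<open>Graphs are saturated with respect to a.e. equality of representatives.\<close>

definition Lmax ::
  "(real \<Rightarrow> real) \<Rightarrow> (real \<Rightarrow> real) \<Rightarrow> (real \<Rightarrow> real) \<Rightarrow> (real \<Rightarrow> real) \<Rightarrow>
   ((real \<Rightarrow> complex) \<times> (real \<Rightarrow> complex)) set" where
  "Lmax p Q r s = {(u, f). L2 u \<and> L2 f \<and>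
     (\<exists>y y1 y2. (AE x in lebesgue. y x = u x) \<and> quasi p Q r s y y1 y2 \<and>
                (AE x in lebesgue. f x = - y2 x))}"

definition L00 ::
  "(real \<Rightarrow> real) \<Rightarrow> (real \<Rightarrow> real) \<Rightarrow> (real \<Rightarrow> real) \<Rightarrow> (real \<Rightarrow> real) \<Rightarrow>
   ((real \<Rightarrow> complex) \<times> (real \<Rightarrow> complex)) set" where
  "L00 p Q r s = {(u, f). L2 u \<and> L2 f \<and>
     (\<exists>y y1 y2 c d. (\<forall>x. x \<notin> {c..d} \<longrightarrow> y x = 0) \<and>
                (AE x in lebesgue. y x = u x) \<and> quasi p Q r s y y1 y2 \<and>
                (AE x in lebesgue. f x = - y2 x))}"

definition adjoint_op ::
  "((real \<Rightarrow> complex) \<times> (real \<Rightarrow> complex)) set \<Rightarrow> ((real \<Rightarrow> complex) \<times> (real \<Rightarrow> complex)) set" where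
  "adjoint_op T = {(v, w). L2 v \<and> L2 w \<and> (\<forall>(u, f) \<in> T. L2_inner f v = L2_inner u w)}"

definition closure_op ::
  "((real \<Rightarrow> complex) \<times> (real \<Rightarrow> complex)) set \<Rightarrow> ((real \<Rightarrow> complex) \<times> (real \<Rightarrow> complex)) set" where
  "closure_op T = {(u, f). L2 u \<and> L2 f \<and>
     (\<exists>U F. (\<forall>n. (U n, F n) \<in> T) \<and>
        (\<lambda>n. L2_norm_sq (\<lambda>x. U n x - u x)) \<longlonglongrightarrow> 0 \<and>
        (\<lambda>n. L2_norm_sq (\<lambda>x. F n x - f x)) \<longlonglongrightarrow> 0)}"

definition densely_defined :: "((real \<Rightarrow> complex) \<times> (real \<Rightarrow> complex)) set \<Rightarrow> bool" where
  "densely_defined T \<longleftrightarrow> (\<forall>v. L2 v \<longrightarrow>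
     (\<exists>U. (\<forall>n. U n \<in> fst ` T) \<and> (\<lambda>n. L2_norm_sq (\<lambda>x. U n x - v x)) \<longlonglongrightarrow> 0))"

definition single_valued_op :: "((real \<Rightarrow> complex) \<times> (real \<Rightarrow> complex)) set \<Rightarrow> bool" where
  "single_valued_op T \<longleftrightarrow> (\<forall>u v f g. (u, f) \<in> T \<longrightarrow> (v, g) \<in> T \<longrightarrow>
      (AE x in lebesgue. u x = v x) \<longrightarrow> (AE x in lebesgue. f x = g x))"

definition self_adjoint_op :: "((real \<Rightarrow> complex) \<times> (real \<Rightarrow> complex)) set \<Rightarrow> bool" where
  "self_adjoint_op T \<longleftrightarrow> densely_defined T \<and> single_valued_op T \<and> adjoint_op T = T"

definition essentially_self_adjoint :: "((real \<Rightarrow> complex) \<times> (real \<Rightarrow> complex)) set \<Rightarrow> bool" where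
  "essentially_self_adjoint T \<longleftrightarrow> densely_defined T \<and> self_adjoint_op (closure_op T)"

definition test_fun :: "real \<Rightarrow> real \<Rightarrow> (real \<Rightarrow> real) \<Rightarrow> bool" where
  "test_fun a b \<phi> \<longleftrightarrow>
     (\<exists>D :: nat \<Rightarrow> real \<Rightarrow> real. D 0 = \<phi> \<and> (\<forall>k x. (D k has_real_derivative D (Suc k) x) (at x))) \<and>
     (\<exists>c d. a < c \<and> d < b \<and> (\<forall>x. x \<notin> {c..d} \<longrightarrow> \<phi> x = 0))"

definition W12 :: "real \<Rightarrow> real \<Rightarrow> (real \<Rightarrow> real) \<Rightarrow> bool" where
  "W12 a b f \<longleftrightarrow> f \<in> borel_measurable lebesgue \<and>
     set_integrable lebesgue {a..b} (\<lambda>x. (f x)\<^sup>2) \<and>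
     (\<exists>g. g \<in> borel_measurable lebesgue \<and> set_integrable lebesgue {a..b} (\<lambda>x. (g x)\<^sup>2) \<and>
        (\<forall>\<phi>. test_fun a b \<phi> \<longrightarrow>
           (LINT x:{a..b}|lebesgue. f x * deriv \<phi> x) = - (LINT x:{a..b}|lebesgue. g x * \<phi> x)))"

definition standing_A :: "(real \<Rightarrow> real) \<Rightarrow> (real \<Rightarrow> real) \<Rightarrow> (real \<Rightarrow> real) \<Rightarrow> (real \<Rightarrow> real) \<Rightarrow> bool" where
  "standing_A p Q r s \<longleftrightarrow>
     p \<in> borel_measurable lebesgue \<and> Q \<in> borel_measurable lebesgue \<and>
     r \<in> borel_measurable lebesgue \<and> s \<in> borel_measurable lebesgue \<and>
     L2_loc (\<lambda>x. 1 / sqrt \<bar>p x\<bar>) \<and> L2_loc (\<lambda>x. Q x / sqrt \<bar>p x\<bar>) \<and>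
     L2_loc (\<lambda>x. r x / sqrt \<bar>p x\<bar>) \<and> L1_loc s \<and>
     (AE x in lebesgue. 1 / p x \<noteq> 0)"

definition bounded_below_op :: "((real \<Rightarrow> complex) \<times> (real \<Rightarrow> complex)) set \<Rightarrow> bool" where
  "bounded_below_op T \<longleftrightarrow> (\<exists>\<gamma>::real. \<forall>(u, f) \<in> T.
      Im (L2_inner f u) = 0 \<and> Re (L2_inner f u) \<ge> \<gamma> * L2_norm_sq u)"

end

theory Submission
  imports Defs
begin

text \<open>
  Solving the quasi-differential equation with a prescribed right-hand side shows that the adjoint of
  the preminimal operator is the maximal one. It then suffices to prove that the maximal operator is
  symmetric: an element of its graph orthogonal to the preminimal graph is a pair \<open>(h, k)\<close> with
  \<open>L h = k\<close> and \<open>L k = - h\<close>, and symmetry gives \<open>(k, k) = - (h, h)\<close>, hence \<open>h = k = 0\<close>.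

  For the symmetry, let \<open>\<phi>\<close> be a cut-off that descends from 1 to 0 on two of the given intervals.
  There \<open>p \<phi>'\<^sup>2\<close> is bounded by a multiple of \<open>C\<close>, since \<open>p \<le> C d\<^sup>2\<close> and \<open>\<phi>'\<close> has order
  \<open>1/d\<close>, where \<open>d\<close> is the length of the interval. Integration by parts yields
  \<open>Re (L (\<phi> u), \<phi> u) = Re (\<phi>\<^sup>2 L u, u) + \<integral> p \<phi>'\<^sup>2 |u|\<^sup>2\<close>, so the form of the semibounded preminimal
  operator is bounded on the cut-offs of \<open>u\<close> and small on the difference of two late cut-offs. The
  boundary terms are values of this form at such pairs and vanish in the limit by the Cauchy-Schwarz
  inequality.
\<close>

text \<open>The obstacle is that \<open>\<phi> u\<close> has to lie in the domain of the preminimal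
  operator. Its first quasi-derivative is \<open>\<phi> u1 + p \<phi>' u\<close>, so
  \<open>p \<phi>'\<close> must be absolutely continuous, and \<open>L (\<phi> u)\<close> is square
  integrable only under control of the derivative of \<open>p \<phi>'\<close> and of
  \<open>Q \<phi>'\<close>. Hence the cut-off is built backwards: \<open>\<psi> = p \<phi>'\<close>
  is prescribed as a polynomial on the interval, and \<open>\<phi>\<close> comes from integrating
  \<open>\<psi> / p\<close>. The bound on \<open>p \<phi>'\<^sup>2\<close> also puts
  \<open>Q \<phi>'\<close> in L2, because
  \<open>(Q \<phi>')\<^sup>2 = (Q\<^sup>2 / p) (p \<phi>'\<^sup>2)\<close>.

  No square integrability of \<open>u1\<close> over the whole line is available. The energy identity
  needs none: after adding the derivative of \<open>\<phi> \<psi> |u|\<^sup>2\<close>, whose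
  integral is zero, the terms with \<open>u1\<close>, \<open>Q\<close> and \<open>\<psi>'\<close>
  cancel, and \<open>r\<close> enters only an imaginary part.

  Operators are graphs, so orthogonal projection takes place in the space of pairs, with the squared
  distances of both components added. The preminimal graph is not assumed closed, and so the
  projection delivers an approximating sequence instead of a nearest element.\<close>

section \<open>Locally absolutely continuous functions\<close>

definition loc_int :: "(real \<Rightarrow> complex) \<Rightarrow> bool" where
  "loc_int g \<longleftrightarrow> g \<in> borel_measurable lebesgue \<and> (\<forall>a b. set_integrable lebesgue {a..b} g)"

lemma AC_loc_with_iff:
  "AC_loc_with u g \<longleftrightarrow> loc_int g \<and> (\<forall>x y. x \<le> y \<longrightarrow> u y - u x = (LINT t:{x..y}|lebesgue. g t))"
  by (simp add: AC_loc_with_def loc_int_def)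

lemma loc_intD:
  assumes "loc_int g"
  shows "g \<in> borel_measurable lebesgue" "set_integrable lebesgue {a..b} g"
  using assms by (auto simp: loc_int_def)

lemma set_integral_le_combine:
  fixes g :: "real \<Rightarrow> complex"
  assumes "set_integrable lebesgue {x..z} g" "x \<le> y" "y \<le> z"
  shows "(LINT t:{x..z}|lebesgue. g t) = (LINT t:{x..y}|lebesgue. g t) + (LINT t:{y..z}|lebesgue. g t)"
proof -
  have i: "set_integrable lebesgue {x..y} g" "set_integrable lebesgue {y..z} g"
    using assms by (auto intro: set_integrable_subset)
  have "g integrable_on {x..z}"
    using assms(1) set_lebesgue_integral_eq_integral(1) by blast
  then show ?thesis
    using Henstock_Kurzweil_Integration.integral_combine[OF assms(2,3), of g] i assms(1)
    by (simp add: set_lebesgue_integral_eq_integral(2))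
qed

text \<open>The sign to the left of \<open>c\<close> makes increments additive across
  \<open>c\<close>, so that data at an interior point can be continued in both directions.\<close>

definition prim :: "real \<Rightarrow> (real \<Rightarrow> complex) \<Rightarrow> real \<Rightarrow> complex" where
  "prim c g t = (if c \<le> t then LINT x:{c..t}|lebesgue. g x else - (LINT x:{t..c}|lebesgue. g x))"

lemma AC_prim:
  assumes "loc_int g"
  shows "AC_loc_with (prim c g) g"
  unfolding AC_loc_with_iff
proof (intro conjI allI impI)
  fix x y :: real assume "x \<le> y"
  note i = loc_intD(2)[OF assms]
  consider "c \<le> x" | "x < c" "c \<le> y" | "y < c" by linarith
  then show "prim c g y - prim c g x = (LINT t:{x..y}|lebesgue. g t)"
    using \<open>x \<le> y\<close>
    by cases (auto simp: prim_def set_integral_le_combine[OF i, of c x y]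
       set_integral_le_combine[OF i, of x c y] set_integral_le_combine[OF i, of x y c])
qed (use assms in auto)

lemma AC_eq_prim:
  assumes "AC_loc_with u g"
  shows "u t = u c + prim c g t"
proof (cases "c \<le> t")
  case True
  then have "u t - u c = (LINT x:{c..t}|lebesgue. g x)" using assms by (simp add: AC_loc_with_iff)
  with True show ?thesis by (simp add: prim_def algebra_simps)
next
  case False
  then have "u c - u t = (LINT x:{t..c}|lebesgue. g x)" using assms by (simp add: AC_loc_with_iff)
  with False show ?thesis by (simp add: prim_def algebra_simps)
qed

lemma prim_self [simp]: "prim c g c = 0"
proof -
  have "(LINT x:{c}|lebesgue. g x) = (LINT x:{}|lebesgue. g x)"
  proof -
    have "AE x in lebesgue. indicat_real {c} x *\<^sub>R g x = 0"
      by (rule AE_I'[of "{c}"]) (auto simp: indicator_def)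
    then show ?thesis
      unfolding set_lebesgue_integral_def by (auto intro!: integral_eq_zero_AE)
  qed
  then show ?thesis by (simp add: prim_def set_lebesgue_integral_def)
qed

lemma AC_loc_int: "AC_loc_with u g \<Longrightarrow> loc_int g"
  by (simp add: AC_loc_with_iff)

lemma AC_continuous:
  assumes "AC_loc_with u g"
  shows "continuous_on UNIV u"
proof -
  have "isCont u x" for x
  proof -
    have "g integrable_on {x-1..x+1}"
      using loc_intD(2)[OF AC_loc_int[OF assms]] set_lebesgue_integral_eq_integral(1) by blast
    then have "continuous_on {x-1..x+1} (\<lambda>t. u (x-1) + integral {x-1..t} g)"
      by (intro continuous_intros indefinite_integral_continuous_1)
    moreover have "u (x-1) + integral {x-1..t} g = u t" if "t \<in> {x-1..x+1}" for t
    proof -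
      have "u t - u (x-1) = (LINT t:{x-1..t}|lebesgue. g t)"
        using assms that by (auto simp: AC_loc_with_iff)
      also have "\<dots> = integral {x-1..t} g"
        by (rule set_lebesgue_integral_eq_integral(2)[OF loc_intD(2)[OF AC_loc_int[OF assms]]])
      finally show ?thesis by (simp add: algebra_simps)
    qed
    ultimately have "continuous_on {x-1..x+1} u"
      by (metis (no_types, lifting) continuous_on_cong)
    then show ?thesis
      by (intro continuous_on_interior[of "{x-1..x+1}"]) auto
  qed
  then show ?thesis by (simp add: continuous_on_eq_continuous_at)
qed

lemma borel_measurable_lebesgue_continuous:
  fixes u :: "real \<Rightarrow> 'a::{topological_space}"
  assumes "continuous_on UNIV u"
  shows "u \<in> borel_measurable lebesgue"
proof -
  have "u \<in> borel_measurable lborel" using borel_measurable_continuous_onI[OF assms] by simp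
  then show ?thesis by (rule measurable_completion)
qed

lemma ident_measurable_lebesgue [measurable]: "(\<lambda>x. x) \<in> borel_measurable (lebesgue :: real measure)"
  by (intro borel_measurable_lebesgue_continuous continuous_on_id)

text \<open>Weaker than continuity on purpose: the sum of the Picard series is known to be of this
  kind before it is known to be continuous, and the derivatives of the cut-offs may jump.\<close>

definition loc_bdd :: "(real \<Rightarrow> complex) \<Rightarrow> bool" where
  "loc_bdd f \<longleftrightarrow> f \<in> borel_measurable lebesgue \<and> (\<forall>a b. \<exists>B\<ge>0. \<forall>x\<in>{a..b}. cmod (f x) \<le> B)"

lemma loc_bdd_continuous:
  assumes "continuous_on UNIV u"
  shows "loc_bdd u"
  unfolding loc_bdd_def
proof (intro conjI allI)
  show "u \<in> borel_measurable lebesgue" by (rule borel_measurable_lebesgue_continuous[OF assms])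
  fix a b :: real
  have "bounded (u ` {a..b})"
    by (intro compact_imp_bounded compact_continuous_image continuous_on_subset[OF assms]) auto
  then show "\<exists>B\<ge>0. \<forall>x\<in>{a..b}. cmod (u x) \<le> B"
    unfolding bounded_pos by (meson image_eqI less_imp_le)
qed

lemma AC_loc_bdd: "AC_loc_with u g \<Longrightarrow> loc_bdd u"
  by (intro loc_bdd_continuous AC_continuous)

lemma loc_int_bound:
  fixes G :: "real \<Rightarrow> real"
  assumes "f \<in> borel_measurable lebesgue" "\<And>a b. set_integrable lebesgue {a..b} G"
    "\<And>x. cmod (f x) \<le> G x"
  shows "loc_int f"
  unfolding loc_int_def
proof (intro conjI allI)
  fix a b
  note [measurable] = assms(1)
  have "set_borel_measurable lebesgue {a..b} f"
    unfolding set_borel_measurable_def by measurable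
  then show "set_integrable lebesgue {a..b} f"
    unfolding set_integrable_def set_borel_measurable_def
    by (rule Bochner_Integration.integrable_bound[OF assms(2)[of a b, unfolded set_integrable_def]])
      (use assms(3) in \<open>auto simp: indicator_def intro!: AE_I2 order_trans[OF _ abs_ge_self]\<close>)
qed (use assms in auto)

lemma loc_int_mult_bdd:
  assumes "loc_int g" "loc_bdd f"
  shows "loc_int (\<lambda>x. f x * g x)"
  unfolding loc_int_def
proof (intro conjI allI)
  show m[measurable]: "(\<lambda>x. f x * g x) \<in> borel_measurable lebesgue"
    using assms by (auto simp: loc_int_def loc_bdd_def)
  fix a b
  obtain B where B: "B \<ge> 0" "\<And>x. x \<in> {a..b} \<Longrightarrow> cmod (f x) \<le> B"
    using assms(2) unfolding loc_bdd_def by meson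
  have "integrable lebesgue (\<lambda>x. complex_of_real B * (indicat_real {a..b} x *\<^sub>R g x))"
    using assms(1) unfolding loc_int_def set_integrable_def by (intro integrable_mult_right) auto
  then show "set_integrable lebesgue {a..b} (\<lambda>x. f x * g x)"
    unfolding set_integrable_def
  proof (rule Bochner_Integration.integrable_bound)
    show "(\<lambda>x. indicat_real {a..b} x *\<^sub>R (f x * g x)) \<in> borel_measurable lebesgue"
      by measurable
  qed (use B in \<open>auto simp: indicator_def norm_mult intro!: AE_I2 mult_right_mono\<close>)
qed

lemma loc_int_add: "loc_int f \<Longrightarrow> loc_int g \<Longrightarrow> loc_int (\<lambda>x. f x + g x)"
  by (auto simp: loc_int_def set_integral_add)

lemma loc_int_cmult: "loc_int f \<Longrightarrow> loc_int (\<lambda>x. c * f x)"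
  by (auto simp: loc_int_def)

lemma loc_int_uminus: "loc_int f \<Longrightarrow> loc_int (\<lambda>x. - f x)"
  using loc_int_cmult[of f "-1"] by simp

lemma cnj_measurable [measurable]: "cnj \<in> borel_measurable borel"
  by (intro borel_measurable_continuous_onI continuous_intros)

lemma loc_int_cnj: "loc_int f \<Longrightarrow> loc_int (\<lambda>x. cnj (f x))"
proof -
  assume "loc_int f"
  moreover have "set_integrable lebesgue {a..b} (\<lambda>x. cnj (f x))" if "set_integrable lebesgue {a..b} f" for a b
  proof -
    have "(\<lambda>x. indicat_real {a..b} x *\<^sub>R cnj (f x)) = (\<lambda>x. cnj (indicat_real {a..b} x *\<^sub>R f x))" by auto
    with that show ?thesis unfolding set_integrable_def by (simp only: complex_integrable_cnj)
  qed
  moreover have "(\<lambda>x. cnj (f x)) \<in> borel_measurable lebesgue"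
    using measurable_compose[OF loc_intD(1)[OF \<open>loc_int f\<close>] cnj_measurable] .
  ultimately show ?thesis by (auto simp: loc_int_def)
qed

lemma loc_int_bdd: "loc_bdd f \<Longrightarrow> loc_int f"
proof -
  assume f: "loc_bdd f"
  have "loc_int (\<lambda>x. 1)"
  proof -
    have "continuous_on {a..b} (\<lambda>x. 1 :: complex)" for a b :: real by (intro continuous_intros)
    then show ?thesis
      unfolding loc_int_def using absolutely_integrable_continuous_real by auto
  qed
  from loc_int_mult_bdd[OF this f] show ?thesis by simp
qed

lemma loc_bdd_mult: assumes "loc_bdd f" "loc_bdd g" shows "loc_bdd (\<lambda>x. f x * g x)"
  unfolding loc_bdd_def
proof (intro conjI allI)
  show "(\<lambda>x. f x * g x) \<in> borel_measurable lebesgue" using assms by (auto simp: loc_bdd_def)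
  fix a b
  obtain A B where "A \<ge> 0" "\<And>x. x \<in> {a..b} \<Longrightarrow> cmod (f x) \<le> A" "B \<ge> 0" "\<And>x. x \<in> {a..b} \<Longrightarrow> cmod (g x) \<le> B"
    using assms unfolding loc_bdd_def by meson
  then show "\<exists>B\<ge>0. \<forall>x\<in>{a..b}. cmod (f x * g x) \<le> B"
    by (intro exI[of _ "A*B"]) (auto simp: norm_mult intro!: mult_mono)
qed

lemma AC_add: "AC_loc_with u g \<Longrightarrow> AC_loc_with v h \<Longrightarrow> AC_loc_with (\<lambda>x. u x + v x) (\<lambda>x. g x + h x)"
  unfolding AC_loc_with_iff
proof (intro conjI allI impI, elim conjE, rule loc_int_add, assumption+, elim conjE)
  fix x y :: real assume *: "x \<le> y" "loc_int g" "loc_int h"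
    "\<forall>x y. x \<le> y \<longrightarrow> u y - u x = (LINT t:{x..y}|lebesgue. g t)"
    "\<forall>x y. x \<le> y \<longrightarrow> v y - v x = (LINT t:{x..y}|lebesgue. h t)"
  have "(LINT t:{x..y}|lebesgue. g t + h t) = (u y - u x) + (v y - v x)"
    using * set_integral_add(2)[OF loc_intD(2)[OF *(2)] loc_intD(2)[OF *(3)]] by simp
  then show "u y + v y - (u x + v x) = (LINT t:{x..y}|lebesgue. g t + h t)" by simp
qed

lemma AC_cmult: "AC_loc_with u g \<Longrightarrow> AC_loc_with (\<lambda>x. c * u x) (\<lambda>x. c * g x)"
  unfolding AC_loc_with_iff
  by (simp add: loc_int_cmult right_diff_distrib[symmetric] del: right_diff_distrib)

lemma AC_diff: "AC_loc_with u g \<Longrightarrow> AC_loc_with v h \<Longrightarrow> AC_loc_with (\<lambda>x. u x - v x) (\<lambda>x. g x - h x)"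
  using AC_add[OF _ AC_cmult[of v h "-1"]] by simp

lemma AC_const: "AC_loc_with (\<lambda>x. c) (\<lambda>x. 0)"
  by (auto simp: AC_loc_with_def set_integrable_def)

lemma set_integral_cnj: "(LINT t:A|M. cnj (g t)) = cnj (LINT t:A|M. g t)"
proof -
  have "(\<lambda>t. indicat_real A t *\<^sub>R cnj (g t)) = (\<lambda>t. cnj (indicat_real A t *\<^sub>R g t))" by auto
  then show ?thesis unfolding set_lebesgue_integral_def by (simp only: Bochner_Integration.integral_cnj)
qed

lemma AC_cnj: "AC_loc_with u g \<Longrightarrow> AC_loc_with (\<lambda>x. cnj (u x)) (\<lambda>x. cnj (g x))"
  unfolding AC_loc_with_iff by (auto simp: loc_int_cnj set_integral_cnj simp flip: complex_cnj_diff)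

lemma loc_int_cong_AE:
  assumes "loc_int g" "AE x in lebesgue. g x = h x"
  shows "loc_int h"
proof -
  have h: "h \<in> borel_measurable lebesgue"
    using assms borel_measurable_AE[OF _ assms(2)] by (auto simp: loc_int_def)
  have "set_integrable lebesgue {a..b} h" for a b
    using set_integrable_cong_AE[of g lebesgue h "{a..b}"] assms h eventually_mono[OF assms(2), of "\<lambda>x. x \<in> {a..b} \<longrightarrow> g x = h x"]
    by (simp add: loc_int_def)
  with h show ?thesis by (auto simp: loc_int_def)
qed

lemma AC_cong_AE:
  assumes "AC_loc_with u g" "AE x in lebesgue. g x = h x"
  shows "AC_loc_with u h"
proof -
  have h: "loc_int h" using loc_int_cong_AE assms AC_loc_int by blast
  have "(LINT t:{x..y}|lebesgue. g t) = (LINT t:{x..y}|lebesgue. h t)" for x y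
    using assms h AC_loc_int[OF assms(1)] by (intro set_lebesgue_integral_cong_AE) (auto simp: loc_int_def)
  with assms h show ?thesis by (simp add: AC_loc_with_iff)
qed

section \<open>Fubini's theorem, the product rule, and functions whose integrals vanish\<close>

lemma sigma_finite_lebesgue: "sigma_finite_measure (lebesgue :: real measure)"
proof
  obtain A :: "real set set" where "countable A" "A \<subseteq> sets lborel" "\<Union> A = space lborel" "\<forall>a\<in>A. emeasure lborel a \<noteq> \<infinity>"
    using lborel.sigma_finite_countable by blast
  then show "\<exists>A::real set set. countable A \<and> A \<subseteq> sets lebesgue \<and> \<Union> A = space lebesgue \<and> (\<forall>a\<in>A. emeasure lebesgue a \<noteq> \<infinity>)"
    by (intro exI[of _ A]) (auto simp: subset_eq)
qed

interpretation lebesgue: sigma_finite_measure "lebesgue :: real measure"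
  by (rule sigma_finite_lebesgue)

interpretation lebesgue_pair: pair_sigma_finite "lebesgue :: real measure" "lebesgue :: real measure" ..

lemma integrable_times_pair:
  fixes g h :: "real \<Rightarrow> complex"
  assumes "integrable lebesgue g" "integrable lebesgue h"
  shows "integrable (lebesgue \<Otimes>\<^sub>M lebesgue) (\<lambda>(t, s). g t * h s)"
proof (rule lebesgue_pair.Fubini_integrable)
  have [measurable]: "g \<in> borel_measurable lebesgue" "h \<in> borel_measurable lebesgue" using assms by auto
  show "(\<lambda>(t, s). g t * h s) \<in> borel_measurable (lebesgue \<Otimes>\<^sub>M lebesgue)" by measurable
  show "integrable lebesgue (\<lambda>x. \<integral>y. norm (case (x, y) of (t, s) \<Rightarrow> g t * h s) \<partial>lebesgue)"
    using assms by (auto simp: norm_mult)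
qed (use assms in auto)

text \<open>Both sides are the integral of \<open>g t * h s\<close> over the triangle
  \<open>x \<le> s \<le> t \<le> y\<close>, computed in the two orders.\<close>

lemma integral_triangle_swap:
  fixes g h :: "real \<Rightarrow> complex"
  assumes g: "set_integrable lebesgue {x..y} g" and h: "set_integrable lebesgue {x..y} h"
  shows "(LINT t:{x..y}|lebesgue. g t * (LINT s:{x..t}|lebesgue. h s)) =
    (LINT s:{x..y}|lebesgue. h s * (LINT t:{s..y}|lebesgue. g t))"
proof -
  define g' h' where "g' = (\<lambda>t. indicat_real {x..y} t *\<^sub>R g t)" and "h' = (\<lambda>t. indicat_real {x..y} t *\<^sub>R h t)"
  have i: "integrable lebesgue g'" "integrable lebesgue h'"
    using g h by (auto simp: set_integrable_def g'_def h'_def)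
  have [measurable]: "g' \<in> borel_measurable lebesgue" "h' \<in> borel_measurable lebesgue" using i by auto
  define f where "f t s = (if s \<le> t then g' t * h' s else 0)" for t s
  have "integrable (lebesgue \<Otimes>\<^sub>M lebesgue) (case_prod f)"
  proof (rule Bochner_Integration.integrable_bound[OF integrable_times_pair[OF i]])
    show "case_prod f \<in> borel_measurable (lebesgue \<Otimes>\<^sub>M lebesgue)"
      unfolding f_def by measurable
  qed (auto simp: f_def)
  then have *: "(\<integral>s. (\<integral>t. f t s \<partial>lebesgue) \<partial>lebesgue) = (\<integral>t. (\<integral>s. f t s \<partial>lebesgue) \<partial>lebesgue)"
    by (rule lebesgue_pair.Fubini_integral)
  have 1: "(\<integral>s. f t s \<partial>lebesgue) = indicat_real {x..y} t *\<^sub>R (g t * (LINT s:{x..t}|lebesgue. h s))" for t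
  proof (cases "t \<in> {x..y}")
    case True
    then have "(\<lambda>s. f t s) = (\<lambda>s. g t * (indicat_real {x..t} s *\<^sub>R h s))"
      by (auto simp: f_def g'_def h'_def indicator_def)
    then have "(\<integral>s. f t s \<partial>lebesgue) = g t * (LINT s:{x..t}|lebesgue. h s)"
      unfolding set_lebesgue_integral_def by (simp only: integral_mult_right_zero)
    with True show ?thesis by simp
  next
    case False
    then have "f t = (\<lambda>s. 0)" by (auto simp: f_def g'_def)
    with False show ?thesis by simp
  qed
  have 2: "(\<integral>t. f t s \<partial>lebesgue) = indicat_real {x..y} s *\<^sub>R (h s * (LINT t:{s..y}|lebesgue. g t))" for s
  proof (cases "s \<in> {x..y}")
    case True
    then have "(\<lambda>t. f t s) = (\<lambda>t. h s * (indicat_real {s..y} t *\<^sub>R g t))"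
      by (auto simp: f_def g'_def h'_def indicator_def)
    then have "(\<integral>t. f t s \<partial>lebesgue) = h s * (LINT t:{s..y}|lebesgue. g t)"
      unfolding set_lebesgue_integral_def by (simp only: integral_mult_right_zero)
    with True show ?thesis by simp
  next
    case False
    then have "(\<lambda>t. f t s) = (\<lambda>s. 0)" by (auto simp: f_def h'_def)
    with False show ?thesis by simp
  qed
  show ?thesis using * unfolding 1 2 by (simp add: set_lebesgue_integral_def)
qed

text \<open>No pointwise differentiation is involved. Writing \<open>v t - v x\<close> as an
  integral of \<open>h\<close> and swapping the triangle turns it into the integral of
  \<open>g\<close> over \<open>{s..y}\<close>, that is \<open>u y - u s\<close>; expanding both
  sides gives integration by parts.\<close>

lemma AC_mult:
  assumes u: "AC_loc_with u g" and v: "AC_loc_with v h"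
  shows "AC_loc_with (\<lambda>x. u x * v x) (\<lambda>x. g x * v x + u x * h x)"
  unfolding AC_loc_with_iff
proof (intro conjI allI impI)
  have gv: "loc_int (\<lambda>x. g x * v x)"
    using loc_int_mult_bdd[OF AC_loc_int[OF u] AC_loc_bdd[OF v]] by (simp add: mult.commute)
  have uh: "loc_int (\<lambda>x. u x * h x)"
    using loc_int_mult_bdd[OF AC_loc_int[OF v] AC_loc_bdd[OF u]] by simp
  show "loc_int (\<lambda>x. g x * v x + u x * h x)" by (intro loc_int_add gv uh)
  fix x y :: real assume "x \<le> y"
  note ig = loc_intD(2)[OF AC_loc_int[OF u]] and ih = loc_intD(2)[OF AC_loc_int[OF v]]
  have "(LINT t:{x..y}|lebesgue. g t * (v t - v x)) = (LINT t:{x..y}|lebesgue. g t * (LINT s:{x..t}|lebesgue. h s))"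
    using v by (intro set_lebesgue_integral_cong) (auto simp: AC_loc_with_iff)
  also have "\<dots> = (LINT s:{x..y}|lebesgue. h s * (LINT t:{s..y}|lebesgue. g t))"
    by (rule integral_triangle_swap[OF ig ih])
  also have "\<dots> = (LINT s:{x..y}|lebesgue. h s * (u y - u s))"
    using u by (intro set_lebesgue_integral_cong) (auto simp: AC_loc_with_iff)
  finally have *: "(LINT t:{x..y}|lebesgue. g t * (v t - v x)) = (LINT s:{x..y}|lebesgue. h s * (u y - u s))" .
  have gvi: "set_integrable lebesgue {x..y} (\<lambda>t. g t * v t)" and uhi: "set_integrable lebesgue {x..y} (\<lambda>t. u t * h t)"
    using loc_intD(2)[OF gv] loc_intD(2)[OF uh] by auto
  have U: "u y - u x = (LINT t:{x..y}|lebesgue. g t)" and V: "v y - v x = (LINT t:{x..y}|lebesgue. h t)"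
    using u v \<open>x \<le> y\<close> by (auto simp: AC_loc_with_iff)
  have 1: "(LINT t:{x..y}|lebesgue. g t * (v t - v x)) = (LINT t:{x..y}|lebesgue. g t * v t) - (u y - u x) * v x"
    using set_integral_diff(2)[OF gvi set_integrable_mult_left[where a="v x", OF ig]]
    by (simp add: right_diff_distrib U)
  have 2: "(LINT s:{x..y}|lebesgue. h s * (u y - u s)) = u y * (v y - v x) - (LINT s:{x..y}|lebesgue. u s * h s)"
    using set_integral_diff(2)[OF set_integrable_mult_right[where a="u y", OF ih] uhi]
    by (simp add: right_diff_distrib V mult.commute)
  have sum: "(LINT t:{x..y}|lebesgue. g t * v t + u t * h t) = (LINT t:{x..y}|lebesgue. g t * v t) + (LINT s:{x..y}|lebesgue. u s * h s)"
    by (rule set_integral_add(2)[OF gvi uhi])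
  have "a - (u y - u x) * v x = u y * (v y - v x) - b \<Longrightarrow> u y * v y - u x * v x = a + b" for a b
    by (simp add: algebra_simps)
  from this[OF *[unfolded 1 2]]
  show "u y * v y - u x * v x = (LINT t:{x..y}|lebesgue. g t * v t + u t * h t)"
    unfolding sum .
qed

text \<open>The sets on which \<open>G\<close> integrates to zero contain the half-open intervals,
  which are closed under intersection and generate the Borel sets, and they are closed under
  complements and disjoint countable unions.\<close>

lemma integral_zero_Ioc_imp_zero:
  fixes G :: "real \<Rightarrow> complex"
  assumes iG: "integrable lebesgue G" and zero: "\<And>x y. set_lebesgue_integral lebesgue {x<..y} G = 0"
  shows "AE x in lebesgue. G x = 0"
proof (rule lebesgue.density_zero[OF iG])
  have [measurable]: "G \<in> borel_measurable lebesgue" using iG by auto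
  have sG: "set_integrable lebesgue A G" if "A \<in> sets lebesgue" for A
    using that integrable_mult_indicator[OF _ iG] by (simp add: set_integrable_def)
  \<comment> \<open>The whole line is not a half-open interval, yet its integral is needed for
    complements; it is reached by exhaustion.\<close>
  have UNIV0: "set_lebesgue_integral lebesgue UNIV G = 0"
  proof (rule LIMSEQ_unique)
    let ?A = "\<lambda>n::nat. {-real n<..real n}"
    have U: "(\<Union>n. ?A n) = UNIV"
    proof (safe; clarsimp)
      fix x :: real
      obtain n where "\<bar>x\<bar> < real n" using reals_Archimedean2 by blast
      then show "\<exists>n. - real n < x \<and> x \<le> real n" by (intro exI[of _ n]) auto
    qed
    have "(\<lambda>n. set_lebesgue_integral lebesgue (?A n) G) \<longlonglongrightarrow> set_lebesgue_integral lebesgue (\<Union>n. ?A n) G"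
      by (rule set_integral_cont_up) (auto simp: incseq_def intro!: sG)
    then show "(\<lambda>n. 0) \<longlonglongrightarrow> set_lebesgue_integral lebesgue UNIV G" by (simp only: U zero)
  qed auto
  have borel: "set_lebesgue_integral lebesgue A G = 0" if "A \<in> sets borel" for A
  proof -
    let ?E = "range (\<lambda>(a, b). {a<..b::real})"
    have st: "Int_stable ?E"
    proof (rule Int_stableI)
      fix a b assume "a \<in> ?E" "b \<in> ?E"
      then obtain c d e f where "a = {c<..d}" "b = {e<..f}" by auto
      then have "a \<inter> b = (\<lambda>(a, b). {a<..b}) (max c e, min d f)" by auto
      then show "a \<inter> b \<in> ?E" by blast
    qed
    have A: "A \<in> sigma_sets UNIV ?E"
      using that unfolding borel_sigma_sets_Ioc by (simp add: sets_measure_of)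
    have B: "B \<in> sets borel" if "B \<in> sigma_sets UNIV ?E" for B
      using that unfolding borel_sigma_sets_Ioc by (simp add: sets_measure_of)
    have P: "?E \<subseteq> Pow UNIV" by auto
    show ?thesis
      using st P A
    proof (induct rule: sigma_sets_induct_disjoint)
      case (compl A)
      have "set_lebesgue_integral lebesgue (A \<union> (UNIV - A)) G = set_lebesgue_integral lebesgue A G + set_lebesgue_integral lebesgue (UNIV - A) G"
        using B[OF compl(1)] by (intro set_integral_Un sG) auto
      moreover have "A \<union> (UNIV - A) = UNIV" by auto
      ultimately show ?case using compl UNIV0 by simp
    next
      case (union F)
      have "set_lebesgue_integral lebesgue (\<Union>i. F i) G = (\<Sum>i. set_lebesgue_integral lebesgue (F i) G)"
      proof (intro lebesgue_integral_countable_add sG)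
        have F: "F i \<in> sets lebesgue" for i
          using B[of "F i"] union(2) by (intro sets_completionI_sets) auto
        then show "F i \<in> sets lebesgue" for i .
        show "(\<Union>i. F i) \<in> sets lebesgue" using F by blast
        show "F i \<inter> F j = {}" if "i \<noteq> j" for i j
          using union(1) that by (auto simp: disjoint_family_on_def)
      qed
      with union show ?case by simp
    next
      case (basic A)
      then show ?case using zero by auto
    qed (simp add: set_lebesgue_integral_def)
  qed
  \<comment> \<open>A Lebesgue set differs from its Borel main part by a null set only.\<close>
  fix A :: "real set" assume A: "A \<in> sets lebesgue"
  have "AE x in lebesgue. (x \<in> A) = (x \<in> main_part lborel A)"
    using AE_notin_null_part[OF A] main_part_null_part_Un[OF A]
    by (auto simp: AE_completion_iff elim!: eventually_mono)
  moreover have "main_part lborel A \<in> sets borel" using main_part_sets[OF A] by simp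
  ultimately show "set_lebesgue_integral lebesgue A G = 0"
    using borel[of "main_part lborel A"] A set_integral_cong_set[of lebesgue A G "main_part lborel A"]
    by (auto simp: set_borel_measurable_def)
qed

text \<open>On a closed interval inside \<open>S\<close> every integral of \<open>g\<close> is a
  difference of two values of \<open>u\<close>, hence zero. This replaces differentiation almost
  everywhere.\<close>

lemma AC_locally_zero:
  assumes u: "AC_loc_with u g" and z: "\<And>x. x \<in> S \<Longrightarrow> u x = 0" and S: "open S"
  shows "AE x in lebesgue. x \<in> S \<longrightarrow> g x = 0"
proof -
  have box: "AE x in lebesgue. x \<in> {c..d} \<longrightarrow> g x = 0" if cd: "{c..d} \<subseteq> S" for c d
  proof -
    define G where "G x = indicat_real {c..d} x *\<^sub>R g x" for x
    have iG: "integrable lebesgue G"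
      using loc_intD(2)[OF AC_loc_int[OF u], of c d] unfolding set_integrable_def G_def .
    have zero: "set_lebesgue_integral lebesgue {x<..y} G = 0" for x y
    proof -
      have "set_lebesgue_integral lebesgue {x<..y} G = set_lebesgue_integral lebesgue ({x<..y} \<inter> {c..d}) g"
        by (simp add: set_lebesgue_integral_def G_def indicator_inter_arith)
      also have "\<dots> = set_lebesgue_integral lebesgue {max x c..min y d} g"
      proof (rule set_integral_cong_set)
        show "set_borel_measurable lebesgue ({x<..y} \<inter> {c..d}) g"
          using loc_intD(1)[OF AC_loc_int[OF u]] unfolding set_borel_measurable_def by measurable
        show "set_borel_measurable lebesgue {max x c..min y d} g"
          using loc_intD(1)[OF AC_loc_int[OF u]] unfolding set_borel_measurable_def by measurable
        show "AE t in lebesgue. (t \<in> {max x c..min y d}) = (t \<in> {x<..y} \<inter> {c..d})"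
          by (rule AE_I'[of "{x}"]) auto
      qed
      also have "\<dots> = 0"
      proof (cases "max x c \<le> min y d")
        case True
        then have "max x c \<in> S" "min y d \<in> S" using cd by auto
        then have "u (min y d) - u (max x c) = 0" using z by auto
        with u True show ?thesis unfolding AC_loc_with_iff by metis
      qed (simp add: set_lebesgue_integral_def)
      finally show ?thesis .
    qed
    have "AE x in lebesgue. G x = 0"
      by (rule integral_zero_Ioc_imp_zero[OF iG zero])
    then show ?thesis by eventually_elim (auto simp: G_def)
  qed
  \<comment> \<open>Rational end points leave countably many intervals, so the exceptional null sets
    can be united.\<close>
  have "AE x in lebesgue. \<forall>q\<in>\<rat>. \<forall>r\<in>\<rat>. {q..r} \<subseteq> S \<longrightarrow> x \<in> {q..r} \<longrightarrow> g x = 0"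
    using box by (simp add: AE_ball_countable countable_rat)
  moreover have "\<exists>q\<in>\<rat>. \<exists>r\<in>\<rat>. {q..r} \<subseteq> S \<and> x \<in> {q..r}" if "x \<in> S" for x
  proof -
    obtain e where e: "e > 0" "ball x e \<subseteq> S" using S \<open>x \<in> S\<close> by (meson openE)
    obtain q r where "q \<in> \<rat>" "x - e < q" "q < x" "r \<in> \<rat>" "x < r" "r < x + e"
      using Rats_dense_in_real[of "x - e" x] Rats_dense_in_real[of x "x + e"] e by auto
    moreover from this have "{q..r} \<subseteq> ball x e" by (auto simp: dist_real_def)
    ultimately show ?thesis using e by (intro bexI[of _ q] bexI[of _ r]) auto
  qed
  ultimately show ?thesis by (elim eventually_mono) blast
qed

section \<open>Linear systems with locally integrable coefficients\<close>

lemma prim_add: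
  assumes "loc_int f" "loc_int g"
  shows "prim c (\<lambda>x. f x + g x) t = prim c f t + prim c g t"
  using set_integral_add(2)[OF loc_intD(2)[OF assms(1)] loc_intD(2)[OF assms(2)]]
  by (simp add: prim_def)

lemma AC_power:
  assumes "AC_loc_with u g"
  shows "AC_loc_with (\<lambda>x. u x ^ Suc n) (\<lambda>x. of_nat (Suc n) * u x ^ n * g x)"
proof (induction n)
  case (Suc n)
  show ?case
    using AC_mult[OF assms Suc.IH]
    by (rule AC_cong_AE[rotated, THEN iffD1[OF arg_cong[where f="\<lambda>f. AC_loc_with f _"], rotated], rotated])
       (auto simp: algebra_simps intro!: AE_I2)
qed (use assms in simp)

lemma set_integrable_complex_of_real_iff:
  "set_integrable M S (\<lambda>x. complex_of_real (f x)) \<longleftrightarrow> set_integrable M S f"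
proof -
  have "(\<lambda>x. indicat_real S x *\<^sub>R complex_of_real (f x)) = (\<lambda>x. complex_of_real (indicat_real S x *\<^sub>R f x))"
    by (auto simp: scaleR_conv_of_real)
  then show ?thesis unfolding set_integrable_def by (simp only: complex_of_real_integrable_eq)
qed

lemma norm_set_integral_le:
  fixes w :: "real \<Rightarrow> complex"
  assumes w: "set_integrable M S w" and G: "set_integrable M S G"
    and le: "AE s in M. s \<in> S \<longrightarrow> cmod (w s) \<le> G s"
  shows "cmod (LINT s:S|M. w s) \<le> (LINT s:S|M. G s)"
proof -
  have "cmod (LINT s:S|M. w s) \<le> (\<integral>s. cmod (indicat_real S s *\<^sub>R w s) \<partial>M)"
    unfolding set_lebesgue_integral_def by (rule integral_norm_bound)
  also have "\<dots> \<le> (\<integral>s. indicat_real S s *\<^sub>R G s \<partial>M)"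
  proof (rule integral_mono_AE)
    show "AE s in M. cmod (indicat_real S s *\<^sub>R w s) \<le> indicat_real S s *\<^sub>R G s"
      using le by eventually_elim (auto simp: indicator_def)
    show "integrable M (\<lambda>s. cmod (indicat_real S s *\<^sub>R w s))"
      using w unfolding set_integrable_def by (rule integrable_norm)
  qed (use G in \<open>simp add: set_integrable_def\<close>)
  finally show ?thesis by (simp add: set_lebesgue_integral_def)
qed

text \<open>Used for two purposes: the summed moduli of the coefficients give the growth scale of
  the Picard iteration, and later a nonnegative \<open>\<sigma>'\<close> gives the monotone cut-off
  \<open>\<sigma>\<close> as its primitive.\<close>

locale weight =
  fixes \<mu> :: "real \<Rightarrow> real" and c :: real
  assumes wt_loc_int: "loc_int (\<lambda>t. of_real (\<mu> t))" and wt_nonneg: "0 \<le> \<mu> t"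
begin

definition wt_prim :: "real \<Rightarrow> real" where
  "wt_prim t = Re (prim c (\<lambda>t. of_real (\<mu> t)) t)"

lemma of_real_wt_prim: "of_real (wt_prim t) = prim c (\<lambda>t. of_real (\<mu> t)) t"
  by (simp add: wt_prim_def prim_def set_integral_complex_of_real)

lemma AC_wt_prim: "AC_loc_with (\<lambda>t. of_real (wt_prim t)) (\<lambda>t. of_real (\<mu> t))"
  unfolding of_real_wt_prim by (rule AC_prim[OF wt_loc_int])

lemma wt_prim_c [simp]: "wt_prim c = 0"
  by (simp add: wt_prim_def)

lemma wt_set_integrable: "set_integrable lebesgue {x..y} \<mu>"
  using loc_intD(2)[OF wt_loc_int, of x y] by (simp only: set_integrable_complex_of_real_iff)

lemma wt_prim_diff:
  assumes "x \<le> y"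
  shows "wt_prim y - wt_prim x = (LINT t:{x..y}|lebesgue. \<mu> t)"
proof -
  have "complex_of_real (wt_prim y - wt_prim x) = of_real (LINT t:{x..y}|lebesgue. \<mu> t)"
    using AC_wt_prim assms by (simp add: AC_loc_with_iff set_integral_complex_of_real)
  then show ?thesis by (simp only: of_real_eq_iff)
qed

lemma wt_prim_mono:
  assumes "x \<le> y"
  shows "wt_prim x \<le> wt_prim y"
proof -
  have "(LINT t:{x..y}|lebesgue. \<mu> t) \<ge> 0"
    unfolding set_lebesgue_integral_def by (intro integral_nonneg_AE AE_I2) (auto simp: wt_nonneg)
  with wt_prim_diff[OF assms] show ?thesis by simp
qed

text \<open>The integrand is, up to a factor, the derivative of a power. The sign
  \<open>\<sigma>\<close> is meant to make \<open>\<sigma> * wt_prim\<close> the absolute value on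
  one side of \<open>c\<close>; since its square is 1, dividing by it is multiplying by it.\<close>

lemma wt_integral_power:
  fixes \<sigma> :: real
  assumes "x \<le> y" "\<sigma>\<^sup>2 = 1"
  shows "set_integrable lebesgue {x..y} (\<lambda>s. (\<sigma> * wt_prim s) ^ n * \<mu> s)"
    and "(LINT s:{x..y}|lebesgue. (\<sigma> * wt_prim s) ^ n * \<mu> s) =
      \<sigma> * ((\<sigma> * wt_prim y) ^ Suc n - (\<sigma> * wt_prim x) ^ Suc n) / Suc n"
proof -
  have \<sigma>: "\<sigma> * \<sigma> = 1" using assms(2) by (simp add: power2_eq_square)
  have AC: "AC_loc_with (\<lambda>s. (of_real \<sigma> * of_real (wt_prim s)) ^ Suc n)
     (\<lambda>s. of_nat (Suc n) * (of_real \<sigma> * of_real (wt_prim s)) ^ n * (of_real \<sigma> * of_real (\<mu> s)))"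
    by (intro AC_power AC_cmult AC_wt_prim)
  let ?G = "\<lambda>s. Suc n * (\<sigma> * wt_prim s) ^ n * (\<sigma> * \<mu> s)"
  have "set_integrable lebesgue {x..y} (\<lambda>s. complex_of_real (?G s))"
    using loc_intD(2)[OF AC_loc_int[OF AC], of x y] by simp
  then have "set_integrable lebesgue {x..y} ?G"
    by (simp only: set_integrable_complex_of_real_iff)
  then have "set_integrable lebesgue {x..y} (\<lambda>s. (\<sigma> / Suc n) * ?G s)"
    by (rule set_integrable_mult_right)
  moreover have eq: "(\<sigma> / Suc n) * ?G s = (\<sigma> * wt_prim s) ^ n * \<mu> s" for s
  proof -
    have "(\<sigma> / Suc n) * ?G s = (\<sigma> * \<sigma>) * ((\<sigma> * wt_prim s) ^ n * \<mu> s)"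
      by (simp add: field_simps del: of_nat_Suc)
    then show ?thesis by (simp only: \<sigma> mult_1)
  qed
  ultimately show "set_integrable lebesgue {x..y} (\<lambda>s. (\<sigma> * wt_prim s) ^ n * \<mu> s)" by (simp only: eq)
  have "complex_of_real ((\<sigma> * wt_prim y) ^ Suc n - (\<sigma> * wt_prim x) ^ Suc n) =
     (LINT s:{x..y}|lebesgue. complex_of_real (?G s))"
    using AC assms(1) unfolding AC_loc_with_iff by simp
  also have "\<dots> = complex_of_real (LINT s:{x..y}|lebesgue. ?G s)"
    by (rule set_integral_complex_of_real)
  finally have "(\<sigma> * wt_prim y) ^ Suc n - (\<sigma> * wt_prim x) ^ Suc n = (LINT s:{x..y}|lebesgue. ?G s)"
    by (simp only: of_real_eq_iff)
  then have "(\<sigma> / Suc n) * ((\<sigma> * wt_prim y) ^ Suc n - (\<sigma> * wt_prim x) ^ Suc n) = (LINT s:{x..y}|lebesgue. (\<sigma> / Suc n) * ?G s)"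
    by (simp only: set_integral_mult_right)
  then show "(LINT s:{x..y}|lebesgue. (\<sigma> * wt_prim s) ^ n * \<mu> s) =
      \<sigma> * ((\<sigma> * wt_prim y) ^ Suc n - (\<sigma> * wt_prim x) ^ Suc n) / Suc n"
    unfolding eq by simp
qed

text \<open>The induction step of every Picard estimate: integrating against the weight raises the
  power of \<open>wt_prim\<close> by one and turns \<open>fact n\<close> into
  \<open>fact (Suc n)\<close>.\<close>

lemma prim_power_bound:
  assumes w: "loc_int w"
    and le: "AE s in lebesgue. s \<in> {l..r} \<longrightarrow> cmod (w s) \<le> \<mu> s * (K * \<bar>wt_prim s\<bar> ^ n / fact n)"
    and c: "c \<in> {l..r}" and t: "t \<in> {l..r}"
  shows "cmod (prim c w t) \<le> K * \<bar>wt_prim t\<bar> ^ Suc n / fact (Suc n)"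
proof -
  define \<sigma> :: real where "\<sigma> = (if c \<le> t then 1 else -1)"
  define lo hi where "lo = min c t" and "hi = max c t"
  have \<sigma>: "\<sigma>\<^sup>2 = 1" by (simp add: \<sigma>_def)
  have abs: "\<bar>wt_prim s\<bar> = \<sigma> * wt_prim s" if "s \<in> {lo..hi}" for s
    using that wt_prim_mono[of c s] wt_prim_mono[of s c] by (auto simp: \<sigma>_def lo_def hi_def split: if_splits)
  have lohi: "lo \<le> hi" by (simp add: lo_def hi_def)
  have "cmod (prim c w t) = cmod (LINT s:{lo..hi}|lebesgue. w s)"
    by (simp add: prim_def lo_def hi_def)
  also have "\<dots> \<le> (LINT s:{lo..hi}|lebesgue. (K / fact n) * ((\<sigma> * wt_prim s) ^ n * \<mu> s))"
  proof (rule norm_set_integral_le[OF loc_intD(2)[OF w]])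
    show "set_integrable lebesgue {lo..hi} (\<lambda>s. (K / fact n) * ((\<sigma> * wt_prim s) ^ n * \<mu> s))"
      by (intro set_integrable_mult_right wt_integral_power(1)[OF lohi \<sigma>])
    show "AE s in lebesgue. s \<in> {lo..hi} \<longrightarrow> cmod (w s) \<le> (K / fact n) * ((\<sigma> * wt_prim s) ^ n * \<mu> s)"
      using le
    proof eventually_elim
      case (elim s)
      show ?case
      proof
        assume s: "s \<in> {lo..hi}"
        then have "s \<in> {l..r}" using c t by (auto simp: lo_def hi_def)
        with elim abs[OF s] show "cmod (w s) \<le> (K / fact n) * ((\<sigma> * wt_prim s) ^ n * \<mu> s)"
          by (simp add: mult_ac)
      qed
    qed
  qed
  also have "\<dots> = (K / fact n) * (\<sigma> * ((\<sigma> * wt_prim hi) ^ Suc n - (\<sigma> * wt_prim lo) ^ Suc n) / Suc n)"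
    by (simp only: set_integral_mult_right wt_integral_power(2)[OF lohi \<sigma>])
  also have "\<sigma> * ((\<sigma> * wt_prim hi) ^ Suc n - (\<sigma> * wt_prim lo) ^ Suc n) = \<bar>wt_prim t\<bar> ^ Suc n"
    using abs[of t] by (auto simp: lo_def hi_def \<sigma>_def max_def min_def)
  finally show ?thesis by (simp add: field_simps)
qed

end

section \<open>Uniqueness and existence for first-order linear systems\<close>

lemma power_fact_tendsto_0: "(\<lambda>n. K * (x::real) ^ n / fact n) \<longlonglongrightarrow> 0"
proof -
  have "(\<lambda>n. K * (inverse (fact n) * x ^ n)) \<longlonglongrightarrow> K * 0"
    by (intro tendsto_mult_left summable_LIMSEQ_zero summable_exp)
  then show ?thesis by (simp add: field_simps)
qed

text \<open>The four functions are the coefficient matrix, row by row, of the system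
  \<open>x' = A x + B y\<close>, \<open>y' = C x + D y\<close>.\<close>

locale linear_system =
  fixes A B C D :: "real \<Rightarrow> complex"
  assumes coeff: "loc_int A" "loc_int B" "loc_int C" "loc_int D"
begin

definition \<mu> :: "real \<Rightarrow> real" where
  "\<mu> t = cmod (A t) + cmod (B t) + cmod (C t) + cmod (D t)"

lemma loc_int_cmod: "loc_int f \<Longrightarrow> loc_int (\<lambda>t. complex_of_real (cmod (f t)))"
proof (rule loc_int_bound[where G="\<lambda>t. cmod (f t)"])
  assume f: "loc_int f"
  show "(\<lambda>t. complex_of_real (cmod (f t))) \<in> borel_measurable lebesgue"
    using loc_intD(1)[OF f] by measurable
  show "set_integrable lebesgue {a..b} (\<lambda>t. cmod (f t))" for a b
    by (rule set_integrable_norm[OF loc_intD(2)[OF f]])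
qed auto

lemma weight: "weight \<mu>"
proof
  show "loc_int (\<lambda>t. complex_of_real (\<mu> t))"
    unfolding \<mu>_def of_real_add by (intro loc_int_add loc_int_cmod coeff)
qed (simp add: \<mu>_def)

lemma row_bound:
  assumes "cmod x \<le> k" "cmod y \<le> k"
  shows "cmod (A t * x + B t * y) \<le> \<mu> t * k" "cmod (C t * x + D t * y) \<le> \<mu> t * k"
proof -
  have k: "0 \<le> k" using assms(1) norm_ge_zero order_trans by blast
  have "cmod (a * x + b * y) \<le> cmod a * k + cmod b * k" for a b
    using assms by (intro order_trans[OF norm_triangle_ineq] add_mono) (auto simp: norm_mult mult_left_mono)
  moreover have "cmod (A t) * k + cmod (B t) * k \<le> \<mu> t * k" "cmod (C t) * k + cmod (D t) * k \<le> \<mu> t * k"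
    unfolding \<mu>_def by (auto simp: distrib_right[symmetric] k intro!: mult_right_mono)
  ultimately show "cmod (A t * x + B t * y) \<le> \<mu> t * k" "cmod (C t * x + D t * y) \<le> \<mu> t * k"
    by (meson order_trans)+
qed

text \<open>With zero data at \<open>c\<close> the solution equals the primitive of its own row, so
  a bound \<open>K\<close> improves to \<open>K * \<bar>wt_prim t\<bar> ^ n / fact n\<close> for
  every \<open>n\<close>. Requiring the equation only on \<open>{l..r}\<close> allows continuation
  by zero beyond the support of a right-hand side.\<close>

lemma unique_zero:
  assumes x: "AC_loc_with x gx" and y: "AC_loc_with y gy"
    and gx: "AE t in lebesgue. t \<in> {l..r} \<longrightarrow> gx t = A t * x t + B t * y t"
    and gy: "AE t in lebesgue. t \<in> {l..r} \<longrightarrow> gy t = C t * x t + D t * y t"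
    and c: "c \<in> {l..r}" "x c = 0" "y c = 0" and t: "t \<in> {l..r}"
  shows "x t = 0 \<and> y t = 0"
proof -
  interpret weight \<mu> c by (rule weight)
  obtain K1 K2 where "\<And>s. s \<in> {l..r} \<Longrightarrow> cmod (x s) \<le> K1" "\<And>s. s \<in> {l..r} \<Longrightarrow> cmod (y s) \<le> K2"
    using AC_loc_bdd[OF x] AC_loc_bdd[OF y] unfolding loc_bdd_def by meson
  then obtain K where K: "\<And>s. s \<in> {l..r} \<Longrightarrow> cmod (x s) \<le> K" "\<And>s. s \<in> {l..r} \<Longrightarrow> cmod (y s) \<le> K"
    by (metis max.coboundedI1 max.coboundedI2)
  have "\<forall>s\<in>{l..r}. cmod (x s) \<le> K * \<bar>wt_prim s\<bar> ^ n / fact n \<and> cmod (y s) \<le> K * \<bar>wt_prim s\<bar> ^ n / fact n" for n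
  proof (induction n)
    case (Suc n)
    show ?case
    proof (intro ballI conjI)
      fix s assume s: "s \<in> {l..r}"
      have "cmod (prim c gx s) \<le> K * \<bar>wt_prim s\<bar> ^ Suc n / fact (Suc n)"
        by (rule prim_power_bound[OF AC_loc_int[OF x] eventually_mono[OF gx] c(1) s])
           (use Suc.IH row_bound(1) in \<open>auto simp del: times_divide_eq_right\<close>)
      then show "cmod (x s) \<le> K * \<bar>wt_prim s\<bar> ^ Suc n / fact (Suc n)"
        using AC_eq_prim[OF x, of s c] c by simp
      have "cmod (prim c gy s) \<le> K * \<bar>wt_prim s\<bar> ^ Suc n / fact (Suc n)"
        by (rule prim_power_bound[OF AC_loc_int[OF y] eventually_mono[OF gy] c(1) s])
           (use Suc.IH row_bound(2) in \<open>auto simp del: times_divide_eq_right\<close>)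
      then show "cmod (y s) \<le> K * \<bar>wt_prim s\<bar> ^ Suc n / fact (Suc n)"
        using AC_eq_prim[OF y, of s c] c by simp
    qed
  qed (use K in simp)
  then have "cmod (x t) \<le> K * \<bar>wt_prim t\<bar> ^ n / fact n" "cmod (y t) \<le> K * \<bar>wt_prim t\<bar> ^ n / fact n" for n
    using t by auto
  then have "cmod (x t) \<le> 0" "cmod (y t) \<le> 0"
    by (intro LIMSEQ_le_const[OF power_fact_tendsto_0]; blast)+
  then show ?thesis by simp
qed

text \<open>These are the terms of the Picard series, not its partial sums: initial data and
  inhomogeneity sit in term 0 alone, and by linearity the solution is the sum.\<close>

fun picard :: "real \<Rightarrow> (real \<Rightarrow> complex) \<times> (real \<Rightarrow> complex) \<Rightarrow> nat \<Rightarrow> (real \<Rightarrow> complex) \<times> (real \<Rightarrow> complex)" where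
  "picard c z 0 = z"
| "picard c z (Suc n) =
    (prim c (\<lambda>t. A t * fst (picard c z n) t + B t * snd (picard c z n) t),
     prim c (\<lambda>t. C t * fst (picard c z n) t + D t * snd (picard c z n) t))"

lemma loc_int_rows:
  assumes "loc_bdd x" "loc_bdd y"
  shows "loc_int (\<lambda>t. A t * x t + B t * y t)" "loc_int (\<lambda>t. C t * x t + D t * y t)"
  using coeff assms loc_int_mult_bdd by (auto intro!: loc_int_add simp: mult.commute[of _ "x _"] mult.commute[of _ "y _"])

text \<open>Termwise integration is justified by the majorant \<open>\<mu> t * b n\<close>, a
  locally integrable function times the terms of a convergent series.\<close>

lemma prim_suminf:
  assumes w: "\<And>n. loc_int (w n)"
    and W: "\<And>l r. \<exists>b. summable b \<and> (\<forall>n. b n \<ge> 0) \<and> (\<forall>n. \<forall>t\<in>{l..r}. cmod (w n t) \<le> \<mu> t * b n)"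
    and lim: "loc_int (\<lambda>t. \<Sum>n. w n t)"
  shows "(\<lambda>n. prim c (w n) t) sums prim c (\<lambda>t. \<Sum>n. w n t) t"
proof -
  interpret weight \<mu> c by (rule weight)
  have "(\<lambda>n. LINT t:{l..r}|lebesgue. w n t) sums (LINT t:{l..r}|lebesgue. (\<Sum>n. w n t))" for l r
  proof -
    obtain b where b: "summable b" "\<And>n t. t \<in> {l..r} \<Longrightarrow> cmod (w n t) \<le> \<mu> t * b n" "\<And>n. b n \<ge> 0"
      using W[of l r] by blast
    have "(\<lambda>n. LINT t|lebesgue. indicat_real {l..r} t *\<^sub>R w n t) sums (LINT t|lebesgue. (\<Sum>n. indicat_real {l..r} t *\<^sub>R w n t))"
    proof (rule sums_integral)
      show "integrable lebesgue (\<lambda>t. indicat_real {l..r} t *\<^sub>R w n t)" for n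
        using loc_intD(2)[OF w] by (simp add: set_integrable_def)
      have "summable (\<lambda>n. cmod (indicat_real {l..r} t *\<^sub>R w n t))" for t
        by (rule summable_comparison_test'[where g="\<lambda>n. \<mu> t * b n" and N=0])
           (use b wt_nonneg in \<open>auto simp: indicator_def intro!: summable_mult mult_nonneg_nonneg\<close>)
      then show "AE t in lebesgue. summable (\<lambda>n. cmod (indicat_real {l..r} t *\<^sub>R w n t))" by simp
      show "summable (\<lambda>n. LINT t|lebesgue. cmod (indicat_real {l..r} t *\<^sub>R w n t))"
      proof (rule summable_comparison_test'[where g="\<lambda>n. (LINT t:{l..r}|lebesgue. \<mu> t) * b n" and N=0])
        show "summable (\<lambda>n. (LINT t:{l..r}|lebesgue. \<mu> t) * b n)" using b by (intro summable_mult)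
        fix n
        have "(LINT t|lebesgue. cmod (indicat_real {l..r} t *\<^sub>R w n t)) \<le> (LINT t:{l..r}|lebesgue. \<mu> t * b n)"
          unfolding set_lebesgue_integral_def
        proof (rule integral_mono)
          show "integrable lebesgue (\<lambda>t. indicat_real {l..r} t *\<^sub>R (\<mu> t * b n))"
            using set_integrable_mult_left[of "b n", OF wt_set_integrable, of l r] unfolding set_integrable_def by blast
          show "integrable lebesgue (\<lambda>t. cmod (indicat_real {l..r} t *\<^sub>R w n t))"
            using loc_intD(2)[OF w] unfolding set_integrable_def by (rule integrable_norm)
        qed (use b(2) in \<open>auto simp: indicator_def\<close>)
        then show "norm (LINT t|lebesgue. cmod (indicat_real {l..r} t *\<^sub>R w n t)) \<le> (LINT t:{l..r}|lebesgue. \<mu> t) * b n"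
          by simp
      qed
    qed
    moreover have "(\<Sum>n. indicat_real {l..r} t *\<^sub>R w n t) = indicat_real {l..r} t *\<^sub>R (\<Sum>n. w n t)" for t
      by (auto simp: indicator_def)
    ultimately show ?thesis by (simp add: set_lebesgue_integral_def)
  qed
  then show ?thesis by (auto simp: prim_def intro!: sums_minus)
qed

lemma exists_solution:
  assumes f: "loc_int f" and g: "loc_int g"
  obtains x y where "AC_loc_with x (\<lambda>t. A t * x t + B t * y t + f t)"
    "AC_loc_with y (\<lambda>t. C t * x t + D t * y t + g t)" "x c = x0" "y c = y0"
proof -
  interpret weight \<mu> c by (rule weight)
  define z where "z = ((\<lambda>t. x0 + prim c f t), (\<lambda>t. y0 + prim c g t))"
  define X Y where "X n = fst (picard c z n)" and "Y n = snd (picard c z n)" for n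
  have X0: "X 0 = (\<lambda>t. x0 + prim c f t)" "Y 0 = (\<lambda>t. y0 + prim c g t)" by (auto simp: X_def Y_def z_def)
  have XS: "X (Suc n) = prim c (\<lambda>t. A t * X n t + B t * Y n t)" "Y (Suc n) = prim c (\<lambda>t. C t * X n t + D t * Y n t)" for n
    by (auto simp: X_def Y_def)
  have bdd: "loc_bdd (X n) \<and> loc_bdd (Y n)" for n
  proof (induction n)
    case 0
    show ?case unfolding X0 
      by (intro conjI AC_loc_bdd[OF AC_add[OF AC_const AC_prim]] f g)
  next
    case (Suc n)
    then show ?case unfolding XS by (intro conjI AC_loc_bdd[OF AC_prim] loc_int_rows) auto
  qed
  have rows: "loc_int (\<lambda>t. A t * X n t + B t * Y n t)" "loc_int (\<lambda>t. C t * X n t + D t * Y n t)" for n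
    using bdd loc_int_rows by auto
  have bound: "\<exists>K\<ge>0. \<forall>n. \<forall>t\<in>{l..r}. cmod (X n t) \<le> K * \<bar>wt_prim t\<bar> ^ n / fact n \<and> cmod (Y n t) \<le> K * \<bar>wt_prim t\<bar> ^ n / fact n"
    if "c \<in> {l..r}" for l r
  proof -
    obtain K1 K2 where "K1 \<ge> 0" "\<And>s. s \<in> {l..r} \<Longrightarrow> cmod (X 0 s) \<le> K1" "\<And>s. s \<in> {l..r} \<Longrightarrow> cmod (Y 0 s) \<le> K2"
      using bdd[of 0] unfolding loc_bdd_def by meson
    then obtain K where K: "K \<ge> 0" "\<And>s. s \<in> {l..r} \<Longrightarrow> cmod (X 0 s) \<le> K" "\<And>s. s \<in> {l..r} \<Longrightarrow> cmod (Y 0 s) \<le> K"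
      by (metis max.coboundedI1 max.coboundedI2)
    have "\<forall>s\<in>{l..r}. cmod (X n s) \<le> K * \<bar>wt_prim s\<bar> ^ n / fact n \<and> cmod (Y n s) \<le> K * \<bar>wt_prim s\<bar> ^ n / fact n" for n
    proof (induction n)
      case (Suc n)
      then show ?case
        unfolding XS using row_bound
        by (intro ballI conjI prim_power_bound[OF rows(1) AE_I2 that] prim_power_bound[OF rows(2) AE_I2 that])
            (auto simp del: times_divide_eq_right)
    qed (use K in simp)
    with K show ?thesis by auto
  qed
  have unif: "\<exists>b. summable b \<and> (\<forall>n. b n \<ge> 0) \<and> (\<forall>n. \<forall>t\<in>{l..r}. cmod (X n t) \<le> b n \<and> cmod (Y n t) \<le> b n)" for l r
  proof -
    \<comment> \<open>The estimate of the terms requires an interval containing the base point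
      \<open>c\<close>.\<close>
    define l' r' where "l' = min l c" and "r' = max r c"
    have c: "c \<in> {l'..r'}" by (auto simp: l'_def r'_def)
    obtain K where K: "K \<ge> 0" "\<And>n t. t \<in> {l'..r'} \<Longrightarrow> cmod (X n t) \<le> K * \<bar>wt_prim t\<bar> ^ n / fact n"
      "\<And>n t. t \<in> {l'..r'} \<Longrightarrow> cmod (Y n t) \<le> K * \<bar>wt_prim t\<bar> ^ n / fact n"
      using bound[OF c] by blast
    define L where "L = max \<bar>wt_prim l'\<bar> \<bar>wt_prim r'\<bar>"
    have L: "\<bar>wt_prim t\<bar> \<le> L" if "t \<in> {l'..r'}" for t
      using wt_prim_mono[of l' t] wt_prim_mono[of t r'] that by (auto simp: L_def)
    have "K * \<bar>wt_prim t\<bar> ^ n / fact n \<le> K * L ^ n / fact n" if "t \<in> {l'..r'}" for t n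
      using L[OF that] K(1) by (intro divide_right_mono mult_left_mono power_mono) auto
    with K(2,3) have "\<forall>n. \<forall>t\<in>{l'..r'}. cmod (X n t) \<le> K * L ^ n / fact n \<and> cmod (Y n t) \<le> K * L ^ n / fact n"
      by (meson order_trans)
    moreover have "{l..r} \<subseteq> {l'..r'}" by (auto simp: l'_def r'_def)
    moreover have "summable (\<lambda>n. K * L ^ n / fact n)"
      using summable_mult[OF summable_exp[of L], of K] by (simp add: field_simps)
    moreover have "L \<ge> 0" by (simp add: L_def)
    ultimately show ?thesis using K(1) by (intro exI[of _ "\<lambda>n. K * L ^ n / fact n"]) auto
  qed
  have summ: "summable (\<lambda>n. X n t)" "summable (\<lambda>n. Y n t)" for t
  proof -
    obtain b where "summable b" "\<And>n. cmod (X n t) \<le> b n" "\<And>n. cmod (Y n t) \<le> b n"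
      using unif[of t t] by auto
    then show "summable (\<lambda>n. X n t)" "summable (\<lambda>n. Y n t)"
      by (auto intro: summable_comparison_test'[where g=b and N=0])
  qed
  define x y where "x t = (\<Sum>n. X n t)" and "y t = (\<Sum>n. Y n t)" for t
  have lb: "loc_bdd x" "loc_bdd y"
  proof -
    have [measurable]: "X n \<in> borel_measurable lebesgue" "Y n \<in> borel_measurable lebesgue" for n
      using bdd by (auto simp: loc_bdd_def)
    have m: "x \<in> borel_measurable lebesgue" "y \<in> borel_measurable lebesgue"
      unfolding x_def y_def by measurable
    have "\<exists>B\<ge>0. \<forall>t\<in>{l..r}. cmod (x t) \<le> B \<and> cmod (y t) \<le> B" for l r
    proof -
      obtain b where b: "summable b" "\<And>n. b n \<ge> 0" "\<And>n t. t \<in> {l..r} \<Longrightarrow> cmod (X n t) \<le> b n"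
         "\<And>n t. t \<in> {l..r} \<Longrightarrow> cmod (Y n t) \<le> b n"
        using unif[of l r] by blast
      have "cmod (x t) \<le> suminf b" "cmod (y t) \<le> suminf b" if "t \<in> {l..r}" for t
        unfolding x_def y_def using b that by (auto intro!: norm_suminf_le)
      then show ?thesis using b by (intro exI[of _ "suminf b"]) (auto intro: suminf_nonneg)
    qed
    with m show "loc_bdd x" "loc_bdd y" unfolding loc_bdd_def by meson+
  qed
  have wsum: "(\<Sum>n. A t * X n t + B t * Y n t) = A t * x t + B t * y t"
    "(\<Sum>n. C t * X n t + D t * Y n t) = C t * x t + D t * y t" for t
    unfolding x_def y_def using summ
    by (simp_all add: suminf_add[symmetric] suminf_mult summable_mult)
  have dom: "\<exists>b. summable b \<and> (\<forall>n. b n \<ge> 0) \<and> (\<forall>n. \<forall>t\<in>{l..r}. cmod (A t * X n t + B t * Y n t) \<le> \<mu> t * b n)"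
     "\<exists>b. summable b \<and> (\<forall>n. b n \<ge> 0) \<and> (\<forall>n. \<forall>t\<in>{l..r}. cmod (C t * X n t + D t * Y n t) \<le> \<mu> t * b n)" for l r
    using unif[of l r] row_bound by meson+
  \<comment> \<open>Integrating the summed rows shifts the series by one index; restoring term 0
    yields the integral equation.\<close>
  have tails: "(\<lambda>n. X (Suc n) t) sums prim c (\<lambda>t. A t * x t + B t * y t) t" 
       "(\<lambda>n. Y (Suc n) t) sums prim c (\<lambda>t. C t * x t + D t * y t) t" for t
    unfolding XS using prim_suminf[OF rows(1) dom(1)] prim_suminf[OF rows(2) dom(2)] loc_int_rows[OF lb]
    by (simp_all add: wsum)
  have split: "x t = X 0 t + prim c (\<lambda>t. A t * x t + B t * y t) t" "y t = Y 0 t + prim c (\<lambda>t. C t * x t + D t * y t) t" for t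
  proof -
    have "x t = (\<Sum>n. X (Suc n) t) + X 0 t" "y t = (\<Sum>n. Y (Suc n) t) + Y 0 t"
      using suminf_split_head[OF summ(1), of t] suminf_split_head[OF summ(2), of t]
      unfolding x_def y_def by simp_all
    then show "x t = X 0 t + prim c (\<lambda>t. A t * x t + B t * y t) t" "y t = Y 0 t + prim c (\<lambda>t. C t * x t + D t * y t) t"
      unfolding sums_unique[OF tails(1), of t] sums_unique[OF tails(2), of t] by (simp_all only: add.commute)
  qed
  have *: "x = (\<lambda>t. x0 + prim c (\<lambda>t. A t * x t + B t * y t + f t) t)" "y = (\<lambda>t. y0 + prim c (\<lambda>t. C t * x t + D t * y t + g t) t)"
    by (rule ext, rule trans[OF split(1)], simp add: X0 prim_add[OF loc_int_rows(1)[OF lb] f])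
       (rule ext, rule trans[OF split(2)], simp add: X0 prim_add[OF loc_int_rows(2)[OF lb] g])
  show ?thesis
  proof
    show "AC_loc_with x (\<lambda>t. A t * x t + B t * y t + f t)"
      by (subst (1) *) (use AC_add[OF AC_const AC_prim[OF loc_int_add[OF loc_int_rows(1)[OF lb] f]]] in simp)
    show "AC_loc_with y (\<lambda>t. C t * x t + D t * y t + g t)"
      by (subst (1) *) (use AC_add[OF AC_const AC_prim[OF loc_int_add[OF loc_int_rows(2)[OF lb] g]]] in simp)
    show "x c = x0" "y c = y0" by (subst *, simp)+
  qed
qed

end

section \<open>Square-integrable functions\<close>

text \<open>The minimum over \<open>z\<close> is at \<open>- cnj b / c\<close>, where nonnegativity
  is the claim. Stated abstractly because it serves the L2 inner product, the orthogonality of the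
  projection, and the form of the operator.\<close>

lemma quadratic_form_Cauchy_Schwarz:
  fixes b :: complex
  assumes "\<And>z. 0 \<le> a + 2 * Re (z * b) + (cmod z)\<^sup>2 * c" "0 \<le> c"
  shows "(cmod b)\<^sup>2 \<le> a * c"
proof (cases "c = 0")
  case True
  have "cmod b = 0"
  proof (rule ccontr)
    assume b: "cmod b \<noteq> 0"
    \<comment> \<open>Chosen so that the expression, linear in \<open>z\<close> when
      \<open>c = 0\<close>, takes the value -1.\<close>
    define t where "t = (a + 1) / (2 * (cmod b)\<^sup>2)"
    have "0 \<le> a + 2 * Re (- of_real t * cnj b * b)"
      using assms(1)[of "- of_real t * cnj b"] True by simp
    moreover have "Re (- of_real t * cnj b * b) = - t * (cmod b)\<^sup>2"
      unfolding cmod_power2 by (simp add: power2_eq_square algebra_simps)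
    ultimately have "0 \<le> a - 2 * (t * (cmod b)\<^sup>2)" by simp
    also have "2 * (t * (cmod b)\<^sup>2) = a + 1" using b by (simp add: t_def)
    finally show False by simp
  qed
  with True show ?thesis by simp
next
  case False
  then have c: "c > 0" using assms(2) by simp
  have "- cnj b / of_real c * b = of_real (- (cmod b)\<^sup>2 / c)"
    using complex_norm_square[of b] by (simp add: mult.commute)
  then have "0 \<le> a + 2 * (- (cmod b)\<^sup>2 / c) + (cmod b / c)\<^sup>2 * c"
    using assms(1)[of "- cnj b / of_real c"] c by (simp add: norm_divide)
  also have "(cmod b / c)\<^sup>2 * c = (cmod b)\<^sup>2 / c" using c by (simp add: power2_eq_square)
  finally show ?thesis using c by (simp add: field_simps)
qed

lemma L2_measurable: "L2 f \<Longrightarrow> f \<in> borel_measurable lebesgue"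
  by (simp add: L2_def)

lemma L2_inner_integrable:
  assumes "L2 f" "L2 g"
  shows "integrable lebesgue (\<lambda>x. f x * cnj (g x))"
proof (rule Bochner_Integration.integrable_bound)
  have [measurable]: "f \<in> borel_measurable lebesgue" "g \<in> borel_measurable lebesgue" using assms by (auto simp: L2_def)
  show "integrable lebesgue (\<lambda>x. (cmod (f x))\<^sup>2 + (cmod (g x))\<^sup>2)"
    using assms by (auto simp: L2_def)
  show "(\<lambda>x. f x * cnj (g x)) \<in> borel_measurable lebesgue" by measurable
  have "cmod (f x) * cmod (g x) \<le> (cmod (f x))\<^sup>2 + (cmod (g x))\<^sup>2" for x
    using sum_squares_bound[of "cmod (f x)" "cmod (g x)"] zero_le_mult_iff[of "cmod (f x)" "cmod (g x)"] norm_ge_zero[of "f x"] norm_ge_zero[of "g x"] by argo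
  then show "AE x in lebesgue. norm (f x * cnj (g x)) \<le> norm ((cmod (f x))\<^sup>2 + (cmod (g x))\<^sup>2)"
    by (simp add: norm_mult)
qed

lemma L2_integrable: "L2 f \<Longrightarrow> integrable lebesgue (\<lambda>x. (cmod (f x))\<^sup>2)"
  by (simp add: L2_def)

lemma L2_add: assumes "L2 f" "L2 g" shows "L2 (\<lambda>x. f x + g x)"
  unfolding L2_def
proof
  have [measurable]: "f \<in> borel_measurable lebesgue" "g \<in> borel_measurable lebesgue" using assms by (auto simp: L2_def)
  show "(\<lambda>x. f x + g x) \<in> borel_measurable lebesgue" by measurable
  show "integrable lebesgue (\<lambda>x. (cmod (f x + g x))\<^sup>2)"
  proof (rule Bochner_Integration.integrable_bound)
    show "integrable lebesgue (\<lambda>x. 2 * (cmod (f x))\<^sup>2 + 2 * (cmod (g x))\<^sup>2)"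
      using assms by (auto simp: L2_def)
    have "(cmod (f x + g x))\<^sup>2 \<le> 2 * (cmod (f x))\<^sup>2 + 2 * (cmod (g x))\<^sup>2" for x
    proof -
      have "(cmod (f x + g x))\<^sup>2 \<le> (cmod (f x) + cmod (g x))\<^sup>2"
        by (intro power_mono norm_triangle_ineq) auto
      also have "\<dots> \<le> 2 * (cmod (f x))\<^sup>2 + 2 * (cmod (g x))\<^sup>2"
        using sum_squares_bound[of "cmod (f x)" "cmod (g x)"] by (simp add: power2_sum)
      finally show ?thesis .
    qed
    then show "AE x in lebesgue. norm ((cmod (f x + g x))\<^sup>2) \<le> norm (2 * (cmod (f x))\<^sup>2 + 2 * (cmod (g x))\<^sup>2)"
      by simp
  qed measurable
qed

lemma L2_mult_bounded:
  assumes "L2 f" "h \<in> borel_measurable lebesgue" "\<And>x. cmod (h x) \<le> B"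
  shows "L2 (\<lambda>x. h x * f x)"
  unfolding L2_def
proof
  have [measurable]: "f \<in> borel_measurable lebesgue" using assms by (auto simp: L2_def)
  note [measurable] = assms(2)
  show "(\<lambda>x. h x * f x) \<in> borel_measurable lebesgue" by measurable
  show "integrable lebesgue (\<lambda>x. (cmod (h x * f x))\<^sup>2)"
  proof (rule Bochner_Integration.integrable_bound)
    show "integrable lebesgue (\<lambda>x. B\<^sup>2 * (cmod (f x))\<^sup>2)"
      using assms by (auto simp: L2_def)
    show "AE x in lebesgue. norm ((cmod (h x * f x))\<^sup>2) \<le> norm (B\<^sup>2 * (cmod (f x))\<^sup>2)"
      using assms(3) by (auto simp: norm_mult power_mult_distrib intro!: mult_right_mono power_mono)
  qed measurable
qed

lemma L2_cmult: "L2 f \<Longrightarrow> L2 (\<lambda>x. c * f x)"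
  by (rule L2_mult_bounded[where B="cmod c"]) auto

lemma L2_diff: "L2 f \<Longrightarrow> L2 g \<Longrightarrow> L2 (\<lambda>x. f x - g x)"
  using L2_add[OF _ L2_cmult[of g "-1"]] by simp

lemma L2_zero: "L2 (\<lambda>x. 0)"
  by (simp add: L2_def)

lemma L2_cong_AE:
  assumes "L2 f" "AE x in lebesgue. f x = g x"
  shows "L2 g"
proof -
  have g: "g \<in> borel_measurable lebesgue" using borel_measurable_AE[OF _ assms(2)] assms(1) by (auto simp: L2_def)
  note [measurable] = this L2_measurable[OF assms(1)]
  have "integrable lebesgue (\<lambda>x. (cmod (f x))\<^sup>2) = integrable lebesgue (\<lambda>x. (cmod (g x))\<^sup>2)"
    by (rule integrable_cong_AE) (use assms(2) in \<open>auto elim!: eventually_mono\<close>)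
  with g assms(1) show ?thesis by (simp add: L2_def)
qed

lemma L2_inner_commute: "L2_inner g f = cnj (L2_inner f g)"
  unfolding L2_inner_def Bochner_Integration.integral_cnj[symmetric] by (simp add: mult.commute)

lemma L2_inner_add_left: "L2 f \<Longrightarrow> L2 g \<Longrightarrow> L2 h \<Longrightarrow> L2_inner (\<lambda>x. f x + g x) h = L2_inner f h + L2_inner g h"
  unfolding L2_inner_def distrib_right by (intro Bochner_Integration.integral_add L2_inner_integrable)

lemma L2_inner_diff_left: "L2 f \<Longrightarrow> L2 g \<Longrightarrow> L2 h \<Longrightarrow> L2_inner (\<lambda>x. f x - g x) h = L2_inner f h - L2_inner g h"
  unfolding L2_inner_def left_diff_distrib by (intro Bochner_Integration.integral_diff L2_inner_integrable)

lemma L2_inner_cmult_left: "L2_inner (\<lambda>x. c * f x) h = c * L2_inner f h"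
  unfolding L2_inner_def mult.assoc by (rule integral_mult_right_zero)

lemma L2_inner_add_right: "L2 f \<Longrightarrow> L2 g \<Longrightarrow> L2 h \<Longrightarrow> L2_inner h (\<lambda>x. f x + g x) = L2_inner h f + L2_inner h g"
  using L2_inner_add_left[of f g h] by (simp add: L2_inner_commute[of h])

lemma L2_inner_diff_right: "L2 f \<Longrightarrow> L2 g \<Longrightarrow> L2 h \<Longrightarrow> L2_inner h (\<lambda>x. f x - g x) = L2_inner h f - L2_inner h g"
  using L2_inner_diff_left[of f g h] by (simp add: L2_inner_commute[of h])

lemma L2_inner_cmult_right: "L2_inner h (\<lambda>x. c * f x) = cnj c * L2_inner h f"
  using L2_inner_cmult_left[of c f h] by (simp add: L2_inner_commute[of h])

lemma L2_inner_self: "L2_inner f f = of_real (L2_norm_sq f)"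
  unfolding L2_inner_def L2_norm_sq_def by (simp add: complex_norm_square[symmetric] flip: integral_complex_of_real)

lemma L2_norm_sq_nonneg: "0 \<le> L2_norm_sq f"
  unfolding L2_norm_sq_def by (intro integral_nonneg_AE) simp

lemma L2_inner_cong_AE:
  assumes "L2 f" "L2 g" "AE x in lebesgue. f x = f' x" "AE x in lebesgue. g x = g' x"
  shows "L2_inner f g = L2_inner f' g'"
proof -
  note [measurable] = assms(1,2)[THEN L2_measurable]
    L2_cong_AE[OF assms(1,3), THEN L2_measurable] L2_cong_AE[OF assms(2,4), THEN L2_measurable]
  show ?thesis unfolding L2_inner_def
    using assms(3,4) by (intro integral_cong_AE) (auto elim!: eventually_elim2)
qed

lemma L2_norm_sq_cong_AE:
  assumes "L2 f" "AE x in lebesgue. f x = g x"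
  shows "L2_norm_sq f = L2_norm_sq g"
  using L2_inner_cong_AE[OF assms(1,1,2,2)] by (simp add: L2_inner_self)

lemma L2_norm_sq_zero_iff: "L2 f \<Longrightarrow> L2_norm_sq f = 0 \<longleftrightarrow> (AE x in lebesgue. f x = 0)"
  unfolding L2_norm_sq_def by (subst integral_nonneg_eq_0_iff_AE) (auto simp: L2_def)

lemma L2_norm_sq_add_cmult:
  assumes "L2 f" "L2 g"
  shows "L2_norm_sq (\<lambda>x. f x + z * g x) = L2_norm_sq f + 2 * Re (z * L2_inner g f) + (cmod z)\<^sup>2 * L2_norm_sq g"
proof -
  have zg: "L2 (\<lambda>x. z * g x)" by (rule L2_cmult[OF assms(2)])
  have "complex_of_real (L2_norm_sq (\<lambda>x. f x + z * g x)) = L2_inner f f + z * L2_inner g f + cnj (z * L2_inner g f) + z * cnj z * L2_inner g g"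
    using assms zg L2_add[OF assms(1) zg]
    unfolding L2_inner_self[symmetric]
    by (simp add: L2_inner_add_left L2_inner_add_right L2_inner_cmult_left L2_inner_cmult_right L2_inner_commute[of f g] algebra_simps)
  also have "\<dots> = complex_of_real (L2_norm_sq f + 2 * Re (z * L2_inner g f) + (cmod z)\<^sup>2 * L2_norm_sq g)"
    using complex_add_cnj[of "z * L2_inner g f"] complex_norm_square[of z]
    by (simp add: L2_inner_self add.assoc)
  finally show ?thesis by (simp only: of_real_eq_iff)
qed

lemma L2_norm_sq_cmult: "L2_norm_sq (\<lambda>x. z * g x) = (cmod z)\<^sup>2 * L2_norm_sq g"
  by (simp add: L2_norm_sq_def norm_mult power_mult_distrib)

lemma L2_Cauchy_Schwarz:
  assumes "L2 f" "L2 g"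
  shows "(cmod (L2_inner f g))\<^sup>2 \<le> L2_norm_sq f * L2_norm_sq g"
proof -
  have "(cmod (L2_inner f g))\<^sup>2 \<le> L2_norm_sq g * L2_norm_sq f"
    by (rule quadratic_form_Cauchy_Schwarz)
      (simp_all only: L2_norm_sq_add_cmult[OF assms(2,1), symmetric] L2_norm_sq_nonneg)
  then show ?thesis by (simp add: mult.commute)
qed

section \<open>Convergence in L2, completeness and orthogonal projection\<close>

lemma L2_norm_sq_parallelogram:
  assumes "L2 f" "L2 g"
  shows "L2_norm_sq (\<lambda>x. f x + g x) + L2_norm_sq (\<lambda>x. f x - g x) = 2 * L2_norm_sq f + 2 * L2_norm_sq g"
  using L2_norm_sq_add_cmult[OF assms, of 1] L2_norm_sq_add_cmult[OF assms, of "-1"] by simp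

lemma L2_inner_tendsto_left:
  assumes "\<And>n. L2 (F n)" "L2 f" "L2 g" and lim: "(\<lambda>n. L2_norm_sq (\<lambda>x. F n x - f x)) \<longlonglongrightarrow> 0"
  shows "(\<lambda>n. L2_inner (F n) g) \<longlonglongrightarrow> L2_inner f g"
proof -
  have "(\<lambda>n. sqrt (L2_norm_sq (\<lambda>x. F n x - f x) * L2_norm_sq g)) \<longlonglongrightarrow> sqrt (0 * L2_norm_sq g)"
    by (intro tendsto_intros lim)
  then have lim0: "(\<lambda>n. sqrt (L2_norm_sq (\<lambda>x. F n x - f x) * L2_norm_sq g)) \<longlonglongrightarrow> 0" by simp
  have "(\<lambda>n. L2_inner (F n) g - L2_inner f g) \<longlonglongrightarrow> 0"
  proof (rule Lim_null_comparison[OF _ lim0])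
    show "\<forall>\<^sub>F n in sequentially. cmod (L2_inner (F n) g - L2_inner f g) \<le> sqrt (L2_norm_sq (\<lambda>x. F n x - f x) * L2_norm_sq g)"
      using assms(1-3) L2_Cauchy_Schwarz[OF L2_diff] by (auto simp: L2_inner_diff_left[symmetric] intro!: always_eventually real_le_rsqrt)
  qed
  then show ?thesis by (simp add: LIM_zero_iff)
qed

lemma L2_inner_tendsto_right:
  assumes "\<And>n. L2 (F n)" "L2 f" "L2 g" and lim: "(\<lambda>n. L2_norm_sq (\<lambda>x. F n x - f x)) \<longlonglongrightarrow> 0"
  shows "(\<lambda>n. L2_inner g (F n)) \<longlonglongrightarrow> L2_inner g f"
  unfolding L2_inner_commute[of g] by (intro tendsto_cnj L2_inner_tendsto_left assms)

text \<open>Multiplication by such a function carries L2 into L1 and can be undone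
  pointwise.\<close>

lemma L2_positive_weight:
  obtains w :: "real \<Rightarrow> real" where "L2 (\<lambda>x. of_real (w x))" "\<And>x. w x > 0"
proof -
  obtain h :: "real \<Rightarrow> ennreal" where h: "h \<in> borel_measurable lebesgue" "integral\<^sup>N lebesgue h \<noteq> \<infinity>" "\<And>x. 0 < h x \<and> h x < \<infinity>"
    using lebesgue.Ex_finite_integrable_function by auto
  note [measurable] = h(1)
  have "integrable lebesgue (\<lambda>x. enn2real (h x))"
  proof (rule integrableI_bounded)
    have "(\<integral>\<^sup>+ x. ennreal (norm (enn2real (h x))) \<partial>lebesgue) = integral\<^sup>N lebesgue h"
      using h(3) by (intro nn_integral_cong) (auto simp: ennreal_enn2real)
    then show "(\<integral>\<^sup>+ x. ennreal (norm (enn2real (h x))) \<partial>lebesgue) < \<infinity>"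
      using h(2) by (simp add: less_top)
  qed measurable
  moreover have "(\<lambda>x. complex_of_real (sqrt (enn2real (h x)))) \<in> borel_measurable lebesgue" by measurable
  ultimately have "L2 (\<lambda>x. of_real (sqrt (enn2real (h x))))" by (simp add: L2_def)
  moreover have "sqrt (enn2real (h x)) > 0" for x
    using h(3)[of x] by (simp add: enn2real_positive_iff)
  ultimately show ?thesis using that[of "\<lambda>x. sqrt (enn2real (h x))"] by blast
qed

lemma nn_integral_L2_norm_sq: "L2 f \<Longrightarrow> (\<integral>\<^sup>+x. ennreal ((cmod (f x))\<^sup>2) \<partial>lebesgue) = ennreal (L2_norm_sq f)"
  unfolding L2_norm_sq_def by (intro nn_integral_eq_integral L2_integrable) auto

text \<open>After multiplication by a positive L2 weight the sequence is Cauchy in L1 by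
  Cauchy-Schwarz, so a subsequence is Cauchy almost everywhere. Dividing by the weight gives the
  pointwise limit, and Fatou's lemma returns to the L2 distance.\<close>

theorem Riesz_Fischer:
  assumes L2: "\<And>n. L2 (F n)"
    and Cauchy: "\<And>e. e > 0 \<Longrightarrow> \<exists>N. \<forall>m\<ge>N. \<forall>n\<ge>N. L2_norm_sq (\<lambda>x. F m x - F n x) < e"
  obtains f where "L2 f" "(\<lambda>n. L2_norm_sq (\<lambda>x. F n x - f x)) \<longlonglongrightarrow> 0"
proof -
  obtain w :: "real \<Rightarrow> real" where w: "L2 (\<lambda>x. of_real (w x))" "\<And>x. w x > 0"
    using L2_positive_weight by blast
  define s where "s n x = F n x * cnj (of_real (w x))" for n x
  have [measurable]: "F n \<in> borel_measurable lebesgue" for n using L2_measurable[OF L2] .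
  have "integrable lebesgue (s n)" for n
    unfolding s_def by (intro L2_inner_integrable L2 w)
  moreover have "\<exists>N. \<forall>i\<ge>N. \<forall>j\<ge>N. (LINT x|lebesgue. norm (s i x - s j x)) < e" if "e > 0" for e
  proof -
    let ?W = "L2_norm_sq (\<lambda>x. of_real (w x))"
    have W: "?W + 1 > 0" using L2_norm_sq_nonneg[of "\<lambda>x. of_real (w x)"] by simp
    obtain N where N: "\<And>i j. i \<ge> N \<Longrightarrow> j \<ge> N \<Longrightarrow> L2_norm_sq (\<lambda>x. F i x - F j x) < e\<^sup>2 / (?W + 1)"
      using Cauchy[of "e\<^sup>2 / (?W + 1)"] W \<open>e > 0\<close> by auto
    have "(LINT x|lebesgue. norm (s i x - s j x)) < e" if "i \<ge> N" "j \<ge> N" for i j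
    proof -
      let ?d = "\<lambda>x. of_real (cmod (F i x - F j x))"
      have d: "L2 ?d" using L2_diff[OF L2[of i] L2[of j]] by (auto simp: L2_def)
      have "complex_of_real (LINT x|lebesgue. norm (s i x - s j x)) = L2_inner ?d (\<lambda>x. of_real (w x))"
        unfolding L2_inner_def s_def integral_complex_of_real[symmetric]
        using w(2) by (auto simp: norm_mult left_diff_distrib[symmetric] less_imp_le)
      then have "(LINT x|lebesgue. norm (s i x - s j x))\<^sup>2 = (cmod (L2_inner ?d (\<lambda>x. of_real (w x))))\<^sup>2"
        by (metis norm_of_real power2_abs)
      also have "\<dots> \<le> L2_norm_sq ?d * ?W" by (rule L2_Cauchy_Schwarz[OF d w(1)])
      also have "L2_norm_sq ?d = L2_norm_sq (\<lambda>x. F i x - F j x)" by (simp add: L2_norm_sq_def)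
      also have "\<dots> * ?W \<le> L2_norm_sq (\<lambda>x. F i x - F j x) * (?W + 1)"
        by (intro mult_left_mono L2_norm_sq_nonneg) auto
      also have "\<dots> < e\<^sup>2 / (?W + 1) * (?W + 1)"
        using N[OF that] W by (intro mult_strict_right_mono)
      also have "\<dots> = e\<^sup>2" using W by simp
      finally show ?thesis using \<open>e > 0\<close> by (simp add: power2_less_imp_less)
    qed
    then show ?thesis by blast
  qed
  ultimately obtain r where r: "strict_mono r" "AE x in lebesgue. Cauchy (\<lambda>i. s (r i) x)"
    by (rule cauchy_L1_AE_cauchy_subseq) blast+
  define f where "f x = lim (\<lambda>i. F (r i) x)" for x
  have [measurable]: "f \<in> borel_measurable lebesgue"
    unfolding f_def by measurable
  have conv: "AE x in lebesgue. (\<lambda>i. F (r i) x) \<longlonglongrightarrow> f x"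
    using r(2)
  proof eventually_elim
    case (elim x)
    then have "convergent (\<lambda>i. s (r i) x)" by (rule Cauchy_convergent)
    then obtain l where "(\<lambda>i. s (r i) x) \<longlonglongrightarrow> l" by (auto simp: convergent_def)
    then have "(\<lambda>i. s (r i) x / of_real (w x)) \<longlonglongrightarrow> l / of_real (w x)"
      using w(2)[of x] by (intro tendsto_divide) auto
    moreover have "s (r i) x / of_real (w x) = F (r i) x" for i using w(2)[of x] by (simp add: s_def)
    ultimately show ?case by (simp add: f_def convergent_LIMSEQ_iff[symmetric] convergentI)
  qed
  \<comment> \<open>Fatou is applied along the subsequence with \<open>n\<close> fixed, so the
    estimate holds for the full sequence and also shows that the difference is in L2.\<close>
  have close: "\<exists>N. \<forall>n\<ge>N. L2 (\<lambda>x. F n x - f x) \<and> L2_norm_sq (\<lambda>x. F n x - f x) \<le> e" if "e > 0" for e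
  proof -
    obtain N where N: "\<And>m n. m \<ge> N \<Longrightarrow> n \<ge> N \<Longrightarrow> L2_norm_sq (\<lambda>x. F m x - F n x) < e"
      using Cauchy[OF \<open>e > 0\<close>] by blast
    have "L2 (\<lambda>x. F n x - f x) \<and> L2_norm_sq (\<lambda>x. F n x - f x) \<le> e" if "n \<ge> N" for n
    proof -
      have "(\<integral>\<^sup>+x. ennreal ((cmod (F n x - f x))\<^sup>2) \<partial>lebesgue) =
         (\<integral>\<^sup>+x. liminf (\<lambda>i. ennreal ((cmod (F n x - F (r i) x))\<^sup>2)) \<partial>lebesgue)"
        using conv
      proof (intro nn_integral_cong_AE, eventually_elim)
        case (elim x)
        then have "(\<lambda>i. ennreal ((cmod (F n x - F (r i) x))\<^sup>2)) \<longlonglongrightarrow> ennreal ((cmod (F n x - f x))\<^sup>2)"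
          by (intro tendsto_intros)
        from lim_imp_Liminf[OF sequentially_bot this] show ?case by (rule sym)
      qed
      also have "\<dots> \<le> liminf (\<lambda>i. \<integral>\<^sup>+x. ennreal ((cmod (F n x - F (r i) x))\<^sup>2) \<partial>lebesgue)"
        by (rule nn_integral_liminf) measurable
      also have "\<dots> \<le> limsup (\<lambda>i. \<integral>\<^sup>+x. ennreal ((cmod (F n x - F (r i) x))\<^sup>2) \<partial>lebesgue)"
        by (rule Liminf_le_Limsup) simp
      also have "\<dots> \<le> ennreal e"
      proof (rule Limsup_bounded)
        have "eventually (\<lambda>i. r i \<ge> N) sequentially"
          using filterlim_subseq[OF r(1)] by (auto simp: filterlim_at_top)
        then show "\<forall>\<^sub>F i in sequentially. (\<integral>\<^sup>+x. ennreal ((cmod (F n x - F (r i) x))\<^sup>2) \<partial>lebesgue) \<le> ennreal e"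
        proof eventually_elim
          case (elim i)
          then show ?case
            using N[OF \<open>n \<ge> N\<close>, of "r i"] nn_integral_L2_norm_sq[OF L2_diff[OF L2[of n] L2[of "r i"]]]
            by (simp add: ennreal_leI)
        qed
      qed
      finally have fin: "(\<integral>\<^sup>+x. ennreal ((cmod (F n x - f x))\<^sup>2) \<partial>lebesgue) \<le> ennreal e" .
      then have int: "integrable lebesgue (\<lambda>x. (cmod (F n x - f x))\<^sup>2)"
        by (intro integrableI_bounded) (auto intro: le_less_trans simp: ennreal_less_top)
      then have "L2 (\<lambda>x. F n x - f x)" by (simp add: L2_def)
      moreover from this fin have "L2_norm_sq (\<lambda>x. F n x - f x) \<le> e"
        using nn_integral_L2_norm_sq[of "\<lambda>x. F n x - f x"] \<open>e > 0\<close> by (simp add: ennreal_le_iff)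
      ultimately show ?thesis by simp
    qed
    then show ?thesis by blast
  qed
  have "L2 f"
  proof -
    obtain N where "L2 (\<lambda>x. F N x - f x)" using close[of 1] by auto
    from L2_diff[OF L2[of N] this] show ?thesis by simp
  qed
  moreover have "(\<lambda>n. L2_norm_sq (\<lambda>x. F n x - f x)) \<longlonglongrightarrow> 0"
  proof (rule LIMSEQ_I)
    fix e :: real assume "e > 0"
    then obtain N where "\<And>n. n \<ge> N \<Longrightarrow> L2_norm_sq (\<lambda>x. F n x - f x) \<le> e / 2"
      using close[of "e/2"] by auto
    with \<open>e > 0\<close> show "\<exists>no. \<forall>n\<ge>no. norm (L2_norm_sq (\<lambda>x. F n x - f x) - 0) < e"
      by (intro exI[of _ N]) (fastforce simp: L2_norm_sq_nonneg)
  qed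
  ultimately show ?thesis using that by blast
qed

text \<open>The one closure rule includes scalar multiples: combine an element with itself, with
  \<open>z\<close> one less than the desired factor.\<close>

definition pair_subspace :: "((real \<Rightarrow> complex) \<times> (real \<Rightarrow> complex)) set \<Rightarrow> bool" where
  "pair_subspace S \<longleftrightarrow> S \<noteq> {} \<and> (\<forall>(u, f)\<in>S. L2 u \<and> L2 f) \<and>
    (\<forall>(u, f)\<in>S. \<forall>(v, g)\<in>S. \<forall>z. ((\<lambda>x. u x + z * v x), (\<lambda>x. f x + z * g x)) \<in> S)"

text \<open>\<open>(U n, F n)\<close> minimises the distance to \<open>(u, f)\<close> in the limit,
  and \<open>(h, k)\<close> is the limit of the residuals, orthogonal to \<open>S\<close>.\<close>

theorem projection:
  assumes S: "pair_subspace S" and u: "L2 u" and f: "L2 f"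
  obtains h k U F where "L2 h" "L2 k" "\<And>v g. (v, g) \<in> S \<Longrightarrow> L2_inner v h + L2_inner g k = 0"
    "\<And>n. (U n, F n) \<in> S" "(\<lambda>n. L2_norm_sq (\<lambda>x. U n x - (u x - h x))) \<longlonglongrightarrow> 0"
    "(\<lambda>n. L2_norm_sq (\<lambda>x. F n x - (f x - k x))) \<longlonglongrightarrow> 0"
proof -
  define Q where "Q v g = L2_norm_sq (\<lambda>x. u x - v x) + L2_norm_sq (\<lambda>x. f x - g x)" for v g
  have Q0: "Q v g \<ge> 0" for v g by (simp add: Q_def L2_norm_sq_nonneg)
  have SL2: "L2 v" "L2 g" if "(v, g) \<in> S" for v g using S that by (auto simp: pair_subspace_def)
  have Slin: "((\<lambda>x. v x + z * v' x), (\<lambda>x. g x + z * g' x)) \<in> S" if "(v, g) \<in> S" "(v', g') \<in> S" for v g v' g' z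
    using S that unfolding pair_subspace_def by fast
  define d where "d = Inf ((\<lambda>(v, g). Q v g) ` S)"
  have Sne: "S \<noteq> {}" using S by (simp add: pair_subspace_def)
  have bdd: "bdd_below ((\<lambda>(v, g). Q v g) ` S)" using Q0 by (intro bdd_belowI[of _ 0]) auto
  have d_le: "d \<le> Q v g" if "(v, g) \<in> S" for v g
    unfolding d_def using that by (intro cInf_lower bdd) force
  have "\<exists>p. p \<in> S \<and> Q (fst p) (snd p) < d + 1 / Suc n" for n
  proof -
    have "d < d + 1 / Suc n" by simp
    then obtain y where "y \<in> (\<lambda>(v, g). Q v g) ` S" "y < d + 1 / Suc n"
      unfolding d_def using cInf_lessD[of "(\<lambda>(v, g). Q v g) ` S"] Sne by blast
    then show ?thesis by force
  qed
  then obtain P where P: "\<And>n. P n \<in> S" "\<And>n. Q (fst (P n)) (snd (P n)) < d + 1 / Suc n" by metis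
  define U F where "U n = fst (P n)" and "F n = snd (P n)" for n
  have UF: "(U n, F n) \<in> S" "Q (U n) (F n) < d + 1 / Suc n" for n using P by (auto simp: U_def F_def)
  have L2U: "L2 (U n)" "L2 (F n)" for n using SL2[OF UF(1)] by auto
  define H K where "H n x = u x - U n x" and "K n x = f x - F n x" for n x
  have L2H: "L2 (H n)" "L2 (K n)" for n unfolding H_def K_def by (intro L2_diff u f L2U)+
  \<comment> \<open>The midpoint of two members of the sequence lies in \<open>S\<close> and has
    squared distance at least \<open>d\<close>; the parallelogram identity then bounds the
    difference of the residuals by the excess of both distances over \<open>d\<close>.\<close>
  have near: "L2_norm_sq (\<lambda>x. H m x - H n x) + L2_norm_sq (\<lambda>x. K m x - K n x) \<le> 2 / Suc m + 2 / Suc n" for m n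
  proof -
    have "((\<lambda>x. (1/2) * (U m x + 1 * U n x)), (\<lambda>x. (1/2) * (F m x + 1 * F n x))) \<in> S"
    proof -
      have s: "((\<lambda>x. U m x + 1 * U n x), (\<lambda>x. F m x + 1 * F n x)) \<in> S" by (rule Slin[OF UF(1) UF(1)])
      show ?thesis using Slin[OF s s, of "-1/2"] by (simp add: algebra_simps)
    qed
    then have "d \<le> Q (\<lambda>x. (1/2) * (U m x + 1 * U n x)) (\<lambda>x. (1/2) * (F m x + 1 * F n x))" by (rule d_le)
    also have "\<dots> = L2_norm_sq (\<lambda>x. (1/2) * (H m x + H n x)) + L2_norm_sq (\<lambda>x. (1/2) * (K m x + K n x))"
      unfolding Q_def H_def K_def by (intro arg_cong2[where f="(+)"] arg_cong[where f=L2_norm_sq]) (auto simp: field_simps fun_eq_iff)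
    also have "\<dots> = (L2_norm_sq (\<lambda>x. H m x + H n x) + L2_norm_sq (\<lambda>x. K m x + K n x)) / 4"
      unfolding L2_norm_sq_cmult by (simp add: norm_divide power2_eq_square)
    finally have "4 * d \<le> L2_norm_sq (\<lambda>x. H m x + H n x) + L2_norm_sq (\<lambda>x. K m x + K n x)" by simp
    moreover have "L2_norm_sq (H m) + L2_norm_sq (K m) < d + 1 / Suc m" "L2_norm_sq (H n) + L2_norm_sq (K n) < d + 1 / Suc n"
      using UF(2) unfolding Q_def H_def K_def by auto
    ultimately show ?thesis
      using L2_norm_sq_parallelogram[OF L2H(1)[of m] L2H(1)[of n]] L2_norm_sq_parallelogram[OF L2H(2)[of m] L2H(2)[of n]]
      by (simp del: of_nat_Suc)
  qed
  have small: "\<exists>N. \<forall>m\<ge>N. \<forall>n\<ge>N. 2 / Suc m + 2 / Suc n < e" if "e > 0" for e :: real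
  proof -
    obtain N where N: "N \<noteq> 0" "inverse (real N) < e / 4" using real_arch_inverse[of "e/4"] \<open>e > 0\<close> by auto
    have "2 / Suc m < e / 2" if "m \<ge> N" for m
    proof -
      have "1 / Suc m \<le> inverse (real N)" using that N(1) by (simp add: field_simps)
      then have "1 / Suc m < e / 4" using N(2) by (rule le_less_trans)
      then show ?thesis by linarith
    qed
    then have "2 / Suc m + 2 / Suc n < e" if "m \<ge> N" "n \<ge> N" for m n
      using that by (smt (verit) field_sum_of_halves)
    then show ?thesis by blast
  qed
  have near': "L2_norm_sq (\<lambda>x. H m x - H n x) \<le> 2 / Suc m + 2 / Suc n" "L2_norm_sq (\<lambda>x. K m x - K n x) \<le> 2 / Suc m + 2 / Suc n" for m n
    using near[of m n] L2_norm_sq_nonneg[of "\<lambda>x. H m x - H n x"] L2_norm_sq_nonneg[of "\<lambda>x. K m x - K n x"] by linarith+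
  have "\<exists>N. \<forall>m\<ge>N. \<forall>n\<ge>N. L2_norm_sq (\<lambda>x. H m x - H n x) < e" if "e > 0" for e
    using small[OF that] le_less_trans[OF near'(1)] by blast
  then obtain h where h: "L2 h" "(\<lambda>n. L2_norm_sq (\<lambda>x. H n x - h x)) \<longlonglongrightarrow> 0"
    using Riesz_Fischer[of H] L2H(1) by blast
  have "\<exists>N. \<forall>m\<ge>N. \<forall>n\<ge>N. L2_norm_sq (\<lambda>x. K m x - K n x) < e" if "e > 0" for e
    using small[OF that] le_less_trans[OF near'(2)] by blast
  then obtain k where k: "L2 k" "(\<lambda>n. L2_norm_sq (\<lambda>x. K n x - k x)) \<longlonglongrightarrow> 0"
    using Riesz_Fischer[of K] L2H(2) by blast
  show ?thesis
  proof
    show "L2 h" "L2 k" by fact+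
    show "(U n, F n) \<in> S" for n by fact
    have "L2_norm_sq (\<lambda>x. U n x - (u x - h x)) = L2_norm_sq (\<lambda>x. H n x - h x)" for n
      unfolding L2_norm_sq_def H_def by (intro Bochner_Integration.integral_cong refl arg_cong[where f="\<lambda>t. t^2"])
        (simp add: norm_minus_commute algebra_simps)
    with h(2) show "(\<lambda>n. L2_norm_sq (\<lambda>x. U n x - (u x - h x))) \<longlonglongrightarrow> 0" by simp
    have "L2_norm_sq (\<lambda>x. F n x - (f x - k x)) = L2_norm_sq (\<lambda>x. K n x - k x)" for n
      unfolding L2_norm_sq_def K_def by (intro Bochner_Integration.integral_cong refl arg_cong[where f="\<lambda>t. t^2"])
        (simp add: norm_minus_commute algebra_simps)
    with k(2) show "(\<lambda>n. L2_norm_sq (\<lambda>x. F n x - (f x - k x))) \<longlonglongrightarrow> 0" by simp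
    fix v g assume vg: "(v, g) \<in> S"
    note L2v = SL2[OF vg]
    let ?c = "L2_norm_sq v + L2_norm_sq g"
    \<comment> \<open>Moving from a near-minimiser along \<open>(v, g)\<close> cannot go below
      \<open>d\<close>, so the constant term of the quadratic in \<open>z\<close> is only the excess
      \<open>1 / Suc n\<close>, which tends to 0.\<close>
    have "(cmod (L2_inner v (H n) + L2_inner g (K n)))\<^sup>2 \<le> (1 / Suc n) * ?c" for n
    proof (rule order_trans[OF quadratic_form_Cauchy_Schwarz])
      fix z
      have "((\<lambda>x. U n x + (-z) * v x), (\<lambda>x. F n x + (-z) * g x)) \<in> S" by (rule Slin[OF UF(1) vg])
      then have "d \<le> Q (\<lambda>x. U n x + (-z) * v x) (\<lambda>x. F n x + (-z) * g x)" by (rule d_le)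
      also have "\<dots> = L2_norm_sq (\<lambda>x. H n x + z * v x) + L2_norm_sq (\<lambda>x. K n x + z * g x)"
        unfolding Q_def H_def K_def by (intro arg_cong2[where f="(+)"] arg_cong[where f=L2_norm_sq]) (auto simp: algebra_simps)
      also have "\<dots> = L2_norm_sq (H n) + L2_norm_sq (K n) + 2 * Re (z * (L2_inner v (H n) + L2_inner g (K n))) + (cmod z)\<^sup>2 * ?c"
        by (simp add: L2_norm_sq_add_cmult L2H L2v algebra_simps)
      finally show "0 \<le> (L2_norm_sq (H n) + L2_norm_sq (K n) - d) + 2 * Re (z * (L2_inner v (H n) + L2_inner g (K n))) + (cmod z)\<^sup>2 * ?c"
        by linarith
    next
      show c0: "0 \<le> ?c" by (simp add: L2_norm_sq_nonneg)
      have "L2_norm_sq (H n) + L2_norm_sq (K n) - d \<le> 1 / Suc n"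
        using UF(2)[of n] unfolding Q_def H_def K_def by (simp del: of_nat_Suc)
      then show "(L2_norm_sq (H n) + L2_norm_sq (K n) - d) * ?c \<le> 1 / Suc n * ?c"
        by (intro mult_right_mono c0)
    qed
    moreover have "(\<lambda>n. (cmod (L2_inner v (H n) + L2_inner g (K n)))\<^sup>2) \<longlonglongrightarrow> (cmod (L2_inner v h + L2_inner g k))\<^sup>2"
      by (intro tendsto_intros L2_inner_tendsto_right L2H h k L2v)
    moreover have "(\<lambda>n. (1 / Suc n) * ?c) \<longlonglongrightarrow> 0 * ?c"
      by (intro tendsto_mult_right LIMSEQ_Suc lim_1_over_n)
    ultimately have "(cmod (L2_inner v h + L2_inner g k))\<^sup>2 \<le> 0 * ?c"
      by (intro LIMSEQ_le) auto
    then show "L2_inner v h + L2_inner g k = 0" by simp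
  qed
qed

section \<open>The adjoint of the preminimal operator\<close>

lemma continuous_AE_zero_on_open:
  fixes u :: "real \<Rightarrow> complex"
  assumes u: "continuous_on UNIV u" and ae: "AE x in lebesgue. x \<in> S \<longrightarrow> u x = 0" and S: "open S" and x: "x \<in> S"
  shows "u x = 0"
proof (rule ccontr)
  assume "u x \<noteq> 0"
  have "open (S \<inter> u -` (- {0}))"
    using open_vimage[OF _ u, of "- {0}"] S by (auto intro!: open_Int)
  moreover have "S \<inter> u -` (- {0}) \<noteq> {}" using x \<open>u x \<noteq> 0\<close> by auto
  ultimately have "\<not> negligible (S \<inter> u -` (- {0}))" by (rule open_not_negligible)
  moreover have "S \<inter> u -` (- {0}) \<in> null_sets lebesgue"
    using ae by (subst AE_iff_null_sets[OF sets_completionI_sets])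
      (auto elim!: eventually_mono intro: borel_open \<open>open (S \<inter> u -` (- {0}))\<close>)
  ultimately show False by (simp add: negligible_iff_null_sets)
qed

lemma AC_integral_zero:
  assumes F: "AC_loc_with F G" and supp: "\<And>x. x \<notin> {c..d} \<Longrightarrow> F x = 0"
  shows "integrable lebesgue G" "integral\<^sup>L lebesgue G = 0"
proof -
  \<comment> \<open>Both points lie outside the support, so the integral is a difference of two
    zeros; the maximum keeps \<open>a \<le> b\<close> even when \<open>{c..d}\<close> is
    empty.\<close>
  define a b where "a = c - 1" and "b = max c d + 1"
  have "AE x in lebesgue. x \<in> - {c..d} \<longrightarrow> G x = 0"
    by (rule AC_locally_zero[OF F]) (use supp in auto)
  then have eq: "AE x in lebesgue. indicat_real {a..b} x *\<^sub>R G x = G x"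
    by eventually_elim (auto simp: indicator_def a_def b_def)
  note [measurable] = loc_intD(1)[OF AC_loc_int[OF F]]
  have i: "integrable lebesgue (\<lambda>x. indicat_real {a..b} x *\<^sub>R G x)"
    using loc_intD(2)[OF AC_loc_int[OF F], of a b] unfolding set_integrable_def .
  with integrable_cong_AE[OF _ _ eq] show "integrable lebesgue G" by simp
  have "integral\<^sup>L lebesgue G = (\<integral>x. indicat_real {a..b} x *\<^sub>R G x \<partial>lebesgue)"
    by (rule integral_cong_AE[symmetric, OF _ _ eq]) measurable
  also have "\<dots> = F b - F a"
    using F by (simp add: AC_loc_with_iff set_lebesgue_integral_def a_def b_def)
  finally have *: "integral\<^sup>L lebesgue G = F b - F a" .
  have "F b = 0" "F a = 0" by (rule supp; simp add: a_def b_def max_def)+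
  with * show "integral\<^sup>L lebesgue G = 0" by simp
qed

lemma L2_loc_int:
  assumes "L2 w"
  shows "loc_int w"
proof (rule loc_int_bound[where G="\<lambda>x. 1 + (cmod (w x))\<^sup>2"])
  show "w \<in> borel_measurable lebesgue" by (rule L2_measurable[OF assms])
  fix a b :: real
  have "set_integrable lebesgue {a..b} (\<lambda>x. (cmod (w x))\<^sup>2)"
    unfolding set_integrable_def using assms by (intro integrable_mult_indicator) (auto simp: L2_def)
  moreover have "set_integrable lebesgue {a..b} (\<lambda>x. 1 :: real)"
    by (intro absolutely_integrable_continuous_real continuous_intros)
  ultimately show "set_integrable lebesgue {a..b} (\<lambda>x. 1 + (cmod (w x))\<^sup>2)"
    by (rule set_integral_add(1)[rotated])
next
  show "cmod (w x) \<le> 1 + (cmod (w x))\<^sup>2" for x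
    using sum_squares_bound[of 1 "cmod (w x)"] by (simp add: power2_eq_square) (smt (verit) norm_ge_zero)
qed

lemma L2_cutoff:
  assumes "loc_bdd u"
  shows "L2 (\<lambda>x. indicat_real {a..b} x *\<^sub>R u x)"
  unfolding L2_def
proof
  have [measurable]: "u \<in> borel_measurable lebesgue" using assms by (simp add: loc_bdd_def)
  show "(\<lambda>x. indicat_real {a..b} x *\<^sub>R u x) \<in> borel_measurable lebesgue" by measurable
  obtain B where B: "B \<ge> 0" "\<And>x. x \<in> {a..b} \<Longrightarrow> cmod (u x) \<le> B"
    using assms unfolding loc_bdd_def by meson
  show "integrable lebesgue (\<lambda>x. (cmod (indicat_real {a..b} x *\<^sub>R u x))\<^sup>2)"
  proof (rule Bochner_Integration.integrable_bound)
    have "set_integrable lebesgue {a..b} (\<lambda>x. B\<^sup>2)"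
      by (intro absolutely_integrable_continuous_real continuous_intros)
    then show "integrable lebesgue (\<lambda>x. indicat_real {a..b} x *\<^sub>R B\<^sup>2)" by (simp add: set_integrable_def)
    show "AE x in lebesgue. norm ((cmod (indicat_real {a..b} x *\<^sub>R u x))\<^sup>2) \<le> norm (indicat_real {a..b} x *\<^sub>R B\<^sup>2)"
      using B by (auto simp: indicator_def intro!: AE_I2 power_mono)
  qed measurable
qed

lemma L2_compact_support:
  assumes "loc_bdd u" "\<And>x. x \<notin> {a..b} \<Longrightarrow> u x = 0"
  shows "L2 u"
proof -
  have "(\<lambda>x. indicat_real {a..b} x *\<^sub>R u x) = u" using assms(2) by (auto simp: indicator_def fun_eq_iff)
  with L2_cutoff[OF assms(1), of a b] show ?thesis by simp
qed

lemma L2_orthogonalize: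
  assumes "L2 f" "L2 e"
  obtains c where "L2_inner (\<lambda>x. f x - c * e x) e = 0"
proof (cases "L2_norm_sq e = 0")
  case True
  then have "L2_inner f e = 0" using L2_Cauchy_Schwarz[OF assms] by simp
  with that[of 0] show ?thesis by simp
next
  case False
  then have "L2_inner (\<lambda>x. f x - (L2_inner f e / of_real (L2_norm_sq e)) * e x) e = 0"
    by (simp only: L2_inner_diff_left L2_cmult assms L2_inner_cmult_left L2_inner_self) simp
  with that show ?thesis by blast
qed

text \<open>A finite-dimensional space is its own double orthogonal complement. Gram-Schmidt leaves
  a residual \<open>f\<close> of \<open>\<rho>\<close> that is an admissible test function, and
  testing with it gives \<open>(f, f) = 0\<close>. The pointwise clause lets the test functions be
  confined to a common compact support.\<close>

lemma L2_orthogonal_complement_of_pair: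
  assumes \<rho>: "L2 \<rho>" and e0: "L2 e0" and e1: "L2 e1"
    and orth: "\<And>f. L2 f \<Longrightarrow> (\<And>x. \<rho> x = 0 \<Longrightarrow> e0 x = 0 \<Longrightarrow> e1 x = 0 \<Longrightarrow> f x = 0) \<Longrightarrow>
       L2_inner f e0 = 0 \<Longrightarrow> L2_inner f e1 = 0 \<Longrightarrow> L2_inner f \<rho> = 0"
  obtains c0 c1 where "AE x in lebesgue. \<rho> x = c0 * e0 x + c1 * e1 x"
proof -
  obtain c where c: "L2_inner (\<lambda>x. e1 x - c * e0 x) e0 = 0"
    using L2_orthogonalize[OF e1 e0] .
  define e1' where "e1' x = e1 x - c * e0 x" for x
  have L2e1': "L2 e1'" unfolding e1'_def by (intro L2_diff L2_cmult e0 e1)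
  obtain a where a: "L2_inner (\<lambda>x. \<rho> x - a * e0 x) e0 = 0" using L2_orthogonalize[OF \<rho> e0] .
  obtain b where b: "L2_inner (\<lambda>x. \<rho> x - b * e1' x) e1' = 0" using L2_orthogonalize[OF \<rho> L2e1'] .
  define f where "f x = \<rho> x - a * e0 x - b * e1' x" for x
  have L2f: "L2 f" unfolding f_def by (intro L2_diff L2_cmult \<rho> e0 L2e1')
  have o1: "L2_inner e1' e0 = 0" using c by (simp add: e1'_def[abs_def])
  then have "L2_inner e0 e1' = 0" using L2_inner_commute[of e0 e1'] by simp
  note o = o1 this
  have 0: "L2_inner f e0 = 0"
    using a o by (simp add: f_def[abs_def] L2_inner_diff_left L2_inner_cmult_left L2_cmult L2_diff \<rho> e0 L2e1')
  have "L2_inner f e1' = 0"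
    using b o by (simp add: f_def[abs_def] L2_inner_diff_left L2_inner_cmult_left L2_cmult L2_diff \<rho> e0 L2e1')
  moreover have "L2_inner f e1' = L2_inner f e1 - cnj c * L2_inner f e0"
    by (simp add: e1'_def[abs_def] L2_inner_diff_right L2_inner_cmult_right L2_cmult e0 e1 L2f)
  ultimately have 1: "L2_inner f e1 = 0" using 0 by simp
  have "L2_inner f \<rho> = 0"
    by (rule orth[OF L2f _ 0 1]) (simp add: f_def e1'_def)
  moreover have "L2_inner f f = L2_inner f \<rho> - cnj a * L2_inner f e0 - cnj b * L2_inner f e1'"
    by (subst (2) f_def[abs_def]) (simp add: L2_inner_diff_right L2_inner_cmult_right L2_cmult L2_diff \<rho> e0 L2e1' L2f)
  ultimately have "L2_inner f f = 0" using 0 \<open>L2_inner f e1' = 0\<close> by simp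
  then have "AE x in lebesgue. f x = 0" using L2_norm_sq_zero_iff[OF L2f] by (simp add: L2_inner_self)
  then have "AE x in lebesgue. \<rho> x = (a - b * c) * e0 x + b * e1 x"
    by eventually_elim (simp add: f_def e1'_def algebra_simps)
  with that show ?thesis by blast
qed

section \<open>The quasi-differential equation as a first-order system\<close>

locale quasi_operator =
  fixes p Q r s :: "real \<Rightarrow> real"
  assumes standing: "standing_A p Q r s"
begin

abbreviation "qd \<equiv> quasi p Q r s"

text \<open>Solving the definitions of the quasi-derivatives for the ordinary derivatives gives
  \<open>u' = cA u + cB u1\<close> and \<open>u1' = cC u + cD u1 + u2\<close>.\<close>

definition cA :: "real \<Rightarrow> complex" where "cA x = (of_real (Q x) + \<i> * of_real (r x)) / of_real (p x)"
definition cB :: "real \<Rightarrow> complex" where "cB x = 1 / of_real (p x)"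
definition cC :: "real \<Rightarrow> complex" where "cC x = - of_real (((Q x)\<^sup>2 + (r x)\<^sup>2) / p x - s x)"
definition cD :: "real \<Rightarrow> complex" where "cD x = - ((of_real (Q x) - \<i> * of_real (r x)) / of_real (p x))"

lemma coeff_measurable [measurable]:
  "p \<in> borel_measurable lebesgue" "Q \<in> borel_measurable lebesgue"
  "r \<in> borel_measurable lebesgue" "s \<in> borel_measurable lebesgue"
  using standing by (auto simp: standing_A_def)

lemma p_nonzero: "AE x in lebesgue. p x \<noteq> 0"
  using standing by (auto simp: standing_A_def)

lemma coeff_sq_integrable:
  "set_integrable lebesgue {a..b} (\<lambda>x. (1 / sqrt \<bar>p x\<bar>)\<^sup>2)"
  "set_integrable lebesgue {a..b} (\<lambda>x. (Q x / sqrt \<bar>p x\<bar>)\<^sup>2)"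
  "set_integrable lebesgue {a..b} (\<lambda>x. (r x / sqrt \<bar>p x\<bar>)\<^sup>2)"
  "set_integrable lebesgue {a..b} s"
  using standing by (auto simp: standing_A_def L2_loc_def L1_loc_def)

definition coeff_bound :: "real \<Rightarrow> real" where
  "coeff_bound x = ((1 / sqrt \<bar>p x\<bar>)\<^sup>2 + (Q x / sqrt \<bar>p x\<bar>)\<^sup>2 + (r x / sqrt \<bar>p x\<bar>)\<^sup>2) + \<bar>s x\<bar>"

lemma coeff_bound_integrable: "set_integrable lebesgue {a..b} coeff_bound"
  unfolding coeff_bound_def by (intro set_integral_add coeff_sq_integrable set_integrable_abs)

text \<open>The bound \<open>\<bar>a\<bar> + \<bar>b\<bar> \<le> 1 + a\<^sup>2 + b\<^sup>2\<close>
  converts the square-integrability assumptions on the quotients by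
  \<open>sqrt \<bar>p\<bar>\<close> into local integrability of the coefficients.\<close>

lemma cmod_Q_ir_le: "cmod ((of_real a + \<i> * of_real b) / of_real c) \<le> (1 / sqrt \<bar>c\<bar>)\<^sup>2 + (a / sqrt \<bar>c\<bar>)\<^sup>2 + (b / sqrt \<bar>c\<bar>)\<^sup>2"
proof -
  have "\<bar>a\<bar> + \<bar>b\<bar> \<le> 1 + a\<^sup>2 + b\<^sup>2"
  proof -
    have "2 * \<bar>a\<bar> \<le> a\<^sup>2 + 1" "2 * \<bar>b\<bar> \<le> b\<^sup>2 + 1"
      using sum_squares_bound[of "\<bar>a\<bar>" 1] sum_squares_bound[of "\<bar>b\<bar>" 1] by simp_all
    then show ?thesis using zero_le_power2[of a] zero_le_power2[of b] by linarith
  qed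
  moreover have "cmod (of_real a + \<i> * of_real b) \<le> \<bar>a\<bar> + \<bar>b\<bar>"
    by (rule order_trans[OF norm_triangle_ineq]) (simp add: norm_mult)
  ultimately have "cmod (of_real a + \<i> * of_real b) / \<bar>c\<bar> \<le> (1 + a\<^sup>2 + b\<^sup>2) / \<bar>c\<bar>"
    by (intro divide_right_mono) auto
  also have "\<dots> = (1 / sqrt \<bar>c\<bar>)\<^sup>2 + (a / sqrt \<bar>c\<bar>)\<^sup>2 + (b / sqrt \<bar>c\<bar>)\<^sup>2"
    by (simp add: power_divide add_divide_distrib)
  finally show ?thesis by (simp only: norm_divide norm_of_real)
qed

lemma coeff_loc_int: "loc_int cA" "loc_int cB" "loc_int cC" "loc_int cD"
proof -
  have pos: "0 \<le> (1 / sqrt \<bar>p x\<bar>)\<^sup>2" "0 \<le> (Q x / sqrt \<bar>p x\<bar>)\<^sup>2" "0 \<le> (r x / sqrt \<bar>p x\<bar>)\<^sup>2" for x by simp_all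
  have [measurable]: "cA \<in> borel_measurable lebesgue" "cB \<in> borel_measurable lebesgue"
    "cC \<in> borel_measurable lebesgue" "cD \<in> borel_measurable lebesgue"
    unfolding cA_def[abs_def] cB_def[abs_def] cC_def[abs_def] cD_def[abs_def] by measurable
  show "loc_int cA"
  proof (rule loc_int_bound[OF _ coeff_bound_integrable])
    show "cmod (cA x) \<le> coeff_bound x" for x
      using cmod_Q_ir_le[of "Q x" "r x" "p x"] by (simp add: cA_def coeff_bound_def)
  qed measurable
  show "loc_int cD"
  proof (rule loc_int_bound[OF _ coeff_bound_integrable])
    show "cmod (cD x) \<le> coeff_bound x" for x
      using cmod_Q_ir_le[of "Q x" "- r x" "p x"] by (simp add: cD_def coeff_bound_def)
  qed measurable
  show "loc_int cB"
  proof (rule loc_int_bound[OF _ coeff_bound_integrable])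
    show "cmod (cB x) \<le> coeff_bound x" for x
    proof -
      have "cmod (cB x) = (1 / sqrt \<bar>p x\<bar>)\<^sup>2" by (simp add: cB_def norm_divide power_divide)
      then show ?thesis unfolding coeff_bound_def using pos[of x] by linarith
    qed
  qed measurable
  show "loc_int cC"
  proof (rule loc_int_bound[OF _ coeff_bound_integrable])
    show "cmod (cC x) \<le> coeff_bound x" for x
    proof -
      have "cmod (cC x) = \<bar>((Q x)\<^sup>2 + (r x)\<^sup>2) / p x - s x\<bar>"
        unfolding cC_def norm_minus_cancel norm_of_real by simp
      also have "\<dots> \<le> ((Q x)\<^sup>2 + (r x)\<^sup>2) / \<bar>p x\<bar> + \<bar>s x\<bar>"
        using abs_triangle_ineq4[of "((Q x)\<^sup>2 + (r x)\<^sup>2) / p x" "s x"] by (simp add: abs_divide)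
      also have "((Q x)\<^sup>2 + (r x)\<^sup>2) / \<bar>p x\<bar> = (Q x / sqrt \<bar>p x\<bar>)\<^sup>2 + (r x / sqrt \<bar>p x\<bar>)\<^sup>2"
        by (simp add: power_divide add_divide_distrib)
      finally show ?thesis unfolding coeff_bound_def using pos[of x] by linarith
    qed
  qed measurable
qed

sublocale linear_system cA cB cC cD
  by standard (rule coeff_loc_int)+

text \<open>Since \<open>p\<close> is nonzero almost everywhere, the existentially quantified
  derivatives are determined up to null sets; from here on the equation is a linear system.\<close>

lemma qd_iff:
  "qd u u1 u2 \<longleftrightarrow> AC_loc_with u (\<lambda>x. cA x * u x + cB x * u1 x) \<and>
     AC_loc_with u1 (\<lambda>x. cC x * u x + cD x * u1 x + u2 x)"
proof
  assume "qd u u1 u2"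
  then obtain g h where gh: "AC_loc_with u g" "AC_loc_with u1 h"
    "AE x in lebesgue. u1 x = of_real (p x) * g x - (of_real (Q x) + \<i> * of_real (r x)) * u x"
    "AE x in lebesgue. u2 x = h x + (of_real (Q x) - \<i> * of_real (r x)) / of_real (p x) * u1 x
              + of_real (((Q x)\<^sup>2 + (r x)\<^sup>2) / p x - s x) * u x"
    unfolding quasi_def by blast
  have g: "AE x in lebesgue. g x = cA x * u x + cB x * u1 x"
    using gh(3) p_nonzero by eventually_elim (simp add: cA_def cB_def field_simps)
  have h: "AE x in lebesgue. h x = cC x * u x + cD x * u1 x + u2 x"
    using gh(4) by eventually_elim (simp only: cC_def cD_def, simp add: algebra_simps)
  show "AC_loc_with u (\<lambda>x. cA x * u x + cB x * u1 x) \<and>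
     AC_loc_with u1 (\<lambda>x. cC x * u x + cD x * u1 x + u2 x)"
    using AC_cong_AE[OF gh(1) g] AC_cong_AE[OF gh(2) h] by simp
next
  assume *: "AC_loc_with u (\<lambda>x. cA x * u x + cB x * u1 x) \<and>
     AC_loc_with u1 (\<lambda>x. cC x * u x + cD x * u1 x + u2 x)"
  have "AE x in lebesgue. u1 x = of_real (p x) * (cA x * u x + cB x * u1 x) - (of_real (Q x) + \<i> * of_real (r x)) * u x"
    using p_nonzero by eventually_elim (simp add: cA_def cB_def field_simps)
  moreover have "AE x in lebesgue. u2 x = (cC x * u x + cD x * u1 x + u2 x) + (of_real (Q x) - \<i> * of_real (r x)) / of_real (p x) * u1 x
              + of_real (((Q x)\<^sup>2 + (r x)\<^sup>2) / p x - s x) * u x"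
    by (simp only: cC_def cD_def) (simp add: algebra_simps)
  ultimately show "qd u u1 u2" unfolding quasi_def using * by blast
qed

lemma qd_AC:
  assumes "qd u u1 u2"
  shows "AC_loc_with u (\<lambda>x. cA x * u x + cB x * u1 x)" "AC_loc_with u1 (\<lambda>x. cC x * u x + cD x * u1 x + u2 x)"
  using assms qd_iff by auto

lemma qd_continuous: "qd u u1 u2 \<Longrightarrow> continuous_on UNIV u" "qd u u1 u2 \<Longrightarrow> continuous_on UNIV u1"
  using qd_AC AC_continuous by blast+

lemma qd_loc_bdd: "qd u u1 u2 \<Longrightarrow> loc_bdd u" "qd u u1 u2 \<Longrightarrow> loc_bdd u1"
  using qd_AC AC_loc_bdd by blast+

lemma qd_cong_AE:
  assumes "qd u u1 u2" "AE x in lebesgue. u2 x = u2' x"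
  shows "qd u u1 u2'"
  using assms AC_cong_AE[of u1 _ "\<lambda>x. cC x * u x + cD x * u1 x + u2' x"] unfolding qd_iff
  by (auto elim!: eventually_mono)

lemma qd_add_cmult:
  assumes u: "qd u u1 u2" and v: "qd v v1 v2"
  shows "qd (\<lambda>x. u x + z * v x) (\<lambda>x. u1 x + z * v1 x) (\<lambda>x. u2 x + z * v2 x)"
  unfolding qd_iff
  using AC_cong_AE[OF AC_add[OF qd_AC(1)[OF u] AC_cmult[OF qd_AC(1)[OF v], of z]] AE_I2]
    AC_cong_AE[OF AC_add[OF qd_AC(2)[OF u] AC_cmult[OF qd_AC(2)[OF v], of z]] AE_I2]
  by (auto simp: algebra_simps)

lemma qd_diff:
  assumes u: "qd u u1 u2" and v: "qd v v1 v2"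
  shows "qd (\<lambda>x. u x - v x) (\<lambda>x. u1 x - v1 x) (\<lambda>x. u2 x - v2 x)"
  using qd_add_cmult[OF assms, of "-1"] by simp

lemma qd_exists:
  assumes "loc_int F"
  obtains u u1 where "qd u u1 F" "u c = x0" "u1 c = y0"
proof -
  have "loc_int (\<lambda>x. 0)" by (simp add: loc_int_def set_integrable_def)
  then obtain u u1 where "AC_loc_with u (\<lambda>x. cA x * u x + cB x * u1 x + 0)"
     "AC_loc_with u1 (\<lambda>x. cC x * u x + cD x * u1 x + F x)" "u c = x0" "u1 c = y0"
    using exists_solution[OF _ assms] by blast
  with that show ?thesis by (auto simp: qd_iff)
qed

lemma qd_unique:
  assumes u: "qd u u1 u2" and "AE x in lebesgue. x \<in> {l..h} \<longrightarrow> u2 x = 0"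
    and "c \<in> {l..h}" "u c = 0" "u1 c = 0" "x \<in> {l..h}"
  shows "u x = 0 \<and> u1 x = 0"
  using assms(2) by (intro unique_zero[OF qd_AC[OF u] _ _ assms(3-6)]) (auto elim!: eventually_mono)

text \<open>Where \<open>u\<close> vanishes, its derivative reduces to \<open>cB u1\<close>, and
  \<open>cB\<close> is nonzero almost everywhere; continuity of \<open>u1\<close> removes the null
  set. Compact support of \<open>u\<close> is thus inherited by \<open>u1\<close>.\<close>

lemma qd_locally_zero1:
  assumes u: "qd u u1 u2" and z: "\<And>x. x \<in> S \<Longrightarrow> u x = 0" and S: "open S" and x: "x \<in> S"
  shows "u1 x = 0"
proof (rule continuous_AE_zero_on_open[OF qd_continuous(2)[OF u] _ S x])
  have "AE x in lebesgue. x \<in> S \<longrightarrow> cA x * u x + cB x * u1 x = 0"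
    by (rule AC_locally_zero[OF qd_AC(1)[OF u] z S])
  then show "AE x in lebesgue. x \<in> S \<longrightarrow> u1 x = 0"
    using p_nonzero by eventually_elim (auto simp: z cB_def)
qed

lemma qd_locally_zero2:
  assumes u: "qd u u1 u2" and z: "\<And>x. x \<in> S \<Longrightarrow> u x = 0" and S: "open S"
  shows "AE x in lebesgue. x \<in> S \<longrightarrow> u2 x = 0"
proof -
  note u1 = qd_locally_zero1[OF u z S]
  have "AE x in lebesgue. x \<in> S \<longrightarrow> cC x * u x + cD x * u1 x + u2 x = 0"
    by (rule AC_locally_zero[OF qd_AC(2)[OF u] u1 S])
  then show ?thesis
    by eventually_elim (auto simp: z u1)
qed

text \<open>Formal symmetry is visible in the coefficients: \<open>cB\<close> and \<open>cC\<close>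
  are real and \<open>cnj cA = - cD\<close>, so everything except the second quasi-derivatives
  cancels.\<close>

lemma Lagrange_identity:
  assumes u: "qd u u1 u2" and v: "qd v v1 v2"
  shows "AC_loc_with (\<lambda>x. u1 x * cnj (v x) - u x * cnj (v1 x)) (\<lambda>x. u2 x * cnj (v x) - u x * cnj (v2 x))"
proof (rule AC_cong_AE[OF AC_diff[OF AC_mult[OF qd_AC(2)[OF u] AC_cnj[OF qd_AC(1)[OF v]]]
         AC_mult[OF qd_AC(1)[OF u] AC_cnj[OF qd_AC(2)[OF v]]]]], rule AE_I2)
  fix x
  have c: "cnj (cB x) = cB x" "cnj (cC x) = cC x" "cnj (cA x) = - cD x" "cnj (cD x) = - cA x"
    by (auto simp: cA_def cB_def cC_def cD_def)
  show "(cC x * u x + cD x * u1 x + u2 x) * cnj (v x) + u1 x * cnj (cA x * v x + cB x * v1 x) -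
         ((cA x * u x + cB x * u1 x) * cnj (v1 x) + u x * cnj (cC x * v x + cD x * v1 x + v2 x)) =
         u2 x * cnj (v x) - u x * cnj (v2 x)"
    by (simp add: c algebra_simps)
qed

section \<open>Graphs of the maximal and preminimal operators, and duality between them\<close>

lemma qd_uminus_cong:
  assumes "qd y y1 y2" "AE x in lebesgue. f x = - y2 x"
  shows "qd y y1 (\<lambda>x. - f x)"
  by (rule qd_cong_AE[OF assms(1)]) (use assms(2) in \<open>auto elim!: eventually_mono\<close>)

lemma Lmax_iff:
  "(u, f) \<in> Lmax p Q r s \<longleftrightarrow> L2 u \<and> L2 f \<and> (\<exists>y y1. (AE x in lebesgue. y x = u x) \<and> qd y y1 (\<lambda>x. - f x))"
  (is "_ \<longleftrightarrow> ?R")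
proof
  assume "(u, f) \<in> Lmax p Q r s"
  then obtain y y1 y2 where *: "L2 u" "L2 f" "AE x in lebesgue. y x = u x" "qd y y1 y2" "AE x in lebesgue. f x = - y2 x"
    by (auto simp: Lmax_def)
  from *(1-3) qd_uminus_cong[OF *(4,5)] show ?R by blast
next
  assume ?R
  then obtain y y1 where *: "L2 u" "L2 f" "AE x in lebesgue. y x = u x" "qd y y1 (\<lambda>x. - f x)" by blast
  then show "(u, f) \<in> Lmax p Q r s"
    unfolding Lmax_def mem_Collect_eq prod.case
    by (intro conjI exI[of _ y] exI[of _ y1] exI[of _ "\<lambda>x. - f x"]) auto
qed

lemma L00_iff:
  "(u, f) \<in> L00 p Q r s \<longleftrightarrow> L2 u \<and> L2 f \<and>
    (\<exists>y y1 c d. (\<forall>x. x \<notin> {c..d} \<longrightarrow> y x = 0) \<and> (AE x in lebesgue. y x = u x) \<and> qd y y1 (\<lambda>x. - f x))"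
  (is "_ \<longleftrightarrow> ?R")
proof
  assume "(u, f) \<in> L00 p Q r s"
  then obtain y y1 y2 c d where *: "L2 u" "L2 f" "\<forall>x. x \<notin> {c..d} \<longrightarrow> y x = 0" "AE x in lebesgue. y x = u x"
      "qd y y1 y2" "AE x in lebesgue. f x = - y2 x"
    unfolding L00_def mem_Collect_eq prod.case by blast
  from *(1-4) qd_uminus_cong[OF *(5,6)] show ?R by blast
next
  assume ?R
  then obtain y y1 c d where *: "L2 u" "L2 f" "\<forall>x. x \<notin> {c..d} \<longrightarrow> y x = 0" "AE x in lebesgue. y x = u x"
      "qd y y1 (\<lambda>x. - f x)" by blast
  then show "(u, f) \<in> L00 p Q r s"
    unfolding L00_def mem_Collect_eq prod.case
    by (intro conjI exI[of _ y] exI[of _ y1] exI[of _ "\<lambda>x. - f x"] exI[of _ c] exI[of _ d]) auto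
qed

lemma L00_subset_Lmax: "L00 p Q r s \<subseteq> Lmax p Q r s"
proof safe
  fix u f assume "(u, f) \<in> L00 p Q r s"
  then show "(u, f) \<in> Lmax p Q r s" unfolding L00_iff Lmax_iff by blast
qed

lemma Lmax_single_valued: "single_valued_op (Lmax p Q r s)"
  unfolding single_valued_op_def
proof (intro allI impI)
  fix u v f g assume "(u, f) \<in> Lmax p Q r s" "(v, g) \<in> Lmax p Q r s" and uv: "AE x in lebesgue. u x = v x"
  then obtain y y1 z z1 where y: "AE x in lebesgue. y x = u x" "qd y y1 (\<lambda>x. - f x)"
    and z: "AE x in lebesgue. z x = v x" "qd z z1 (\<lambda>x. - g x)" by (auto simp: Lmax_iff)
  have d: "qd (\<lambda>x. y x - z x) (\<lambda>x. y1 x - z1 x) (\<lambda>x. - f x - - g x)" by (rule qd_diff[OF y(2) z(2)])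
  have "AE x in lebesgue. x \<in> UNIV \<longrightarrow> y x - z x = 0" using y(1) z(1) uv by eventually_elim simp
  then have "y x - z x = 0" for x
    using continuous_AE_zero_on_open[OF qd_continuous(1)[OF d] _ open_UNIV] by blast
  from qd_locally_zero2[OF d this open_UNIV] show "AE x in lebesgue. f x = g x"
    by eventually_elim simp
qed

lemma Lagrange_compact:
  assumes u: "qd u u1 (\<lambda>x. - f x)" and v: "qd v v1 (\<lambda>x. - g x)" and supp: "\<And>x. x \<notin> {c..d} \<Longrightarrow> u x = 0"
  shows "(\<integral>x. u x * cnj (g x) - f x * cnj (v x) \<partial>lebesgue) = 0"
proof -
  have "u1 x = 0" if "x \<notin> {c..d}" for x
    using qd_locally_zero1[OF u, of "- {c..d}" x] supp that by auto
  with supp have "(\<integral>x. - f x * cnj (v x) - u x * cnj (- g x) \<partial>lebesgue) = 0"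
    by (intro AC_integral_zero(2)[OF Lagrange_identity[OF u v], of c d]) auto
  then show ?thesis by (simp add: algebra_simps)
qed

lemma Lmax_subset_adjoint: "Lmax p Q r s \<subseteq> adjoint_op (L00 p Q r s)"
proof (clarsimp simp: adjoint_op_def, intro conjI ballI, safe)
  fix v w assume vw: "(v, w) \<in> Lmax p Q r s"
  then show L2: "L2 v" "L2 w" by (auto simp: Lmax_iff)
  fix u f assume "(u, f) \<in> L00 p Q r s"
  then obtain y y1 c d where y: "\<And>x. x \<notin> {c..d} \<Longrightarrow> y x = 0" "AE x in lebesgue. y x = u x" "qd y y1 (\<lambda>x. - f x)"
    and L2uf: "L2 u" "L2 f" by (auto simp: L00_iff)
  obtain z z1 where z: "AE x in lebesgue. z x = v x" "qd z z1 (\<lambda>x. - w x)" using vw by (auto simp: Lmax_iff)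
  have L2yz: "L2 y" "L2 z"
    using L2_cong_AE[OF L2uf(1), of y] L2_cong_AE[OF L2(1), of z] y(2) z(1) by (simp_all only: eq_commute)
  have "L2_inner y w - L2_inner f z = 0"
    using Lagrange_compact[OF y(3) z(2) y(1)] L2_inner_integrable[OF L2yz(1) L2(2)] L2_inner_integrable[OF L2uf(2) L2yz(2)]
    by (simp add: L2_inner_def)
  then show "L2_inner f v = L2_inner u w"
    using L2_inner_cong_AE[OF L2yz(1) L2(2) y(2) AE_I2[OF refl]] L2_inner_cong_AE[OF L2uf(2) L2yz(2) AE_I2[OF refl] z(1)] by simp
qed

text \<open>
  With \<open>z\<close> a solution of \<open>L z = w\<close>, the function \<open>v - z\<close> is orthogonal to every \<open>f\<close> that lives on
  \<open>[-R, R]\<close> and is orthogonal there to the two-dimensional space of solutions of \<open>L e = 0\<close>: the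
  solution of \<open>L u = f\<close> vanishing at \<open>-R\<close> then vanishes at \<open>R\<close> as well, so it lies in the domain of
  the preminimal operator.
\<close>

lemma adjoint_local:
  assumes vw: "(v, w) \<in> adjoint_op (L00 p Q r s)" and R: "R > 0"
  obtains y y1 where "qd y y1 (\<lambda>x. - w x)" "AE x in lebesgue. x \<in> {-R..R} \<longrightarrow> v x = y x"
proof -
  have L2: "L2 v" "L2 w" and adj: "\<And>u f. (u, f) \<in> L00 p Q r s \<Longrightarrow> L2_inner f v = L2_inner u w"
    using vw by (auto simp: adjoint_op_def)
  have zero: "loc_int (\<lambda>x. 0)" by (simp add: loc_int_def set_integrable_def)
  obtain z z1 where z: "qd z z1 (\<lambda>x. - w x)"
    using qd_exists[OF loc_int_uminus[OF L2_loc_int[OF L2(2)]]] by metis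
  \<comment> \<open>Data \<open>(1, 0)\<close> and \<open>(0, 1)\<close> at \<open>R\<close> make
    the Lagrange boundary term at \<open>R\<close> read off \<open>u1 R\<close> and
    \<open>- u R\<close> respectively.\<close>
  obtain e0 e01 where e0: "qd e0 e01 (\<lambda>x. 0)" "e0 R = 1" "e01 R = 0" using qd_exists[OF zero] .
  obtain e1 e11 where e1: "qd e1 e11 (\<lambda>x. 0)" "e1 R = 0" "e11 R = 1" using qd_exists[OF zero] .
  let ?I = "\<lambda>x. indicat_real {-R..R} x"
  define \<rho> where "\<rho> x = ?I x *\<^sub>R v x - ?I x *\<^sub>R z x" for x
  have "L2 (\<lambda>x. of_real (?I x) * v x)" 
  proof (rule L2_mult_bounded[OF L2(1)])
    show "(\<lambda>x. complex_of_real (?I x)) \<in> borel_measurable lebesgue" by measurable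
    show "cmod (complex_of_real (?I x)) \<le> 1" for x unfolding norm_of_real by (simp add: indicator_def)
  qed
  then have Iv: "L2 (\<lambda>x. ?I x *\<^sub>R v x)" by (simp add: scaleR_conv_of_real)
  note Iz = L2_cutoff[OF qd_loc_bdd(1)[OF z], of "-R" R]
  have "L2 \<rho>" unfolding \<rho>_def by (rule L2_diff[OF Iv Iz])
  then obtain c0 c1 where c: "AE x in lebesgue. \<rho> x = c0 * (?I x *\<^sub>R e0 x) + c1 * (?I x *\<^sub>R e1 x)"
  proof (rule L2_orthogonal_complement_of_pair[OF _ L2_cutoff[OF qd_loc_bdd(1)[OF e0(1)], of "-R" R] L2_cutoff[OF qd_loc_bdd(1)[OF e1(1)], of "-R" R]])
    fix f assume f: "L2 f" and "\<And>x. \<rho> x = 0 \<Longrightarrow> ?I x *\<^sub>R e0 x = 0 \<Longrightarrow> ?I x *\<^sub>R e1 x = 0 \<Longrightarrow> f x = 0"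
      and f0: "L2_inner f (\<lambda>x. ?I x *\<^sub>R e0 x) = 0" and f1: "L2_inner f (\<lambda>x. ?I x *\<^sub>R e1 x) = 0"
    then have supp: "f x = 0" if "x \<notin> {-R..R}" for x
      using that by (auto simp: \<rho>_def)
    obtain u u1 where u: "qd u u1 (\<lambda>x. - f x)" "u (-R) = 0" "u1 (-R) = 0"
      using qd_exists[OF loc_int_uminus[OF L2_loc_int[OF f]]] .
    have end_value: "u1 R * cnj (e R) - u R * cnj (e' R) = 0"
      if e: "qd e e' (\<lambda>x. 0)" "L2_inner f (\<lambda>x. ?I x *\<^sub>R e x) = 0" for e e'
    proof -
      have "u1 R * cnj (e R) - u R * cnj (e' R) = (LINT x:{-R..R}|lebesgue. - f x * cnj (e x) - u x * cnj 0)"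
        using Lagrange_identity[OF u(1) e(1), unfolded AC_loc_with_iff, THEN conjunct2, rule_format, of "-R" R] u(2,3) R
        by simp
      also have "\<dots> = - (LINT x:{-R..R}|lebesgue. f x * cnj (e x))"
        unfolding set_lebesgue_integral_def by simp
      also have "(LINT x:{-R..R}|lebesgue. f x * cnj (e x)) = L2_inner f (\<lambda>x. ?I x *\<^sub>R e x)"
        unfolding set_lebesgue_integral_def L2_inner_def by (simp add: scaleR_conv_of_real mult_ac)
      finally show ?thesis using e(2) by simp
    qed
    have uR: "u R = 0" "u1 R = 0" using end_value[OF e0(1) f0] end_value[OF e1(1) f1] e0 e1 by auto
    have usupp: "u x = 0" if "x \<notin> {-R..R}" for x
    proof (cases "x < -R")
      case True
      \<comment> \<open>The end point \<open>-R\<close> belongs to the support interval, so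
        \<open>f\<close> vanishes here only up to one point.\<close>
      have "AE t in lebesgue. t \<in> {x..-R} \<longrightarrow> - f t = 0"
      proof (rule AE_I'[of "{-R}"])
        have "f t = 0" if "t \<in> {x..-R}" "t \<noteq> -R" for t using that R by (intro supp) auto
        then show "{t \<in> space lebesgue. \<not> (t \<in> {x..-R} \<longrightarrow> - f t = 0)} \<subseteq> {-R}" by auto
      qed auto
      from qd_unique[OF u(1) this _ u(2,3), of x] True show ?thesis by auto
    next
      case False
      with that have "x > R" by auto
      have "AE t in lebesgue. t \<in> {R..x} \<longrightarrow> - f t = 0"
      proof (rule AE_I'[of "{R}"])
        have "f t = 0" if "t \<in> {R..x}" "t \<noteq> R" for t using that R by (intro supp) auto
        then show "{t \<in> space lebesgue. \<not> (t \<in> {R..x} \<longrightarrow> - f t = 0)} \<subseteq> {R}" by auto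
      qed auto
      from qd_unique[OF u(1) this _ uR, of x] \<open>x > R\<close> show ?thesis by auto
    qed
    have L2u: "L2 u" by (rule L2_compact_support[OF qd_loc_bdd(1)[OF u(1)] usupp])
    have "(u, f) \<in> L00 p Q r s"
      unfolding L00_iff using L2u f u(1) usupp by (intro conjI exI[of _ u] exI[of _ u1] exI[of _ "-R"] exI[of _ R]) auto
    then have 1: "L2_inner f v = L2_inner u w" by (rule adj)
    have fI: "f x * cnj (?I x *\<^sub>R h x) = f x * cnj (h x)" for h x using supp[of x] by (auto simp: indicator_def)
    have "L2_inner u w - L2_inner f (\<lambda>x. ?I x *\<^sub>R z x) = 0"
      using Lagrange_compact[OF u(1) z usupp] L2_inner_integrable[OF L2u L2(2)] L2_inner_integrable[OF f Iz]
      unfolding L2_inner_def fI by simp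
    moreover have "L2_inner f v = L2_inner f (\<lambda>x. ?I x *\<^sub>R v x)" unfolding L2_inner_def fI ..
    ultimately show "L2_inner f \<rho> = 0"
      unfolding \<rho>_def using 1 by (simp only: L2_inner_diff_right[OF Iv Iz f])
  qed blast
  show ?thesis
  proof
    show "qd (\<lambda>x. (z x + c0 * e0 x) + c1 * e1 x) (\<lambda>x. (z1 x + c0 * e01 x) + c1 * e11 x) (\<lambda>x. - w x)"
      using qd_add_cmult[OF qd_add_cmult[OF z e0(1), of c0] e1(1), of c1] by simp
    show "AE x in lebesgue. x \<in> {-R..R} \<longrightarrow> v x = (z x + c0 * e0 x) + c1 * e1 x"
      using c by eventually_elim (auto simp: \<rho>_def algebra_simps)
  qed
qed

text \<open>The local representatives on growing intervals are glued by uniqueness, which shows them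
  all to be the same function.\<close>

theorem adjoint_L00: "adjoint_op (L00 p Q r s) = Lmax p Q r s"
proof
  show "adjoint_op (L00 p Q r s) \<subseteq> Lmax p Q r s"
  proof safe
    fix v w assume vw: "(v, w) \<in> adjoint_op (L00 p Q r s)"
    then have L2: "L2 v" "L2 w" by (auto simp: adjoint_op_def)
    obtain y y1 where y: "qd y y1 (\<lambda>x. - w x)" "AE x in lebesgue. x \<in> {-1..1} \<longrightarrow> v x = y x"
      using adjoint_local[OF vw, of 1] by auto
    have "AE x in lebesgue. x \<in> {- real (Suc n)..real (Suc n)} \<longrightarrow> v x = y x" for n
    proof -
      obtain z z1 where z: "qd z z1 (\<lambda>x. - w x)" "AE x in lebesgue. x \<in> {- real (Suc n)..real (Suc n)} \<longrightarrow> v x = z x"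
        using adjoint_local[OF vw, of "real (Suc n)"] by auto
      have d: "qd (\<lambda>x. y x - z x) (\<lambda>x. y1 x - z1 x) (\<lambda>x. 0)" using qd_diff[OF y(1) z(1)] by simp
      \<comment> \<open>Agreement near 0 gives equal Cauchy data there for the homogeneous equation
        satisfied by the difference, hence agreement everywhere.\<close>
      have "AE x in lebesgue. x \<in> {-1<..<1} \<longrightarrow> y x - z x = 0" using y(2) z(2) by eventually_elim auto
      then have 0: "y x - z x = 0" if "x \<in> {-1<..<1}" for x
        using continuous_AE_zero_on_open[OF qd_continuous(1)[OF d] _ open_greaterThanLessThan] that by blast
      then have 1: "y1 0 - z1 0 = 0" using qd_locally_zero1[OF d _ open_greaterThanLessThan] by force
      have "y x - z x = 0" for x
        using qd_unique[OF d, of "min x 0" "max x 0" 0 x] 0[of 0] 1 by auto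
      then have "y = z" by auto
      with z(2) show ?thesis by simp
    qed
    then have "AE x in lebesgue. \<forall>n. x \<in> {- real (Suc n)..real (Suc n)} \<longrightarrow> v x = y x"
      by (simp only: AE_all_countable) blast
    then have "AE x in lebesgue. y x = v x"
    proof eventually_elim
      case (elim x)
      obtain n where "\<bar>x\<bar> < real n" using reals_Archimedean2 by blast
      then have "x \<in> {- real (Suc n)..real (Suc n)}" by auto
      with elim[rule_format, of n] show ?case by simp
    qed
    with L2 y(1) show "(v, w) \<in> Lmax p Q r s" by (auto simp: Lmax_iff)
  qed
qed (rule Lmax_subset_adjoint)

end

section \<open>Cut-off functions and the energy estimate\<close>

context quasi_operator
begin

text \<open>
  The function \<open>\<psi>\<close> plays the role of \<open>p \<phi>'\<close>. Regularity is required of this product only, not of \<open>p\<close>.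
\<close>

definition multiplier :: "(real \<Rightarrow> real) \<Rightarrow> (real \<Rightarrow> real) \<Rightarrow> (real \<Rightarrow> real) \<Rightarrow> (real \<Rightarrow> real) \<Rightarrow> bool" where
  "multiplier \<phi> \<phi>' \<psi> \<psi>' \<longleftrightarrow>
     AC_loc_with (\<lambda>x. of_real (\<phi> x)) (\<lambda>x. of_real (\<phi>' x)) \<and>
     AC_loc_with (\<lambda>x. of_real (\<psi> x)) (\<lambda>x. of_real (\<psi>' x)) \<and>
     (AE x in lebesgue. \<psi> x = p x * \<phi>' x) \<and>
     (\<exists>B. \<forall>x. \<bar>\<phi>' x\<bar> \<le> B \<and> \<bar>\<psi>' x\<bar> \<le> B) \<and>
     L2 (\<lambda>x. of_real (Q x * \<phi>' x))"

definition supported :: "(real \<Rightarrow> real) \<Rightarrow> (real \<Rightarrow> real) \<Rightarrow> (real \<Rightarrow> real) \<Rightarrow> (real \<Rightarrow> real) \<Rightarrow> real set \<Rightarrow> bool" where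
  "supported \<phi> \<phi>' \<psi> \<psi>' S \<longleftrightarrow> (\<forall>x. x \<notin> S \<longrightarrow> \<phi> x = 0 \<and> \<phi>' x = 0 \<and> \<psi> x = 0 \<and> \<psi>' x = 0)"

lemma multiplier_diff:
  assumes "multiplier \<phi> \<phi>' \<psi> \<psi>'" "multiplier \<eta> \<eta>' \<omega> \<omega>'"
  shows "multiplier (\<lambda>x. \<phi> x - \<eta> x) (\<lambda>x. \<phi>' x - \<eta>' x) (\<lambda>x. \<psi> x - \<omega> x) (\<lambda>x. \<psi>' x - \<omega>' x)"
  unfolding multiplier_def
proof (intro conjI)
  show "AC_loc_with (\<lambda>x. of_real (\<phi> x - \<eta> x)) (\<lambda>x. of_real (\<phi>' x - \<eta>' x))"
    using assms AC_diff unfolding multiplier_def of_real_diff by blast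
  show "AC_loc_with (\<lambda>x. of_real (\<psi> x - \<omega> x)) (\<lambda>x. of_real (\<psi>' x - \<omega>' x))"
    using assms AC_diff unfolding multiplier_def of_real_diff by blast
  have "AE x in lebesgue. \<psi> x = p x * \<phi>' x" "AE x in lebesgue. \<omega> x = p x * \<eta>' x"
    using assms by (auto simp: multiplier_def)
  then show "AE x in lebesgue. \<psi> x - \<omega> x = p x * (\<phi>' x - \<eta>' x)"
    by eventually_elim (simp add: right_diff_distrib)
  obtain B where "\<And>x. \<bar>\<phi>' x\<bar> \<le> B" "\<And>x. \<bar>\<psi>' x\<bar> \<le> B" using assms(1) unfolding multiplier_def by blast
  moreover obtain B' where "\<And>x. \<bar>\<eta>' x\<bar> \<le> B'" "\<And>x. \<bar>\<omega>' x\<bar> \<le> B'" using assms(2) unfolding multiplier_def by blast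
  ultimately show "\<exists>B. \<forall>x. \<bar>\<phi>' x - \<eta>' x\<bar> \<le> B \<and> \<bar>\<psi>' x - \<omega>' x\<bar> \<le> B"
    by (intro exI[of _ "B + B'"] allI conjI order_trans[OF abs_triangle_ineq4] add_mono) 
  show "L2 (\<lambda>x. of_real (Q x * (\<phi>' x - \<eta>' x)))"
    using assms L2_diff[of "\<lambda>x. of_real (Q x * \<phi>' x)" "\<lambda>x. of_real (Q x * \<eta>' x)"]
    by (simp add: multiplier_def right_diff_distrib)
qed

text \<open>The value of \<open>L\<close> at \<open>\<phi> u\<close> for \<open>f = L u\<close> and \<open>u1 = u\<^bsup>[1]\<^esup>\<close>.\<close>

definition mult_image :: "(real \<Rightarrow> real) \<Rightarrow> (real \<Rightarrow> real) \<Rightarrow> (real \<Rightarrow> real) \<Rightarrow>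
    (real \<Rightarrow> complex) \<Rightarrow> (real \<Rightarrow> complex) \<Rightarrow> (real \<Rightarrow> complex) \<Rightarrow> real \<Rightarrow> complex" where
  "mult_image \<phi> \<phi>' \<psi>' u u1 f x = of_real (\<phi> x) * f x - 2 * of_real (\<phi>' x) * u1 x - of_real (\<psi>' x) * u x
     - 2 * of_real (Q x * \<phi>' x) * u x"

lemma bounded_loc_bdd:
  assumes "(\<lambda>x. complex_of_real (h x)) \<in> borel_measurable lebesgue" "\<And>x. \<bar>h x\<bar> \<le> B"
  shows "loc_bdd (\<lambda>x. of_real (h x))"
  unfolding loc_bdd_def
proof (intro conjI allI)
  fix a b :: real
  have "0 \<le> B" using assms(2)[of 0] by linarith
  with assms(2) show "\<exists>B\<ge>0. \<forall>x\<in>{a..b}. cmod (of_real (h x)) \<le> B" by auto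
qed (rule assms)

lemma compactly_supported_bounded:
  assumes "loc_bdd u" "\<And>x. x \<notin> {c..d} \<Longrightarrow> u x = 0"
  obtains B where "\<And>x. cmod (u x) \<le> B"
proof -
  obtain B where B: "B \<ge> 0" "\<And>x. x \<in> {c..d} \<Longrightarrow> cmod (u x) \<le> B"
    using assms(1) unfolding loc_bdd_def by meson
  have "cmod (u x) \<le> B" for x using B assms(2)[of x] by (cases "x \<in> {c..d}") auto
  with that show ?thesis by blast
qed

lemma Re_integral_add_null:
  fixes F D :: "real \<Rightarrow> complex" and N :: "real \<Rightarrow> real"
  assumes "integrable M F" "integrable M N" "integrable M D" "integral\<^sup>L M D = 0"
  shows "Re (integral\<^sup>L M F) + \<kappa> * integral\<^sup>L M N = (\<integral>x. Re (F x) + \<kappa> * N x + Re (D x) \<partial>M)"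
  using assms by simp

lemma integrable_Re_add:
  fixes F D :: "real \<Rightarrow> complex" and N :: "real \<Rightarrow> real"
  assumes "integrable M F" "integrable M N" "integrable M D"
  shows "integrable M (\<lambda>x. Re (F x) + \<kappa> * N x + Re (D x))"
  using assms by simp

context
  fixes \<phi> \<phi>' \<psi> \<psi>' c d u u1 f
  assumes m: "multiplier \<phi> \<phi>' \<psi> \<psi>'" and supp: "supported \<phi> \<phi>' \<psi> \<psi>' {c..d}"
    and u: "qd u u1 (\<lambda>x. - f x)" and L2: "L2 u" "L2 f"
begin

lemma AC\<phi>: "AC_loc_with (\<lambda>x. of_real (\<phi> x)) (\<lambda>x. of_real (\<phi>' x))"
  and AC\<psi>: "AC_loc_with (\<lambda>x. of_real (\<psi> x)) (\<lambda>x. of_real (\<psi>' x))"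
  and ae\<psi>: "AE x in lebesgue. \<psi> x = p x * \<phi>' x"
  and L2Q: "L2 (\<lambda>x. of_real (Q x * \<phi>' x))"
  using m by (auto simp: multiplier_def)

lemma multiplier_loc_bdd: "loc_bdd (\<lambda>x. of_real (\<phi> x))" "loc_bdd (\<lambda>x. of_real (\<phi>' x))" "loc_bdd (\<lambda>x. of_real (\<psi>' x))"
proof -
  obtain B where "\<And>x. \<bar>\<phi>' x\<bar> \<le> B" "\<And>x. \<bar>\<psi>' x\<bar> \<le> B" using m unfolding multiplier_def by blast
  then show "loc_bdd (\<lambda>x. of_real (\<phi>' x))" "loc_bdd (\<lambda>x. of_real (\<psi>' x))"
    by (auto intro!: bounded_loc_bdd loc_intD(1)[OF AC_loc_int] AC\<phi> AC\<psi>)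
  show "loc_bdd (\<lambda>x. of_real (\<phi> x))" by (rule AC_loc_bdd[OF AC\<phi>])
qed

lemma zero_outside: "x \<notin> {c..d} \<Longrightarrow> \<phi> x = 0 \<and> \<phi>' x = 0 \<and> \<psi> x = 0 \<and> \<psi>' x = 0"
  using supp by (auto simp: supported_def)

lemma L2_mult_u: "L2 (\<lambda>x. of_real (\<phi> x) * u x)" and L2_mult_f: "L2 (\<lambda>x. of_real (\<phi> x) * f x)"
proof -
  obtain B where "\<And>x. cmod (complex_of_real (\<phi> x)) \<le> B"
    using compactly_supported_bounded[OF multiplier_loc_bdd(1), of c d] zero_outside by (metis of_real_0)
  then show "L2 (\<lambda>x. of_real (\<phi> x) * u x)" "L2 (\<lambda>x. of_real (\<phi> x) * f x)"
    using L2 multiplier_loc_bdd(1) by (auto intro!: L2_mult_bounded simp: loc_bdd_def)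
qed

text \<open>The delicate term is \<open>Q \<phi>' u\<close>: \<open>Q\<close> need not be locally
  bounded, so the L2 clause of \<open>multiplier\<close> is combined with the boundedness of
  \<open>u\<close> on the support.\<close>

lemma L2_mult_image: "L2 (mult_image \<phi> \<phi>' \<psi>' u u1 f)"
proof -
  have 1: "L2 (\<lambda>x. of_real (\<phi>' x) * u1 x)"
    by (rule L2_compact_support[OF loc_bdd_mult[OF multiplier_loc_bdd(2) qd_loc_bdd(2)[OF u]]]) (use zero_outside in auto)
  have 2: "L2 (\<lambda>x. of_real (\<psi>' x) * u x)"
    by (rule L2_compact_support[OF loc_bdd_mult[OF multiplier_loc_bdd(3) qd_loc_bdd(1)[OF u]]]) (use zero_outside in auto)
  obtain B where B: "B \<ge> 0" "\<And>x. x \<in> {c..d} \<Longrightarrow> cmod (u x) \<le> B"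
    using qd_loc_bdd(1)[OF u] unfolding loc_bdd_def by meson
  have [measurable]: "u \<in> borel_measurable lebesgue" by (rule L2_measurable[OF L2(1)])
  have "L2 (\<lambda>x. (indicat_real {c..d} x *\<^sub>R u x) * of_real (Q x * \<phi>' x))"
  proof (rule L2_mult_bounded[OF L2Q])
    show "(\<lambda>x. indicat_real {c..d} x *\<^sub>R u x) \<in> borel_measurable lebesgue" by measurable
    show "cmod (indicat_real {c..d} x *\<^sub>R u x) \<le> B" for x using B by (auto simp: indicator_def)
  qed
  moreover have "(indicat_real {c..d} x *\<^sub>R u x) * of_real (Q x * \<phi>' x) = of_real (Q x * \<phi>' x) * u x" for x
    using zero_outside[of x] by (auto simp: indicator_def)
  ultimately have 3: "L2 (\<lambda>x. of_real (Q x * \<phi>' x) * u x)" by simp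
  have "L2 (\<lambda>x. of_real (\<phi> x) * f x - 2 * (of_real (\<phi>' x) * u1 x) - of_real (\<psi>' x) * u x - 2 * (of_real (Q x * \<phi>' x) * u x))"
    by (intro L2_diff L2_cmult L2_mult_f 1 2 3)
  then show ?thesis by (simp add: mult_image_def[abs_def] mult.assoc)
qed

text \<open>Since \<open>cB \<psi> = \<phi>'\<close>, the extra term \<open>\<phi>' u\<close> of the
  product rule is absorbed by adding \<open>\<psi> u\<close> to the quasi-derivative.\<close>

lemma qd_mult: "qd (\<lambda>x. of_real (\<phi> x) * u x) (\<lambda>x. of_real (\<phi> x) * u1 x + of_real (\<psi> x) * u x) (\<lambda>x. - mult_image \<phi> \<phi>' \<psi>' u u1 f x)"
  unfolding qd_iff
proof
  show "AC_loc_with (\<lambda>x. of_real (\<phi> x) * u x)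
     (\<lambda>x. cA x * (of_real (\<phi> x) * u x) + cB x * (of_real (\<phi> x) * u1 x + of_real (\<psi> x) * u x))"
  proof (rule AC_cong_AE[OF AC_mult[OF AC\<phi> qd_AC(1)[OF u]]])
    show "AE x in lebesgue. of_real (\<phi>' x) * u x + of_real (\<phi> x) * (cA x * u x + cB x * u1 x) =
      cA x * (of_real (\<phi> x) * u x) + cB x * (of_real (\<phi> x) * u1 x + of_real (\<psi> x) * u x)"
      using ae\<psi> p_nonzero
    proof eventually_elim
      case (elim x)
      then have "cB x * of_real (\<psi> x) = of_real (\<phi>' x)" by (simp add: cB_def)
      then have "cB x * (of_real (\<psi> x) * u x) = of_real (\<phi>' x) * u x" by (metis mult.assoc)
      then show ?case by (auto simp: algebra_simps)
    qed
  qed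
  show "AC_loc_with (\<lambda>x. of_real (\<phi> x) * u1 x + of_real (\<psi> x) * u x)
    (\<lambda>x. cC x * (of_real (\<phi> x) * u x) + cD x * (of_real (\<phi> x) * u1 x + of_real (\<psi> x) * u x) + - mult_image \<phi> \<phi>' \<psi>' u u1 f x)"
  proof (rule AC_cong_AE[OF AC_add[OF AC_mult[OF AC\<phi> qd_AC(2)[OF u]] AC_mult[OF AC\<psi> qd_AC(1)[OF u]]]])
    show "AE x in lebesgue. of_real (\<phi>' x) * u1 x + of_real (\<phi> x) * (cC x * u x + cD x * u1 x + - f x) +
        (of_real (\<psi>' x) * u x + of_real (\<psi> x) * (cA x * u x + cB x * u1 x)) =
        cC x * (of_real (\<phi> x) * u x) + cD x * (of_real (\<phi> x) * u1 x + of_real (\<psi> x) * u x) + - mult_image \<phi> \<phi>' \<psi>' u u1 f x"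
      using ae\<psi> p_nonzero
    proof eventually_elim
      case (elim x)
      \<comment> \<open>The numerators \<open>Q + i r\<close> of \<open>cA\<close> and
        \<open>Q - i r\<close> of \<open>- cD\<close> add up to \<open>2 Q\<close>, so no
        \<open>r\<close> remains.\<close>
      then have B: "of_real (\<psi> x) * (cB x * u1 x) = of_real (\<phi>' x) * u1 x"
        and A: "of_real (\<psi> x) * (cA x * u x) - cD x * (of_real (\<psi> x) * u x) = 2 * of_real (Q x * \<phi>' x) * u x"
        by (simp_all add: cB_def cA_def cD_def field_simps)
      show ?case
        unfolding mult_image_def using A B by (simp add: algebra_simps)
    qed
  qed
qed

lemma mult_in_L00: "((\<lambda>x. of_real (\<phi> x) * u x), (mult_image \<phi> \<phi>' \<psi>' u u1 f)) \<in> L00 p Q r s"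
  unfolding L00_iff using L2_mult_u L2_mult_image qd_mult zero_outside
  by (intro conjI exI[of _ "\<lambda>x. of_real (\<phi> x) * u x"] exI[of _ "\<lambda>x. of_real (\<phi> x) * u1 x + of_real (\<psi> x) * u x"]
     exI[of _ c] exI[of _ d]) auto

text \<open>The inequality form of the energy identity. Here \<open>\<phi>' \<psi>\<close> stands
  for \<open>p \<phi>'\<^sup>2\<close>, and \<open>\<kappa>\<close> is the shift that later makes
  the form nonnegative. The set \<open>T\<close> will be the whole line for a cut-off and the
  complement of \<open>{-R..R}\<close> for a difference of two.\<close>

lemma energy_bound:
  fixes K \<kappa> :: real
  assumes bd: "\<And>x. \<bar>\<phi> x\<bar> \<le> 1" "\<And>x. \<phi>' x * \<psi> x \<le> K" "0 \<le> \<kappa>" "0 \<le> K"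
    and T: "T \<in> sets lebesgue" "\<And>x. x \<notin> T \<Longrightarrow> \<phi> x = 0 \<and> \<phi>' x = 0"
  shows "Re (L2_inner (mult_image \<phi> \<phi>' \<psi>' u u1 f) (\<lambda>x. of_real (\<phi> x) * u x)) + \<kappa> * L2_norm_sq (\<lambda>x. of_real (\<phi> x) * u x)
    \<le> (\<integral>x. indicat_real T x * (cmod (f x * cnj (u x)) + (K + \<kappa>) * (cmod (u x))\<^sup>2) \<partial>lebesgue)"
proof -
  let ?w = "\<lambda>x. of_real (\<phi> x) * u x"
  \<comment> \<open>The derivative of \<open>\<phi> \<psi> |u|\<^sup>2\<close>. Its integral is zero
    by compact support, and its real part cancels the terms of \<open>mult_image\<close> whose sign
    is not controlled.\<close>
  define D where "D = (\<lambda>x. (of_real (\<phi>' x) * of_real (\<psi> x) + of_real (\<phi> x) * of_real (\<psi>' x)) * (u x * cnj (u x)) +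
      of_real (\<phi> x) * of_real (\<psi> x) * ((cA x * u x + cB x * u1 x) * cnj (u x) + u x * cnj (cA x * u x + cB x * u1 x)))"
  have "AC_loc_with (\<lambda>x. of_real (\<phi> x) * of_real (\<psi> x) * (u x * cnj (u x))) D"
    unfolding D_def by (intro AC_mult AC\<phi> AC\<psi> AC_cnj qd_AC(1)[OF u])
  then have D: "integrable lebesgue D" "integral\<^sup>L lebesgue D = 0"
    by (rule AC_integral_zero[where c=c and d=d]; use zero_outside in auto)+
  have iw: "integrable lebesgue (\<lambda>x. mult_image \<phi> \<phi>' \<psi>' u u1 f x * cnj (?w x))" "integrable lebesgue (\<lambda>x. (cmod (?w x))\<^sup>2)"
    using L2_inner_integrable[OF L2_mult_image L2_mult_u] L2_integrable[OF L2_mult_u] by auto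
  let ?L = "\<lambda>x. Re (mult_image \<phi> \<phi>' \<psi>' u u1 f x * cnj (?w x)) + \<kappa> * (cmod (?w x))\<^sup>2 + Re (D x)"
  have "Re (L2_inner (mult_image \<phi> \<phi>' \<psi>' u u1 f) ?w) + \<kappa> * L2_norm_sq ?w = (\<integral>x. ?L x \<partial>lebesgue)"
    unfolding L2_inner_def L2_norm_sq_def by (rule Re_integral_add_null[OF iw D])
  also have "\<dots> \<le> (\<integral>x. indicat_real T x * (cmod (f x * cnj (u x)) + (K + \<kappa>) * (cmod (u x))\<^sup>2) \<partial>lebesgue)"
  proof (rule integral_mono_AE)
    show "integrable lebesgue ?L" by (rule integrable_Re_add[OF iw D(1)])
    have "integrable lebesgue (\<lambda>x. cmod (f x * cnj (u x)) + (K + \<kappa>) * (cmod (u x))\<^sup>2)"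
      using L2_inner_integrable[OF L2(2) L2(1)] L2_integrable[OF L2(1)]
      by (intro Bochner_Integration.integrable_add integrable_norm integrable_mult_right) auto
    from integrable_mult_indicator[OF T(1) this]
    show "integrable lebesgue (\<lambda>x. indicat_real T x * (cmod (f x * cnj (u x)) + (K + \<kappa>) * (cmod (u x))\<^sup>2))"
      by (simp only: real_scaleR_def)
    show "AE x in lebesgue. ?L x \<le> indicat_real T x * (cmod (f x * cnj (u x)) + (K + \<kappa>) * (cmod (u x))\<^sup>2)"
      using ae\<psi> p_nonzero
    proof eventually_elim
      case (elim x)
      show ?case
      proof (cases "x \<in> T")
        case False
        then show ?thesis using T(2)[of x] by (simp add: mult_image_def D_def)
      next
        case True
        define a where "a = Re (u x * cnj (u x))"
        define b where "b = Re (u1 x * cnj (u x))"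
        have uu: "u x * cnj (u x) = of_real a" "a = (cmod (u x))\<^sup>2"
          unfolding a_def using complex_norm_square[of "u x"] by (metis Re_complex_of_real)+
        have e1: "Re (mult_image \<phi> \<phi>' \<psi>' u u1 f x * cnj (?w x)) = (\<phi> x)\<^sup>2 * Re (f x * cnj (u x)) - 2 * \<phi> x * \<phi>' x * b - \<phi> x * \<psi>' x * a - 2 * Q x * \<phi> x * \<phi>' x * a"
        proof -
          have "mult_image \<phi> \<phi>' \<psi>' u u1 f x * cnj (?w x) = of_real ((\<phi> x)\<^sup>2) * (f x * cnj (u x)) - of_real (2 * \<phi> x * \<phi>' x) * (u1 x * cnj (u x))
             - of_real (\<phi> x * \<psi>' x) * (u x * cnj (u x)) - of_real (2 * Q x * \<phi> x * \<phi>' x) * (u x * cnj (u x))"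
            by (simp add: mult_image_def algebra_simps power2_eq_square)
          then show ?thesis by (simp only: minus_complex.sel Re_complex_of_real times_complex.sel Im_complex_of_real a_def b_def; simp)
        qed
        \<comment> \<open>The coefficient \<open>r\<close> multiplies \<open>i |u|\<^sup>2\<close>
          and disappears on taking real parts.\<close>
        have \<psi>A: "\<psi> x * Re ((cA x * u x + cB x * u1 x) * cnj (u x)) = \<phi>' x * (Q x * a + b)"
        proof -
          have "of_real (\<psi> x) * ((cA x * u x + cB x * u1 x) * cnj (u x)) =
             of_real (\<phi>' x) * ((of_real (Q x) + \<i> * of_real (r x)) * (u x * cnj (u x)) + u1 x * cnj (u x))"
            using elim by (simp add: cA_def cB_def field_simps)
          then have "of_real (\<psi> x) * ((cA x * u x + cB x * u1 x) * cnj (u x)) =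
             of_real (\<phi>' x) * ((of_real (Q x) + \<i> * of_real (r x)) * of_real a + u1 x * cnj (u x))"
            by (simp only: uu(1))
          from arg_cong[OF this, of Re] show ?thesis
            by (simp add: b_def)
        qed
        have "Re (D x) = (\<phi>' x * \<psi> x + \<phi> x * \<psi>' x) * a + 2 * \<phi> x * (\<psi> x * Re ((cA x * u x + cB x * u1 x) * cnj (u x)))"
        proof -
          have c: "z * cnj (u x) + u x * cnj z = of_real (2 * Re (z * cnj (u x)))" for z
            using complex_add_cnj[of "z * cnj (u x)"] by (simp add: mult.commute)
          have "D x = of_real ((\<phi>' x * \<psi> x + \<phi> x * \<psi>' x) * a + \<phi> x * \<psi> x * (2 * Re ((cA x * u x + cB x * u1 x) * cnj (u x))))"
            unfolding D_def c uu(1) by simp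
          then show ?thesis by (simp only: Re_complex_of_real; simp)
        qed
        then have e2: "Re (D x) = (\<phi>' x * \<psi> x + \<phi> x * \<psi>' x) * a + 2 * \<phi> x * (\<phi>' x * (Q x * a + b))"
          by (simp only: \<psi>A)
        have "?L x = (\<phi> x)\<^sup>2 * Re (f x * cnj (u x)) + \<phi>' x * \<psi> x * a + \<kappa> * ((\<phi> x)\<^sup>2 * a)"
          unfolding e1 e2 by (simp add: norm_mult power_mult_distrib uu(2)[symmetric] algebra_simps)
        moreover have \<phi>1: "(\<phi> x)\<^sup>2 \<le> 1" using bd(1)[of x] by (simp add: abs_square_le_1)
        have "(\<phi> x)\<^sup>2 * Re (f x * cnj (u x)) \<le> 1 * cmod (f x * cnj (u x))"
        proof (rule order_trans)
          show "(\<phi> x)\<^sup>2 * Re (f x * cnj (u x)) \<le> (\<phi> x)\<^sup>2 * cmod (f x * cnj (u x))"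
            by (intro mult_left_mono complex_Re_le_cmod) simp
          show "(\<phi> x)\<^sup>2 * cmod (f x * cnj (u x)) \<le> 1 * cmod (f x * cnj (u x))"
            by (intro mult_right_mono \<phi>1) simp
        qed
        moreover have "\<phi>' x * \<psi> x * a \<le> K * a" "\<kappa> * ((\<phi> x)\<^sup>2 * a) \<le> \<kappa> * (1 * a)"
          unfolding uu(2) using bd by (intro mult_right_mono mult_left_mono \<phi>1; simp)+
        ultimately have "?L x \<le> cmod (f x * cnj (u x)) + (K + \<kappa>) * a"
          by (simp add: distrib_right)
        with True show ?thesis by (simp add: uu(2))
      qed
    qed
  qed
  finally show ?thesis .
qed

end

section \<open>The shifted form of the preminimal operator\<close>

lemma pair_subspace_L00: "pair_subspace (L00 p Q r s)"
  unfolding pair_subspace_def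
proof (intro conjI ballI allI; clarify?)
  have "qd (\<lambda>x. 0) (\<lambda>x. 0) (\<lambda>x. - 0)" unfolding qd_iff using AC_const[of 0] by simp
  then have "((\<lambda>x. 0), (\<lambda>x. 0)) \<in> L00 p Q r s"
    unfolding L00_iff using L2_zero by (intro conjI exI[of _ "\<lambda>x. 0"]) auto
  then show "L00 p Q r s = {} \<Longrightarrow> False" by blast
next
  fix u f assume "(u, f) \<in> L00 p Q r s"
  then show "L2 u \<and> L2 f" by (auto simp: L00_iff)
next
  fix u f v g z assume uf: "(u, f) \<in> L00 p Q r s" and vg: "(v, g) \<in> L00 p Q r s"
  obtain y y1 a b where y: "\<forall>x. x \<notin> {a..b} \<longrightarrow> y x = 0" "AE x in lebesgue. y x = u x" "qd y y1 (\<lambda>x. - f x)"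
    using uf by (auto simp: L00_iff)
  obtain w w1 c d where w: "\<forall>x. x \<notin> {c..d} \<longrightarrow> w x = 0" "AE x in lebesgue. w x = v x" "qd w w1 (\<lambda>x. - g x)"
    using vg by (auto simp: L00_iff)
  have "qd (\<lambda>x. y x + z * w x) (\<lambda>x. y1 x + z * w1 x) (\<lambda>x. - (f x + z * g x))"
    using qd_add_cmult[OF y(3) w(3), of z] by (simp add: algebra_simps)
  moreover have "AE x in lebesgue. y x + z * w x = u x + z * v x"
    using y(2) w(2) by eventually_elim simp
  moreover have "\<forall>x. x \<notin> {min a c..max b d} \<longrightarrow> y x + z * w x = 0"
  proof (intro allI impI)
    fix x assume "x \<notin> {min a c..max b d}"
    then have "x \<notin> {a..b}" "x \<notin> {c..d}" by auto
    with y(1) w(1) show "y x + z * w x = 0" by simp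
  qed
  moreover have "L2 (\<lambda>x. u x + z * v x)" "L2 (\<lambda>x. f x + z * g x)"
    using uf vg by (auto simp: L00_iff intro!: L2_add L2_cmult)
  ultimately show "((\<lambda>x. u x + z * v x), (\<lambda>x. f x + z * g x)) \<in> L00 p Q r s"
    unfolding L00_iff by (intro conjI exI[of _ "\<lambda>x. y x + z * w x"] exI[of _ "\<lambda>x. y1 x + z * w1 x"]
       exI[of _ "min a c"] exI[of _ "max b d"])
qed

lemma L00_symmetric:
  assumes "(u, f) \<in> L00 p Q r s" "(v, g) \<in> Lmax p Q r s"
  shows "L2_inner f v = L2_inner u g"
  using assms Lmax_subset_adjoint by (auto simp: adjoint_op_def)

text \<open>The sesquilinear form of \<open>L + \<kappa>\<close>. The image \<open>k\<close> of
  \<open>w\<close> is carried as an argument because operators are graphs.\<close>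

definition form :: "real \<Rightarrow> (real \<Rightarrow> complex) \<Rightarrow> (real \<Rightarrow> complex) \<Rightarrow> (real \<Rightarrow> complex) \<Rightarrow> complex" where
  "form \<kappa> w k v = L2_inner k v + of_real \<kappa> * L2_inner w v"

text \<open>Positivity is applied to \<open>v + z w\<close>; symmetry of the preminimal operator
  makes the two cross terms complex conjugates, as the quadratic-form lemma demands.\<close>

lemma form_Cauchy_Schwarz:
  assumes pos: "\<And>w k. (w, k) \<in> L00 p Q r s \<Longrightarrow> 0 \<le> Re (form \<kappa> w k w)"
    and w: "(w, k) \<in> L00 p Q r s" and v: "(v, g) \<in> L00 p Q r s"
  shows "(cmod (form \<kappa> w k v))\<^sup>2 \<le> Re (form \<kappa> w k w) * Re (form \<kappa> v g v)"
proof -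
  have L2: "L2 w" "L2 k" "L2 v" "L2 g" using w v by (auto simp: L00_iff)
  have "(cmod (form \<kappa> w k v))\<^sup>2 \<le> Re (form \<kappa> v g v) * Re (form \<kappa> w k w)"
  proof (rule quadratic_form_Cauchy_Schwarz[OF _ pos[OF w]])
    fix z
    have "((\<lambda>x. v x + z * w x), (\<lambda>x. g x + z * k x)) \<in> L00 p Q r s"
      using pair_subspace_L00 v w unfolding pair_subspace_def by fast
    from pos[OF this] have "0 \<le> Re (form \<kappa> (\<lambda>x. v x + z * w x) (\<lambda>x. g x + z * k x) (\<lambda>x. v x + z * w x))" .
    also have "form \<kappa> (\<lambda>x. v x + z * w x) (\<lambda>x. g x + z * k x) (\<lambda>x. v x + z * w x) =
       form \<kappa> v g v + (z * form \<kappa> w k v + cnj (z * form \<kappa> w k v)) + (z * cnj z) * form \<kappa> w k w"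
    proof -
      have "L2_inner g w = L2_inner v k" by (rule L00_symmetric[OF v]) (use w L00_subset_Lmax in blast)
      also have "\<dots> = cnj (L2_inner k v)" by (rule L2_inner_commute)
      finally have 1: "L2_inner g w = cnj (L2_inner k v)" .
      have 2: "L2_inner v w = cnj (L2_inner w v)" by (rule L2_inner_commute)
      note zw = L2_cmult[OF L2(1), of z] and zk = L2_cmult[OF L2(2), of z]
      show ?thesis
        unfolding form_def
        by (simp add: L2_inner_add_left L2_inner_add_right L2_inner_cmult_left L2_inner_cmult_right L2 zw zk L2_add 1 2 algebra_simps)
    qed
    also have "Re \<dots> = Re (form \<kappa> v g v) + 2 * Re (z * form \<kappa> w k v) + (cmod z)\<^sup>2 * Re (form \<kappa> w k w)"
    proof -
      have "z * cnj z = of_real ((cmod z)\<^sup>2)" by (rule complex_norm_square[symmetric])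
      then show ?thesis by simp
    qed
    finally show "0 \<le> Re (form \<kappa> v g v) + 2 * Re (z * form \<kappa> w k v) + (cmod z)\<^sup>2 * Re (form \<kappa> w k w)" .
  qed
  then show ?thesis by (simp add: mult.commute)
qed

end

section \<open>Symmetry of the maximal operator\<close>

context quasi_operator
begin

text \<open>The point is that one \<open>K\<close> serves every \<open>R\<close>.\<close>

definition has_cutoffs :: "real \<Rightarrow> bool" where
  "has_cutoffs K \<longleftrightarrow> (\<forall>R>0. \<exists>S \<phi> \<phi>' \<psi> \<psi>'. multiplier \<phi> \<phi>' \<psi> \<psi>' \<and> supported \<phi> \<phi>' \<psi> \<psi>' {-S..S} \<and>
     (\<forall>x. 0 \<le> \<phi> x \<and> \<phi> x \<le> 1) \<and> (\<forall>x. \<phi>' x * \<psi> x \<le> K) \<and>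
     (\<forall>x\<in>{-R..R}. \<phi> x = 1 \<and> \<phi>' x = 0 \<and> \<psi> x = 0 \<and> \<psi>' x = 0))"

definition energy_density :: "real \<Rightarrow> (real \<Rightarrow> complex) \<Rightarrow> (real \<Rightarrow> complex) \<Rightarrow> real \<Rightarrow> real" where
  "energy_density M u f x = cmod (f x * cnj (u x)) + M * (cmod (u x))\<^sup>2"

lemma energy_density_integrable: "L2 u \<Longrightarrow> L2 f \<Longrightarrow> integrable lebesgue (energy_density M u f)"
  unfolding energy_density_def[abs_def]
  by (intro Bochner_Integration.integrable_add integrable_norm integrable_mult_right L2_inner_integrable L2_integrable)

text \<open>
  Since a second cut-off \<open>\<eta>\<close> equals 1 on the support of \<open>\<phi>\<close>, in the pairing of \<open>L (\<phi> v)\<close> with \<open>u\<close> one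
  may replace \<open>u\<close> by \<open>\<eta> u = \<phi> u + \<delta> u\<close>; the terms with \<open>\<phi> u\<close> cancel by symmetry of the preminimal operator.
\<close>

lemma boundary_term_bound:
  fixes K \<kappa> R :: real
  assumes pos: "\<And>w k. (w, k) \<in> L00 p Q r s \<Longrightarrow> 0 \<le> Re (form \<kappa> w k w)"
    and \<kappa>: "0 \<le> \<kappa>" and K: "0 \<le> K" and cut: "has_cutoffs K" and R: "0 < R"
    and u: "qd u u1 (\<lambda>x. - f x)" "L2 u" "L2 f" and v: "qd v v1 (\<lambda>x. - g x)" "L2 v" "L2 g"
  obtains \<phi> :: "real \<Rightarrow> real" where "continuous_on UNIV \<phi>" "\<And>x. 0 \<le> \<phi> x \<and> \<phi> x \<le> 1" "\<And>x. x \<in> {-R..R} \<Longrightarrow> \<phi> x = 1"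
    "cmod (L2_inner (\<lambda>x. of_real (\<phi> x) * v x) f - L2_inner g (\<lambda>x. of_real (\<phi> x) * u x)) \<le>
      sqrt ((\<integral>x. energy_density (K + \<kappa>) v g x \<partial>lebesgue) * (\<integral>x. indicat_real (- {-R..R}) x * energy_density (K + \<kappa>) u f x \<partial>lebesgue)) +
      sqrt ((\<integral>x. indicat_real (- {-R..R}) x * energy_density (K + \<kappa>) v g x \<partial>lebesgue) * (\<integral>x. energy_density (K + \<kappa>) u f x \<partial>lebesgue))"
proof -
  obtain S \<phi> \<phi>' \<psi> \<psi>' where \<phi>: "multiplier \<phi> \<phi>' \<psi> \<psi>'" "supported \<phi> \<phi>' \<psi> \<psi>' {-S..S}"
     "\<And>x. 0 \<le> \<phi> x \<and> \<phi> x \<le> 1" "\<And>x. \<phi>' x * \<psi> x \<le> K"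
     "\<And>x. x\<in>{-R..R} \<Longrightarrow> \<phi> x = 1 \<and> \<phi>' x = 0 \<and> \<psi> x = 0 \<and> \<psi>' x = 0"
    using cut R unfolding has_cutoffs_def by meson
  have RS: "R \<le> S"
  proof (rule ccontr)
    assume "\<not> R \<le> S"
    then have "\<phi> R = 0" using \<phi>(2) by (auto simp: supported_def)
    with \<phi>(5)[of R] R show False by simp
  qed
  then have S: "0 < S" using R by simp
  \<comment> \<open>The second plateau covers \<open>{-S..S}\<close>, which contains the support of
    the first cut-off.\<close>
  obtain S' \<eta> \<eta>' \<omega> \<omega>' where \<eta>: "multiplier \<eta> \<eta>' \<omega> \<omega>'" "supported \<eta> \<eta>' \<omega> \<omega>' {-S'..S'}"
     "\<And>x. 0 \<le> \<eta> x \<and> \<eta> x \<le> 1" "\<And>x. \<eta>' x * \<omega> x \<le> K"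
     "\<And>x. x\<in>{-S..S} \<Longrightarrow> \<eta> x = 1 \<and> \<eta>' x = 0 \<and> \<omega> x = 0 \<and> \<omega>' x = 0"
    using cut S unfolding has_cutoffs_def by meson
  have SS': "S \<le> S'"
  proof (rule ccontr)
    assume "\<not> S \<le> S'"
    then have "\<eta> S = 0" using \<eta>(2) by (auto simp: supported_def)
    with \<eta>(5)[of S] S show False by simp
  qed
  have out: "\<phi> x = 0" "\<phi>' x = 0" "\<psi> x = 0" "\<psi>' x = 0" if "x \<notin> {-S..S}" for x
    using \<phi>(2) that by (auto simp: supported_def)
  define \<delta> \<delta>' \<epsilon> \<epsilon>' where "\<delta> x = \<eta> x - \<phi> x" and "\<delta>' x = \<eta>' x - \<phi>' x"
    and "\<epsilon> x = \<omega> x - \<psi> x" and "\<epsilon>' x = \<omega>' x - \<psi>' x" for x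
  have \<delta>m: "multiplier \<delta> \<delta>' \<epsilon> \<epsilon>'"
    using multiplier_diff[OF \<eta>(1) \<phi>(1)] by (simp add: \<delta>_def[abs_def] \<delta>'_def[abs_def] \<epsilon>_def[abs_def] \<epsilon>'_def[abs_def])
  have \<delta>s: "supported \<delta> \<delta>' \<epsilon> \<epsilon>' {-S'..S'}"
    unfolding supported_def
  proof (intro allI impI)
    fix x assume x: "x \<notin> {-S'..S'}"
    then have "x \<notin> {-S..S}" using SS' by auto
    with x out[of x] \<eta>(2) show "\<delta> x = 0 \<and> \<delta>' x = 0 \<and> \<epsilon> x = 0 \<and> \<epsilon>' x = 0"
      by (auto simp: \<delta>_def \<delta>'_def \<epsilon>_def \<epsilon>'_def supported_def)
  qed
  have \<delta>1: "\<bar>\<delta> x\<bar> \<le> 1" for x using \<phi>(3)[of x] \<eta>(3)[of x] by (auto simp: \<delta>_def)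
  \<comment> \<open>The two transition regions do not overlap: inside \<open>{-S..S}\<close> both
    factors change sign and the product is that of \<open>\<phi>\<close>, outside it is that of
    \<open>\<eta>\<close>. So the constant does not grow.\<close>
  have \<delta>K: "\<delta>' x * \<epsilon> x \<le> K" for x
    using \<phi>(4)[of x] \<eta>(4)[of x] \<eta>(5)[of x] out[of x] by (cases "x \<in> {-S..S}") (auto simp: \<delta>'_def \<epsilon>_def)
  have \<delta>0: "\<delta> x = 0 \<and> \<delta>' x = 0" if "x \<notin> - {-R..R}" for x
    using \<phi>(5)[of x] \<eta>(5)[of x] that RS by (auto simp: \<delta>_def \<delta>'_def)
  have \<phi>1: "\<bar>\<phi> x\<bar> \<le> 1" for x using \<phi>(3)[of x] by auto
  let ?\<phi>u = "\<lambda>x. of_real (\<phi> x) * u x" and ?\<phi>v = "\<lambda>x. of_real (\<phi> x) * v x"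
    and ?\<delta>u = "\<lambda>x. of_real (\<delta> x) * u x" and ?\<delta>v = "\<lambda>x. of_real (\<delta> x) * v x"
  define ku kv lu lv where "ku = mult_image \<phi> \<phi>' \<psi>' u u1 f" and "kv = mult_image \<phi> \<phi>' \<psi>' v v1 g"
    and "lu = mult_image \<delta> \<delta>' \<epsilon>' u u1 f" and "lv = mult_image \<delta> \<delta>' \<epsilon>' v v1 g"
  have mem: "(?\<phi>u, ku) \<in> L00 p Q r s" "(?\<phi>v, kv) \<in> L00 p Q r s" "(?\<delta>u, lu) \<in> L00 p Q r s" "(?\<delta>v, lv) \<in> L00 p Q r s"
    unfolding ku_def kv_def lu_def lv_def
    by (rule mult_in_L00[OF \<phi>(1,2) u] mult_in_L00[OF \<phi>(1,2) v] mult_in_L00[OF \<delta>m \<delta>s u] mult_in_L00[OF \<delta>m \<delta>s v])+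
  note L2k = mem[unfolded L00_iff, THEN conjunct2, THEN conjunct1] and L2w = mem[unfolded L00_iff, THEN conjunct1]
  have uL: "(u, f) \<in> Lmax p Q r s" and vL: "(v, g) \<in> Lmax p Q r s"
    unfolding Lmax_iff using u v by auto
  have memL: "(?\<phi>u, ku) \<in> Lmax p Q r s" using mem(1) L00_subset_Lmax by blast
  have split: "L2_inner k z = L2_inner k (\<lambda>x. of_real (\<phi> x) * z x) + L2_inner k (\<lambda>x. of_real (\<delta> x) * z x)"
    if k0: "\<And>x. x \<notin> {-S..S} \<Longrightarrow> k x = 0" and "L2 k" "L2 (\<lambda>x. of_real (\<phi> x) * z x)" "L2 (\<lambda>x. of_real (\<delta> x) * z x)" for k z
  proof -
    have "k x * cnj (z x) = k x * cnj (of_real (\<phi> x) * z x + of_real (\<delta> x) * z x)" for x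
      using k0[of x] \<eta>(5)[of x] by (cases "x \<in> {-S..S}") (auto simp: \<delta>_def distrib_right[symmetric] simp flip: of_real_add)
    then have "L2_inner k z = L2_inner k (\<lambda>x. of_real (\<phi> x) * z x + of_real (\<delta> x) * z x)"
      unfolding L2_inner_def by (simp only:)
    with that show ?thesis by (simp add: L2_inner_add_right)
  qed
  have k0: "ku x = 0" "kv x = 0" if "x \<notin> {-S..S}" for x
    using out[OF that] by (simp_all add: ku_def kv_def mult_image_def)
  have 1: "L2_inner kv ?\<phi>u + L2_inner kv ?\<delta>u = L2_inner ?\<phi>v f"
    using split[OF k0(2) L2k(2) L2w(1) L2w(3)] L00_symmetric[OF mem(2) uL] by simp
  have 2: "L2_inner ku ?\<phi>v + L2_inner ku ?\<delta>v = L2_inner ?\<phi>u g"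
    using split[OF k0(1) L2k(1) L2w(2) L2w(4)] L00_symmetric[OF mem(1) vL] by simp
  have 3: "L2_inner kv ?\<phi>u = L2_inner ?\<phi>v ku" by (rule L00_symmetric[OF mem(2) memL])
  have 4: "L2_inner lv ?\<phi>u = L2_inner ?\<delta>v ku" by (rule L00_symmetric[OF mem(4) memL])
  have "L2_inner g ?\<phi>u = L2_inner ?\<phi>v ku + L2_inner ?\<delta>v ku"
    unfolding L2_inner_commute[of g ?\<phi>u] 2[symmetric] L2_inner_commute[of ?\<phi>v ku] L2_inner_commute[of ?\<delta>v ku]
    by (rule complex_cnj_add)
  then have "L2_inner ?\<phi>v f - L2_inner g ?\<phi>u = L2_inner kv ?\<delta>u - L2_inner lv ?\<phi>u"
    using 1 3 4 by (simp add: algebra_simps)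
  \<comment> \<open>Both sides integrate \<open>\<phi> \<delta> v cnj u\<close>, so shifting both
    pairings by \<open>\<kappa>\<close> leaves their difference unchanged.\<close>
  moreover have "L2_inner ?\<phi>v ?\<delta>u = L2_inner ?\<delta>v ?\<phi>u"
    unfolding L2_inner_def by (simp add: mult_ac)
  ultimately have eq: "L2_inner ?\<phi>v f - L2_inner g ?\<phi>u = form \<kappa> ?\<phi>v kv ?\<delta>u - form \<kappa> ?\<delta>v lv ?\<phi>u"
    by (simp add: form_def)
  define Bu Bv Eu Ev where "Bu = (\<integral>x. energy_density (K + \<kappa>) u f x \<partial>lebesgue)" and "Bv = (\<integral>x. energy_density (K + \<kappa>) v g x \<partial>lebesgue)"
    and "Eu = (\<integral>x. indicat_real (- {-R..R}) x * energy_density (K + \<kappa>) u f x \<partial>lebesgue)"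
    and "Ev = (\<integral>x. indicat_real (- {-R..R}) x * energy_density (K + \<kappa>) v g x \<partial>lebesgue)"
  have Re_form: "Re (form \<kappa> w k w) = Re (L2_inner k w) + \<kappa> * L2_norm_sq w" for w k
    by (simp add: form_def L2_inner_self)
  have E: "Re (form \<kappa> ?\<phi>u ku ?\<phi>u) \<le> Bu" "Re (form \<kappa> ?\<phi>v kv ?\<phi>v) \<le> Bv"
    using energy_bound[OF \<phi>(1,2) u \<phi>1 \<phi>(4) \<kappa> K, of UNIV] energy_bound[OF \<phi>(1,2) v \<phi>1 \<phi>(4) \<kappa> K, of UNIV]
    unfolding Re_form Bu_def Bv_def energy_density_def ku_def kv_def by simp_all
  have R_sets: "- {-R..R} \<in> sets lebesgue" by simp
  have E': "Re (form \<kappa> ?\<delta>u lu ?\<delta>u) \<le> Eu" "Re (form \<kappa> ?\<delta>v lv ?\<delta>v) \<le> Ev"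
    using energy_bound[OF \<delta>m \<delta>s u \<delta>1 \<delta>K \<kappa> K R_sets \<delta>0] energy_bound[OF \<delta>m \<delta>s v \<delta>1 \<delta>K \<kappa> K R_sets \<delta>0]
    unfolding Re_form Eu_def Ev_def energy_density_def lu_def lv_def by simp_all
  have CS: "cmod (form \<kappa> w k w') \<le> sqrt (X * Y)"
    if "(w, k) \<in> L00 p Q r s" "(w', k') \<in> L00 p Q r s" "Re (form \<kappa> w k w) \<le> X" "Re (form \<kappa> w' k' w') \<le> Y" for w k w' k' X Y
  proof (rule real_le_rsqrt, rule order_trans[OF form_Cauchy_Schwarz[OF pos that(1,2)]])
    show "Re (form \<kappa> w k w) * Re (form \<kappa> w' k' w') \<le> X * Y"
      using pos[OF that(1)] pos[OF that(2)] that(3,4) by (intro mult_mono) auto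
  qed assumption
  have "cmod (L2_inner ?\<phi>v f - L2_inner g ?\<phi>u) \<le> cmod (form \<kappa> ?\<phi>v kv ?\<delta>u) + cmod (form \<kappa> ?\<delta>v lv ?\<phi>u)"
    unfolding eq by (rule norm_triangle_ineq4)
  also have "\<dots> \<le> sqrt (Bv * Eu) + sqrt (Ev * Bu)"
    by (intro add_mono CS[OF mem(2) mem(3) E(2) E'(1)] CS[OF mem(4) mem(1) E'(2) E(1)])
  finally have bound: "cmod (L2_inner ?\<phi>v f - L2_inner g ?\<phi>u) \<le> sqrt (Bv * Eu) + sqrt (Ev * Bu)" .
  have "continuous_on UNIV (\<lambda>x. Re (of_real (\<phi> x)))"
    using \<phi>(1) by (intro continuous_on_Re AC_continuous[of _ "\<lambda>x. of_real (\<phi>' x)"]) (simp add: multiplier_def)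
  then have "continuous_on UNIV \<phi>" by simp
  from that[OF this \<phi>(3) _ bound[unfolded Bu_def Bv_def Eu_def Ev_def]] \<phi>(5) show ?thesis by blast
qed

lemma integral_tail_tendsto_0:
  fixes W :: "real \<Rightarrow> real"
  assumes "integrable lebesgue W"
  shows "(\<lambda>n. \<integral>x. indicat_real (- {- real (Suc n)..real (Suc n)}) x * W x \<partial>lebesgue) \<longlonglongrightarrow> 0"
proof -
  have [measurable]: "W \<in> borel_measurable lebesgue" using assms by simp
  have "(\<lambda>n. \<integral>x. indicat_real (- {- real (Suc n)..real (Suc n)}) x * W x \<partial>lebesgue) \<longlonglongrightarrow> (\<integral>x. 0 \<partial>(lebesgue :: real measure))"
  proof (rule integral_dominated_convergence[where w="\<lambda>x. \<bar>W x\<bar>"])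
    show "AE x in lebesgue. (\<lambda>n. indicat_real (- {- real (Suc n)..real (Suc n)}) x * W x) \<longlonglongrightarrow> 0"
    proof (rule AE_I2)
      fix x :: real
      obtain N where N: "\<bar>x\<bar> < real N" using reals_Archimedean2 by blast
      have "\<forall>\<^sub>F n in sequentially. indicat_real (- {- real (Suc n)..real (Suc n)}) x * W x = 0"
        using eventually_ge_at_top[of N]
      proof eventually_elim
        case (elim n)
        with N have "real N \<le> real n" "\<bar>x\<bar> < real N" by auto
        then have "x \<in> {- real (Suc n)..real (Suc n)}" by auto
        then show ?case by simp
      qed
      then show "(\<lambda>n. indicat_real (- {- real (Suc n)..real (Suc n)}) x * W x) \<longlonglongrightarrow> 0"
        by (rule tendsto_eventually)
    qed
    show "AE x in lebesgue. norm (indicat_real (- {- real (Suc n)..real (Suc n)}) x * W x) \<le> \<bar>W x\<bar>" for n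
      by (auto simp: indicator_def)
  qed (use assms in \<open>auto\<close>)
  then show ?thesis by simp
qed

lemma L2_inner_cutoff_tendsto:
  assumes "L2 v" "L2 f" and \<phi>: "\<And>n. continuous_on UNIV (\<phi> n)" "\<And>n x. 0 \<le> \<phi> n x \<and> \<phi> n x \<le> 1"
    "\<And>n x. x \<in> {- real (Suc n)..real (Suc n)} \<Longrightarrow> \<phi> n x = 1"
  shows "(\<lambda>n. L2_inner (\<lambda>x. of_real (\<phi> n x) * v x) f) \<longlonglongrightarrow> L2_inner v f"
proof -
  note [measurable] = assms(1,2)[THEN L2_measurable] borel_measurable_lebesgue_continuous[OF \<phi>(1)]
  show ?thesis unfolding L2_inner_def
  proof (rule integral_dominated_convergence[where w="\<lambda>x. cmod (v x * cnj (f x))"])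
    show "AE x in lebesgue. (\<lambda>n. of_real (\<phi> n x) * v x * cnj (f x)) \<longlonglongrightarrow> v x * cnj (f x)"
    proof (rule AE_I2)
      fix x :: real
      obtain N where N: "\<bar>x\<bar> < real N" using reals_Archimedean2 by blast
      have "\<forall>\<^sub>F n in sequentially. of_real (\<phi> n x) * v x * cnj (f x) = v x * cnj (f x)"
        using eventually_ge_at_top[of N]
      proof eventually_elim
        case (elim n)
        with N have "real N \<le> real n" "\<bar>x\<bar> < real N" by auto
        then have "x \<in> {- real (Suc n)..real (Suc n)}" by auto
        from \<phi>(3)[OF this] show ?case by simp
      qed
      then show "(\<lambda>n. of_real (\<phi> n x) * v x * cnj (f x)) \<longlonglongrightarrow> v x * cnj (f x)"
        by (rule tendsto_eventually)
    qed
    show "AE x in lebesgue. norm (of_real (\<phi> n x) * v x * cnj (f x)) \<le> cmod (v x * cnj (f x))" for n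
      using \<phi>(2)[of n] by (auto simp: norm_mult mult.assoc intro!: AE_I2 mult_left_le_one_le)
    show "integrable lebesgue (\<lambda>x. cmod (v x * cnj (f x)))"
      by (intro integrable_norm L2_inner_integrable assms)
  qed measurable
qed

text \<open>Each product in the boundary bound pairs a full energy integral, independent of
  \<open>n\<close>, with an integral over the complement of
  \<open>{- real (Suc n)..real (Suc n)}\<close>, which tends to zero by integrability of the energy
  density.\<close>

lemma Lmax_symmetric_rep:
  fixes K \<kappa> :: real
  assumes pos: "\<And>w k. (w, k) \<in> L00 p Q r s \<Longrightarrow> 0 \<le> Re (form \<kappa> w k w)"
    and \<kappa>: "0 \<le> \<kappa>" and K: "0 \<le> K" and cut: "has_cutoffs K"
    and u: "qd u u1 (\<lambda>x. - f x)" "L2 u" "L2 f" and v: "qd v v1 (\<lambda>x. - g x)" "L2 v" "L2 g"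
  shows "L2_inner v f = L2_inner g u"
proof -
  let ?Wu = "energy_density (K + \<kappa>) u f" and ?Wv = "energy_density (K + \<kappa>) v g"
  let ?b = "\<lambda>n. sqrt ((\<integral>x. ?Wv x \<partial>lebesgue) * (\<integral>x. indicat_real (- {- real (Suc n)..real (Suc n)}) x * ?Wu x \<partial>lebesgue)) +
      sqrt ((\<integral>x. indicat_real (- {- real (Suc n)..real (Suc n)}) x * ?Wv x \<partial>lebesgue) * (\<integral>x. ?Wu x \<partial>lebesgue))"
  define good :: "nat \<Rightarrow> (real \<Rightarrow> real) \<Rightarrow> bool" where
    "good n \<phi> \<longleftrightarrow> continuous_on UNIV \<phi> \<and> (\<forall>x. 0 \<le> \<phi> x \<and> \<phi> x \<le> 1) \<and> (\<forall>x\<in>{- real (Suc n)..real (Suc n)}. \<phi> x = 1) \<and>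
     cmod (L2_inner (\<lambda>x. of_real (\<phi> x) * v x) f - L2_inner g (\<lambda>x. of_real (\<phi> x) * u x)) \<le> ?b n" for n \<phi>
  have "\<forall>n. \<exists>\<phi>. good n \<phi>"
  proof
    fix n
    have R: "0 < real (Suc n)" by simp
    show "\<exists>\<phi>. good n \<phi>"
    proof (rule boundary_term_bound[OF pos \<kappa> K cut R u v])
      fix \<phi> assume "continuous_on UNIV \<phi>" "\<And>x. 0 \<le> \<phi> x \<and> \<phi> x \<le> 1"
      "\<And>x. x \<in> {- real (Suc n)..real (Suc n)} \<Longrightarrow> \<phi> x = 1"
      "cmod (L2_inner (\<lambda>x. of_real (\<phi> x) * v x) f - L2_inner g (\<lambda>x. of_real (\<phi> x) * u x)) \<le> ?b n"
      then have "good n \<phi>" unfolding good_def by blast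
      then show ?thesis by blast
    qed
  qed
  then obtain \<phi> where good: "\<And>n. good n (\<phi> n)" using choice[of good] by blast
  then have \<phi>: "\<And>n. continuous_on UNIV (\<phi> n)" "\<And>n x. 0 \<le> \<phi> n x \<and> \<phi> n x \<le> 1"
    "\<And>n x. x \<in> {- real (Suc n)..real (Suc n)} \<Longrightarrow> \<phi> n x = 1"
    unfolding good_def by blast+
  have bd: "cmod (L2_inner (\<lambda>x. of_real (\<phi> n x) * v x) f - L2_inner g (\<lambda>x. of_real (\<phi> n x) * u x)) \<le> ?b n" for n
    using good[of n] unfolding good_def by blast
  have "?b \<longlonglongrightarrow> sqrt ((\<integral>x. ?Wv x \<partial>lebesgue) * 0) + sqrt (0 * (\<integral>x. ?Wu x \<partial>lebesgue))"
    by (intro tendsto_intros integral_tail_tendsto_0 energy_density_integrable u v)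
  then have "?b \<longlonglongrightarrow> 0" by simp
  then have "(\<lambda>n. L2_inner (\<lambda>x. of_real (\<phi> n x) * v x) f - L2_inner g (\<lambda>x. of_real (\<phi> n x) * u x)) \<longlonglongrightarrow> 0"
    by (rule Lim_null_comparison[rotated]) (rule always_eventually, rule allI, rule bd)
  moreover have "(\<lambda>n. L2_inner (\<lambda>x. of_real (\<phi> n x) * v x) f - L2_inner g (\<lambda>x. of_real (\<phi> n x) * u x)) \<longlonglongrightarrow> L2_inner v f - L2_inner g u"
    unfolding L2_inner_commute[of g] by (intro tendsto_diff tendsto_cnj L2_inner_cutoff_tendsto u v \<phi>)
  ultimately have "L2_inner v f - L2_inner g u = 0" by (rule LIMSEQ_unique[symmetric])
  then show ?thesis by simp
qed

lemma Lmax_subset_adjoint_Lmax: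
  fixes K \<kappa> :: real
  assumes pos: "\<And>w k. (w, k) \<in> L00 p Q r s \<Longrightarrow> 0 \<le> Re (form \<kappa> w k w)"
    and \<kappa>: "0 \<le> \<kappa>" and K: "0 \<le> K" and cut: "has_cutoffs K"
  shows "Lmax p Q r s \<subseteq> adjoint_op (Lmax p Q r s)"
proof -
  have "L2_inner g u = L2_inner v f" if uf: "(u, f) \<in> Lmax p Q r s" and vg: "(v, g) \<in> Lmax p Q r s" for u f v g
  proof -
    obtain y y1 where y: "AE x in lebesgue. y x = u x" "qd y y1 (\<lambda>x. - f x)" and L2u: "L2 u" "L2 f" using uf by (auto simp: Lmax_iff)
    obtain z z1 where z: "AE x in lebesgue. z x = v x" "qd z z1 (\<lambda>x. - g x)" and L2v: "L2 v" "L2 g" using vg by (auto simp: Lmax_iff)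
    have L2yz: "L2 y" "L2 z"
      using L2_cong_AE[OF L2u(1), of y] L2_cong_AE[OF L2v(1), of z] y(1) z(1) by (simp_all only: eq_commute)
    have "L2_inner z f = L2_inner g y"
      by (rule Lmax_symmetric_rep[OF pos \<kappa> K cut y(2) L2yz(1) L2u(2) z(2) L2yz(2) L2v(2)])
    then show ?thesis
      using L2_inner_cong_AE[OF L2yz(2) L2u(2) z(1) AE_I2[OF refl]] L2_inner_cong_AE[OF L2v(2) L2yz(1) AE_I2[OF refl] y(1)] by simp
  qed
  then show ?thesis unfolding adjoint_op_def by (auto simp: Lmax_iff)
qed

end

section \<open>Construction of the cut-offs\<close>

lemma indicator_continuous_bounded:
  fixes h :: "real \<Rightarrow> real"
  assumes "continuous_on {a..b} h"
  obtains B where "loc_bdd (\<lambda>x. of_real (indicat_real {a..b} x * h x))" "\<And>x. \<bar>indicat_real {a..b} x * h x\<bar> \<le> B"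
proof -
  have "(\<lambda>x. indicat_real {a..b} x *\<^sub>R h x) \<in> borel_measurable borel"
    by (rule borel_measurable_continuous_on_indicator[OF _ assms]) simp
  then have "(\<lambda>x. indicat_real {a..b} x * h x) \<in> borel_measurable lborel" by simp
  from measurable_completion[OF this]
  have [measurable]: "(\<lambda>x. indicat_real {a..b} x * h x) \<in> borel_measurable lebesgue" .
  have "bounded (h ` {a..b})"
    by (intro compact_imp_bounded compact_continuous_image assms) simp
  then obtain B where B: "0 < B" "\<And>x. x \<in> {a..b} \<Longrightarrow> \<bar>h x\<bar> \<le> B"
    unfolding bounded_pos by auto
  have bd: "\<bar>indicat_real {a..b} x * h x\<bar> \<le> B" for x using B by (auto simp: indicator_def)
  have "loc_bdd (\<lambda>x. of_real (indicat_real {a..b} x * h x))"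
    unfolding loc_bdd_def
  proof (intro conjI allI exI[of _ B] ballI)
    show "(\<lambda>x. complex_of_real (indicat_real {a..b} x * h x)) \<in> borel_measurable lebesgue" by measurable
    show "cmod (of_real (indicat_real {a..b} x * h x)) \<le> B" for x using bd[of x] by (simp only: norm_of_real)
  qed (use B in simp)
  with bd that show ?thesis by blast
qed

lemma bump_integral:
  fixes \<alpha> \<beta> :: real
  assumes "\<alpha> < \<beta>"
  shows "set_integrable lebesgue {\<alpha>..\<beta>} (\<lambda>x. (x - \<alpha>) * (\<beta> - x))"
    and "(LINT x:{\<alpha>..\<beta>}|lebesgue. (x - \<alpha>) * (\<beta> - x)) = (\<beta> - \<alpha>)^3 / 6"
proof -
  show i: "set_integrable lebesgue {\<alpha>..\<beta>} (\<lambda>x. (x - \<alpha>) * (\<beta> - x))"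
    by (intro absolutely_integrable_continuous_real continuous_intros)
  \<comment> \<open>A primitive, from \<open>(x - \<alpha>) (\<beta> - x) = (\<beta> - \<alpha>) (x
    - \<alpha>) - (x - \<alpha>)\<^sup>2\<close>.\<close>
  define \<Theta> where "\<Theta> x = (\<beta> - \<alpha>) * (x - \<alpha>)^2 / 2 - (x - \<alpha>)^3 / 3" for x
  have "((\<lambda>x. (x - \<alpha>) * (\<beta> - x)) has_integral (\<Theta> \<beta> - \<Theta> \<alpha>)) {\<alpha>..\<beta>}"
  proof (rule fundamental_theorem_of_calculus)
    fix x assume "x \<in> {\<alpha>..\<beta>}"
    have "(\<Theta> has_real_derivative (x - \<alpha>) * (\<beta> - x)) (at x within {\<alpha>..\<beta>})"
      unfolding \<Theta>_def by (auto intro!: derivative_eq_intros simp: power2_eq_square field_simps)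
    then show "(\<Theta> has_vector_derivative (x - \<alpha>) * (\<beta> - x)) (at x within {\<alpha>..\<beta>})"
      by (simp add: has_real_derivative_iff_has_vector_derivative)
  qed (use assms in simp)
  then have "integral {\<alpha>..\<beta>} (\<lambda>x. (x - \<alpha>) * (\<beta> - x)) = \<Theta> \<beta> - \<Theta> \<alpha>" by (rule integral_unique)
  also have "\<dots> = (\<beta> - \<alpha>)^3 / 6" by (simp add: \<Theta>_def power2_eq_square power3_eq_cube)
  finally show "(LINT x:{\<alpha>..\<beta>}|lebesgue. (x - \<alpha>) * (\<beta> - x)) = (\<beta> - \<alpha>)^3 / 6"
    by (simp only: set_lebesgue_integral_eq_integral(2)[OF i])
qed

context quasi_operator
begin

text \<open>
  Here \<open>\<psi>\<close> is a multiple of \<open>g \<theta>\<close>, where \<open>\<theta>\<close> is the parabola vanishing at both end points and the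
  polynomial \<open>g\<close> lies between \<open>p / 2\<close> and \<open>3 p / 2\<close>; then \<open>\<sigma>\<close> is obtained by integrating \<open>\<psi> / p\<close>.
  With \<open>d = \<beta> - \<alpha>\<close>, the constant is \<open>81/4 = (3/2)\<^sup>2 (1/4)\<^sup>2 12\<^sup>2\<close>, from \<open>\<theta> \<le> d\<^sup>2/4\<close> and the normalising
  factor \<open>J \<ge> d\<^sup>3/12\<close>.
\<close>

lemma cutoff_step:
  fixes \<alpha> \<beta> C :: real and pn :: "real \<Rightarrow> real"
  assumes \<alpha>\<beta>: "\<alpha> < \<beta>" and cont: "continuous_on {\<alpha>..\<beta>} pn"
    and ae: "AE x in lebesgue. x \<in> {\<alpha>..\<beta>} \<longrightarrow> pn x = p x"
    and pos: "\<And>x. x \<in> {\<alpha>..\<beta>} \<Longrightarrow> 0 < pn x" and le: "\<And>x. x \<in> {\<alpha>..\<beta>} \<Longrightarrow> pn x \<le> C * (\<beta> - \<alpha>)\<^sup>2"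
  obtains \<sigma> \<sigma>' \<psi> \<psi>' where "multiplier \<sigma> \<sigma>' \<psi> \<psi>'" "\<And>x. 0 \<le> \<sigma> x \<and> \<sigma> x \<le> 1" "\<And>x. x \<le> \<alpha> \<Longrightarrow> \<sigma> x = 0" "\<And>x. \<beta> \<le> x \<Longrightarrow> \<sigma> x = 1"
    "\<And>x. x \<notin> {\<alpha>..\<beta>} \<Longrightarrow> \<sigma>' x = 0 \<and> \<psi> x = 0 \<and> \<psi>' x = 0" "\<And>x. \<sigma>' x * \<psi> x \<le> 81 / 4 * C"
proof -
  define L where "L = \<beta> - \<alpha>"
  have L: "L > 0" using \<alpha>\<beta> by (simp add: L_def)
  have C: "C > 0"
  proof -
    have "0 < C * (\<beta> - \<alpha>)\<^sup>2" using pos[of \<alpha>] le[of \<alpha>] \<alpha>\<beta> by auto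
    then show ?thesis by (simp add: zero_less_mult_iff)
  qed
  obtain x0 where x0: "x0 \<in> {\<alpha>..\<beta>}" "\<And>x. x \<in> {\<alpha>..\<beta>} \<Longrightarrow> pn x0 \<le> pn x"
    using continuous_attains_inf[OF compact_Icc _ cont] \<alpha>\<beta> by auto
  \<comment> \<open>An error below half the minimum of \<open>pn\<close> keeps \<open>g\<close>
    within a factor between 1/2 and 3/2 of \<open>pn\<close>, while a polynomial has the derivative
    that \<open>\<psi>'\<close> requires.\<close>
  obtain g where g: "real_polynomial_function g" "\<And>x. x \<in> {\<alpha>..\<beta>} \<Longrightarrow> \<bar>pn x - g x\<bar> < pn x0 / 2"
    using Stone_Weierstrass_real_polynomial_function[OF compact_Icc cont, of "pn x0 / 2"] pos[OF x0(1)] by auto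
  have g_bounds: "pn x / 2 \<le> g x \<and> g x \<le> 3 / 2 * pn x" if "x \<in> {\<alpha>..\<beta>}" for x
    using g(2)[OF that] x0(2)[OF that] by linarith
  obtain g' where g': "real_polynomial_function g'" "\<And>x. (g has_real_derivative g' x) (at x)"
    using has_real_derivative_polynomial_function[OF g(1)] by blast
  have cg: "continuous_on S g" "continuous_on S g'" for S
    using g(1) g'(1) by (auto intro: continuous_on_polymonial_function simp: real_polynomial_function_eq)
  define \<theta> where "\<theta> x = (x - \<alpha>) * (\<beta> - x)" for x
  have \<theta>0: "0 \<le> \<theta> x" if "x \<in> {\<alpha>..\<beta>}" for x using that by (auto simp: \<theta>_def)
  have \<theta>neg: "\<theta> x \<le> 0" if "x \<notin> {\<alpha>..\<beta>}" for x
    using that \<alpha>\<beta> by (auto simp: \<theta>_def mult_nonneg_nonpos mult_nonpos_nonneg)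
  have \<theta>_le: "\<theta> x \<le> L\<^sup>2 / 4" for x
  proof -
    have "0 \<le> (2 * x - \<alpha> - \<beta>)\<^sup>2" by simp
    then show ?thesis by (simp add: \<theta>_def L_def power2_eq_square algebra_simps)
  qed
  have [continuous_intros]: "continuous_on S \<theta>" for S unfolding \<theta>_def[abs_def] by (intro continuous_intros)
  \<comment> \<open>Dividing by \<open>J\<close> makes \<open>\<sigma>\<close> rise by exactly 1
    across the interval.\<close>
  define J where "J = (LINT x:{\<alpha>..\<beta>}|lebesgue. g x * \<theta> x / pn x)"
  have cq: "continuous_on {\<alpha>..\<beta>} (\<lambda>x. g x * \<theta> x / pn x)"
    using pos by (intro continuous_intros cg cont) force
  \<comment> \<open>From \<open>g / pn \<ge> 1/2\<close> and the integral \<open>L^3 / 6\<close> of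
    the parabola.\<close>
  have J: "L^3 / 12 \<le> J"
  proof -
    have "L^3 / 12 = (LINT x:{\<alpha>..\<beta>}|lebesgue. (1/2) * \<theta> x)"
      unfolding set_integral_mult_right \<theta>_def bump_integral(2)[OF \<alpha>\<beta>] by (simp add: L_def)
    also have "\<dots> \<le> J"
      unfolding J_def
    proof (rule set_integral_mono)
      show "set_integrable lebesgue {\<alpha>..\<beta>} (\<lambda>x. (1/2) * \<theta> x)"
        by (intro absolutely_integrable_continuous_real continuous_intros)
      show "set_integrable lebesgue {\<alpha>..\<beta>} (\<lambda>x. g x * \<theta> x / pn x)"
        by (intro absolutely_integrable_continuous_real cq)
      fix x assume x: "x \<in> {\<alpha>..\<beta>}"
      have "1 / 2 \<le> g x / pn x" using g_bounds[OF x] pos[OF x] by (simp add: field_simps)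
      then have "(1 / 2) * \<theta> x \<le> (g x / pn x) * \<theta> x" by (intro mult_right_mono \<theta>0[OF x])
      then show "(1 / 2) * \<theta> x \<le> g x * \<theta> x / pn x" by simp
    qed
    finally show ?thesis .
  qed
  have J0: "J > 0" by (rule less_le_trans[OF _ J]) (use L in simp)
  let ?I = "indicat_real {\<alpha>..\<beta>}"
  define \<sigma>' where "\<sigma>' x = ?I x * (g x * \<theta> x / pn x / J)" for x
  define \<psi> where "\<psi> x = ?I x * (g x * \<theta> x / J)" for x
  define \<psi>' where "\<psi>' x = ?I x * ((g' x * \<theta> x + g x * (\<alpha> + \<beta> - 2 * x)) / J)" for x
  have cq': "continuous_on {\<alpha>..\<beta>} (\<lambda>x. g x * \<theta> x / pn x / J)"
    using J0 by (intro continuous_on_divide[OF cq] continuous_intros) auto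
  obtain B1 where B1: "loc_bdd (\<lambda>x. of_real (\<sigma>' x))" "\<And>x. \<bar>\<sigma>' x\<bar> \<le> B1"
    using indicator_continuous_bounded[OF cq'] unfolding \<sigma>'_def by metis
  have c2: "continuous_on {\<alpha>..\<beta>} (\<lambda>x. (g' x * \<theta> x + g x * (\<alpha> + \<beta> - 2 * x)) / J)"
    using J0 by (intro continuous_intros cg) auto
  obtain B2 where B2: "loc_bdd (\<lambda>x. of_real (\<psi>' x))" "\<And>x. \<bar>\<psi>' x\<bar> \<le> B2"
    using indicator_continuous_bounded[OF c2] unfolding \<psi>'_def by metis
  have \<sigma>'0: "0 \<le> \<sigma>' x" for x
  proof (cases "x \<in> {\<alpha>..\<beta>}")
    case True
    then have "0 \<le> g x" using g_bounds[OF True] pos[OF True] by linarith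
    with True show ?thesis using pos[OF True] \<theta>0[OF True] J0 by (simp add: \<sigma>'_def)
  qed (simp add: \<sigma>'_def)
  interpret w: weight \<sigma>' \<alpha>
    by standard (rule loc_int_bdd[OF B1(1)], rule \<sigma>'0)
  define \<sigma> where "\<sigma> = w.wt_prim"
  have \<sigma>_left: "\<sigma> x = 0" if "x \<le> \<alpha>" for x
  proof -
    have "(LINT t:{x..\<alpha>}|lebesgue. \<sigma>' t) = (LINT t:{x..\<alpha>}|lebesgue. 0)"
      by (rule set_lebesgue_integral_cong) (auto simp: \<sigma>'_def \<theta>_def indicator_def)
    then show ?thesis using w.wt_prim_diff[OF that] by (simp add: \<sigma>_def)
  qed
  have \<sigma>\<beta>: "\<sigma> \<beta> = 1"
  proof -
    have "(LINT t:{\<alpha>..\<beta>}|lebesgue. \<sigma>' t) = (LINT t:{\<alpha>..\<beta>}|lebesgue. g t * \<theta> t / pn t / J)"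
      by (rule set_lebesgue_integral_cong) (auto simp: \<sigma>'_def indicator_def)
    also have "\<dots> = 1" using J0 unfolding set_integral_divide_zero J_def[symmetric] by simp
    finally show ?thesis using w.wt_prim_diff[of \<alpha> \<beta>] \<alpha>\<beta> by (simp add: \<sigma>_def)
  qed
  have \<sigma>_right: "\<sigma> x = 1" if "\<beta> \<le> x" for x
  proof -
    have "(LINT t:{\<beta>..x}|lebesgue. \<sigma>' t) = (LINT t:{\<beta>..x}|lebesgue. 0)"
      by (rule set_lebesgue_integral_cong) (auto simp: \<sigma>'_def \<theta>_def indicator_def)
    then show ?thesis using w.wt_prim_diff[OF that] \<sigma>\<beta> by (simp add: \<sigma>_def)
  qed
  have \<sigma>01: "0 \<le> \<sigma> x \<and> \<sigma> x \<le> 1" for x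
    using w.wt_prim_mono[of "min x \<alpha>" x] w.wt_prim_mono[of x "max x \<beta>"] \<sigma>_left[of "min x \<alpha>"] \<sigma>_right[of "max x \<beta>"]
    by (simp add: \<sigma>_def)
  \<comment> \<open>The parabola cut to its interval is its positive part, which shows continuity at
    the end points.\<close>
  have \<psi>_eq: "\<psi> x = g x * max 0 (\<theta> x) / J" for x
  proof (cases "x \<in> {\<alpha>..\<beta>}")
    case True
    with \<theta>0[OF True] show ?thesis by (simp add: \<psi>_def max_def)
  next
    case False
    have "max 0 (\<theta> x) = 0" using \<theta>neg[OF False] by simp
    with False show ?thesis by (simp add: \<psi>_def)
  qed
  have c\<psi>: "continuous_on S \<psi>" for S
    unfolding \<psi>_eq[abs_def] using J0 by (intro continuous_intros cg) auto
  have deriv\<psi>: "(\<psi> has_real_derivative \<psi>' x) (at x)" if "x \<noteq> \<alpha>" "x \<noteq> \<beta>" for x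
  proof (cases "x \<in> {\<alpha>..\<beta>}")
    case True
    then have x: "x \<in> {\<alpha><..<\<beta>}" using that by auto
    have "((\<lambda>x. g x * \<theta> x / J) has_real_derivative \<psi>' x) (at x)"
      using True J0 unfolding \<theta>_def
      by (auto intro!: derivative_eq_intros g'(2) simp: \<psi>'_def \<theta>_def field_simps)
    then show ?thesis
      by (rule has_field_derivative_transform_within_open[OF _ open_greaterThanLessThan x]) (auto simp: \<psi>_def)
  next
    case False
    have "open (- {\<alpha>..\<beta>})" by auto
    have "((\<lambda>x. 0) has_real_derivative \<psi>' x) (at x)" using False by (simp add: \<psi>'_def)
    then show ?thesis
      by (rule has_field_derivative_transform_within_open[OF _ \<open>open (- {\<alpha>..\<beta>})\<close>]) (use False in \<open>auto simp: \<psi>_def\<close>)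
  qed
  have AC\<psi>: "AC_loc_with (\<lambda>x. of_real (\<psi> x)) (\<lambda>x. of_real (\<psi>' x))"
    unfolding AC_loc_with_iff
  proof (intro conjI allI impI)
    show li: "loc_int (\<lambda>x. of_real (\<psi>' x))" by (rule loc_int_bdd[OF B2(1)])
    fix x y :: real assume xy: "x \<le> y"
    \<comment> \<open>At \<open>\<alpha>\<close> and \<open>\<beta>\<close> the function
      \<open>\<psi>\<close> may have corners; they are the exceptional points of the fundamental
      theorem.\<close>
    have "(\<psi>' has_integral \<psi> y - \<psi> x) {x..y}"
    proof (rule fundamental_theorem_of_calculus_interior_strong[of "{\<alpha>, \<beta>}"])
      show "(\<psi> has_vector_derivative \<psi>' t) (at t)" if "t \<in> {x<..<y} - {\<alpha>, \<beta>}" for t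
        using deriv\<psi>[of t] that by (simp add: has_real_derivative_iff_has_vector_derivative)
    qed (use xy c\<psi> in auto)
    then have "integral {x..y} \<psi>' = \<psi> y - \<psi> x" by (rule integral_unique)
    moreover have "set_integrable lebesgue {x..y} \<psi>'"
      using loc_intD(2)[OF li, of x y] by (simp only: set_integrable_complex_of_real_iff)
    ultimately have "(LINT t:{x..y}|lebesgue. \<psi>' t) = \<psi> y - \<psi> x"
      using set_lebesgue_integral_eq_integral(2) by metis
    then show "complex_of_real (\<psi> y) - of_real (\<psi> x) = (LINT t:{x..y}|lebesgue. of_real (\<psi>' t))"
      by (simp add: set_integral_complex_of_real)
  qed
  \<comment> \<open>The length drops out: \<open>L^4\<close> from the squared parabola and
    \<open>L\<^sup>2\<close> from the bound on \<open>pn\<close> are compensated by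
    \<open>J\<^sup>2\<close>, which is at least \<open>L^6 / 144\<close>.\<close>
  have \<sigma>'\<psi>: "\<sigma>' x * \<psi> x \<le> 81 / 4 * C" for x
  proof (cases "x \<in> {\<alpha>..\<beta>}")
    case True
    note gb = g_bounds[OF True] and px = pos[OF True]
    have "(g x)\<^sup>2 \<le> (3 / 2 * pn x)\<^sup>2" using gb px by (intro power_mono) auto
    moreover have "(\<theta> x)\<^sup>2 \<le> (L\<^sup>2 / 4)\<^sup>2" by (intro power_mono \<theta>_le \<theta>0 True)
    ultimately have "(g x)\<^sup>2 * (\<theta> x)\<^sup>2 \<le> (3 / 2 * pn x)\<^sup>2 * (L\<^sup>2 / 4)\<^sup>2" by (intro mult_mono) auto
    also have "\<dots> = pn x * (9 / 64 * L^4 * pn x)" by (simp add: power2_eq_square power4_eq_xxxx)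
    also have "\<dots> \<le> pn x * (9 / 64 * L^4 * (C * L\<^sup>2))"
      using le[OF True] px by (intro mult_left_mono) (auto simp: L_def)
    also have "\<dots> = pn x * (81 / 4 * C * (L^3 / 12)\<^sup>2)" by (simp add: power2_eq_square power3_eq_cube power4_eq_xxxx)
    also have "\<dots> \<le> pn x * (81 / 4 * C * J\<^sup>2)"
      using J L C px by (intro mult_left_mono power_mono) auto
    finally have *: "(g x)\<^sup>2 * (\<theta> x)\<^sup>2 \<le> pn x * (81 / 4 * C * J\<^sup>2)" .
    have "\<sigma>' x * \<psi> x = (g x)\<^sup>2 * (\<theta> x)\<^sup>2 / (pn x * J\<^sup>2)"
      using True by (simp add: \<sigma>'_def \<psi>_def power2_eq_square mult_ac)
    also have "\<dots> \<le> 81 / 4 * C" using * px J0 by (simp add: divide_le_eq mult_ac)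
    finally show ?thesis .
  qed (use C in \<open>simp add: \<sigma>'_def\<close>)
  have ae\<psi>: "AE x in lebesgue. \<psi> x = p x * \<sigma>' x"
    using ae
  proof eventually_elim
    case (elim x)
    show ?case
    proof (cases "x \<in> {\<alpha>..\<beta>}")
      case True
      with elim have px: "p x = pn x" "pn x \<noteq> 0" using pos[OF True] by auto
      then show ?thesis by (simp add: \<psi>_def \<sigma>'_def)
    qed (simp add: \<psi>_def \<sigma>'_def)
  qed
  have L2Q: "L2 (\<lambda>x. of_real (Q x * \<sigma>' x))"
    unfolding L2_def
  proof
    have "(\<lambda>x. Re (complex_of_real (\<sigma>' x))) \<in> borel_measurable lebesgue"
      by (rule measurable_compose[OF _ borel_measurable_Re]) (use B1(1) in \<open>simp add: loc_bdd_def\<close>)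
    then have [measurable]: "\<sigma>' \<in> borel_measurable lebesgue" by simp
    show "(\<lambda>x. complex_of_real (Q x * \<sigma>' x)) \<in> borel_measurable lebesgue" by measurable
    show "integrable lebesgue (\<lambda>x. (cmod (complex_of_real (Q x * \<sigma>' x)))\<^sup>2)"
    proof (rule Bochner_Integration.integrable_bound)
      show "integrable lebesgue (\<lambda>x. (81 / 4 * C) * (?I x *\<^sub>R (Q x / sqrt \<bar>p x\<bar>)\<^sup>2))"
        using coeff_sq_integrable(2)[of \<alpha> \<beta>] unfolding set_integrable_def by (rule integrable_mult_right)
      show "AE x in lebesgue. norm ((cmod (complex_of_real (Q x * \<sigma>' x)))\<^sup>2) \<le> norm ((81 / 4 * C) * (?I x *\<^sub>R (Q x / sqrt \<bar>p x\<bar>)\<^sup>2))"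
        using ae ae\<psi>
      proof eventually_elim
        case (elim x)
        show ?case
        proof (cases "x \<in> {\<alpha>..\<beta>}")
          case True
          with elim have px: "0 < p x" using pos[OF True] by simp
          \<comment> \<open>By \<open>\<psi> = p \<sigma>'\<close> the factor \<open>p\<close> is
            moved under \<open>Q\<^sup>2\<close>, where local integrability is assumed, and what
            remains is the bounded product.\<close>
          have "(Q x * \<sigma>' x)\<^sup>2 = (Q x / sqrt \<bar>p x\<bar>)\<^sup>2 * (\<sigma>' x * \<psi> x)"
            using elim px by (simp add: power_divide power2_eq_square)
          also have "\<dots> \<le> (Q x / sqrt \<bar>p x\<bar>)\<^sup>2 * (81 / 4 * C)"
            by (intro mult_left_mono \<sigma>'\<psi>) simp
          finally show ?thesis using True C by (simp add: norm_mult abs_mult power_mult_distrib mult.commute)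
        qed (simp add: \<sigma>'_def)
      qed
    qed measurable
  qed
  show ?thesis
  proof
    show "multiplier \<sigma> \<sigma>' \<psi> \<psi>'"
      unfolding multiplier_def
    proof (intro conjI)
      show "AC_loc_with (\<lambda>x. of_real (\<sigma> x)) (\<lambda>x. of_real (\<sigma>' x))" unfolding \<sigma>_def by (rule w.AC_wt_prim)
      show "\<exists>B. \<forall>x. \<bar>\<sigma>' x\<bar> \<le> B \<and> \<bar>\<psi>' x\<bar> \<le> B"
        using B1(2) B2(2) by (meson max.coboundedI1 max.coboundedI2)
    qed (rule AC\<psi> ae\<psi> L2Q)+
    show "\<sigma>' x = 0 \<and> \<psi> x = 0 \<and> \<psi>' x = 0" if "x \<notin> {\<alpha>..\<beta>}" for x
      using that by (simp add: \<sigma>'_def \<psi>_def \<psi>'_def)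
  qed (rule \<sigma>01 \<sigma>_left \<sigma>_right \<sigma>'\<psi>; assumption?)+
qed

text \<open>The plateau is \<open>\<sigma> - \<eta>\<close>, with \<open>\<sigma>\<close> rising on
  an interval left of \<open>-R\<close> and \<open>\<eta>\<close> on one right of \<open>R\<close>.
  The ramps are disjoint, so the products have no cross terms and the constant of a single ramp is
  kept.\<close>

lemma has_cutoffsI:
  fixes a b :: "int \<Rightarrow> real" and C :: real
  assumes ab: "\<And>n. a n < b n" and b: "filterlim b at_bot at_bot" and a: "filterlim a at_top at_top" and C: "C > 0"
    and pn: "\<And>n. \<exists>pn. continuous_on {a n..b n} pn \<and> (AE x in lebesgue. x \<in> {a n..b n} \<longrightarrow> pn x = p x) \<and>
       (\<forall>x\<in>{a n..b n}. pn x > 0 \<and> pn x \<le> C * (b n - a n)\<^sup>2)"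
  shows "has_cutoffs (81 / 4 * C)"
  unfolding has_cutoffs_def
proof (intro allI impI)
  fix R :: real assume R: "R > 0"
  have "eventually (\<lambda>n. b n < - R) at_bot" using b unfolding filterlim_at_bot_dense by blast
  then obtain i where i: "b i < - R" by (auto simp: eventually_at_bot_linorder)
  have "eventually (\<lambda>n. R < a n) at_top" using a unfolding filterlim_at_top_dense by blast
  then obtain j where j: "R < a j" by (auto simp: eventually_at_top_linorder)
  obtain \<sigma> \<sigma>' \<psi> \<psi>' where l: "multiplier \<sigma> \<sigma>' \<psi> \<psi>'" "\<And>x. 0 \<le> \<sigma> x \<and> \<sigma> x \<le> 1" "\<And>x. x \<le> a i \<Longrightarrow> \<sigma> x = 0" "\<And>x. b i \<le> x \<Longrightarrow> \<sigma> x = 1"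
    "\<And>x. x \<notin> {a i..b i} \<Longrightarrow> \<sigma>' x = 0 \<and> \<psi> x = 0 \<and> \<psi>' x = 0" "\<And>x. \<sigma>' x * \<psi> x \<le> 81 / 4 * C"
  proof -
    obtain pi where "continuous_on {a i..b i} pi" "AE x in lebesgue. x \<in> {a i..b i} \<longrightarrow> pi x = p x"
      "\<forall>x\<in>{a i..b i}. pi x > 0 \<and> pi x \<le> C * (b i - a i)\<^sup>2" using pn[of i] by blast
    from cutoff_step[OF ab this(1,2)] this(3) that show ?thesis by blast
  qed
  obtain \<eta> \<eta>' \<omega> \<omega>' where r: "multiplier \<eta> \<eta>' \<omega> \<omega>'" "\<And>x. 0 \<le> \<eta> x \<and> \<eta> x \<le> 1" "\<And>x. x \<le> a j \<Longrightarrow> \<eta> x = 0" "\<And>x. b j \<le> x \<Longrightarrow> \<eta> x = 1"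
    "\<And>x. x \<notin> {a j..b j} \<Longrightarrow> \<eta>' x = 0 \<and> \<omega> x = 0 \<and> \<omega>' x = 0" "\<And>x. \<eta>' x * \<omega> x \<le> 81 / 4 * C"
  proof -
    obtain pj where "continuous_on {a j..b j} pj" "AE x in lebesgue. x \<in> {a j..b j} \<longrightarrow> pj x = p x"
      "\<forall>x\<in>{a j..b j}. pj x > 0 \<and> pj x \<le> C * (b j - a j)\<^sup>2" using pn[of j] by blast
    from cutoff_step[OF ab this(1,2)] this(3) that show ?thesis by blast
  qed
  define S where "S = max (- a i) (b j)"
  have order: "a i < b i" "b i < - R" "R < a j" "a j < b j" using ab i j by auto
  show "\<exists>S \<phi> \<phi>' \<psi> \<psi>'. multiplier \<phi> \<phi>' \<psi> \<psi>' \<and> supported \<phi> \<phi>' \<psi> \<psi>' {-S..S} \<and>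
     (\<forall>x. 0 \<le> \<phi> x \<and> \<phi> x \<le> 1) \<and> (\<forall>x. \<phi>' x * \<psi> x \<le> 81 / 4 * C) \<and>
     (\<forall>x\<in>{-R..R}. \<phi> x = 1 \<and> \<phi>' x = 0 \<and> \<psi> x = 0 \<and> \<psi>' x = 0)"
  proof (intro exI conjI allI ballI)
    show "multiplier (\<lambda>x. \<sigma> x - \<eta> x) (\<lambda>x. \<sigma>' x - \<eta>' x) (\<lambda>x. \<psi> x - \<omega> x) (\<lambda>x. \<psi>' x - \<omega>' x)"
      by (rule multiplier_diff[OF l(1) r(1)])
    show "supported (\<lambda>x. \<sigma> x - \<eta> x) (\<lambda>x. \<sigma>' x - \<eta>' x) (\<lambda>x. \<psi> x - \<omega> x) (\<lambda>x. \<psi>' x - \<omega>' x) {-S..S}"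
      unfolding supported_def
    proof (intro allI impI)
      fix x assume "x \<notin> {-S..S}"
      then consider "x < a i" | "b j < x" by (auto simp: S_def max_def split: if_splits)
      then show "\<sigma> x - \<eta> x = 0 \<and> \<sigma>' x - \<eta>' x = 0 \<and> \<psi> x - \<omega> x = 0 \<and> \<psi>' x - \<omega>' x = 0"
        using l(3-5)[of x] r(3-5)[of x] order R by cases auto
    qed
    fix x
    show "0 \<le> \<sigma> x - \<eta> x" "\<sigma> x - \<eta> x \<le> 1"
      using l(2,4)[of x] r(2,3)[of x] order R by (cases "x \<le> a j"; auto)+
    show "(\<sigma>' x - \<eta>' x) * (\<psi> x - \<omega> x) \<le> 81 / 4 * C"
      using l(5,6)[of x] r(5,6)[of x] order R by (cases "x \<le> b i") auto
  next
    fix x assume "x \<in> {-R..R}"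
    then show "\<sigma> x - \<eta> x = 1" "\<sigma>' x - \<eta>' x = 0" "\<psi> x - \<omega> x = 0" "\<psi>' x - \<omega>' x = 0"
      using l(4,5)[of x] r(3,5)[of x] order by auto
  qed
qed

section \<open>Density of the domain and the closure of the preminimal operator\<close>

lemma limit_in_Lmax:
  assumes UF: "\<And>n. (U n, F n) \<in> L00 p Q r s" and "L2 u" "L2 f"
    and lim: "(\<lambda>n. L2_norm_sq (\<lambda>x. U n x - u x)) \<longlonglongrightarrow> 0" "(\<lambda>n. L2_norm_sq (\<lambda>x. F n x - f x)) \<longlonglongrightarrow> 0"
  shows "(u, f) \<in> Lmax p Q r s"
proof -
  have L2UF: "L2 (U n)" "L2 (F n)" for n using UF[of n] by (auto simp: L00_iff)
  \<comment> \<open>An adjoint is closed because its defining equation passes to L2 limits; the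
    maximal graph is such an adjoint.\<close>
  have "L2_inner g u = L2_inner v f" if vg: "(v, g) \<in> L00 p Q r s" for v g
  proof (rule LIMSEQ_unique)
    have L2v: "L2 v" "L2 g" using vg by (auto simp: L00_iff)
    show "(\<lambda>n. L2_inner g (U n)) \<longlonglongrightarrow> L2_inner g u"
      by (rule L2_inner_tendsto_right[OF L2UF(1) assms(2) L2v(2) lim(1)])
    have "L2_inner g (U n) = L2_inner v (F n)" for n
      by (rule L00_symmetric[OF vg]) (use UF L00_subset_Lmax in blast)
    then show "(\<lambda>n. L2_inner g (U n)) \<longlonglongrightarrow> L2_inner v f"
      using L2_inner_tendsto_right[OF L2UF(2) assms(3) L2v(1) lim(2)] by simp
  qed
  then have "(u, f) \<in> adjoint_op (L00 p Q r s)" using assms by (auto simp: adjoint_op_def)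
  then show ?thesis by (simp only: adjoint_L00)
qed

text \<open>Replacing all second components by zero makes the pair projection act on the domain
  alone. The residual \<open>h\<close> is orthogonal to the domain, so \<open>(0, h)\<close> lies in
  the adjoint, which is the single-valued maximal operator; hence \<open>h = 0\<close>.\<close>

lemma densely_defined_L00: "densely_defined (L00 p Q r s)"
  unfolding densely_defined_def
proof (intro allI impI)
  fix v assume v: "L2 v"
  define S where "S = {(u, \<lambda>x::real. 0::complex) |u f. (u, f) \<in> L00 p Q r s}"
  have S: "pair_subspace S"
    unfolding pair_subspace_def
  proof (intro conjI ballI allI; clarify?)
    have "L00 p Q r s \<noteq> {}" using pair_subspace_L00 by (simp add: pair_subspace_def)
    then show "S = {} \<Longrightarrow> False" by (fastforce simp: S_def)
  next
    fix u f assume "(u, f) \<in> S"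
    then show "L2 u \<and> L2 f" by (auto simp: S_def L00_iff L2_zero)
  next
    fix u f w g z assume "(u, f) \<in> S" "(w, g) \<in> S"
    then obtain f' g' where "(u, f') \<in> L00 p Q r s" "(w, g') \<in> L00 p Q r s" and fg: "f = (\<lambda>x. 0)" "g = (\<lambda>x. 0)"
      by (auto simp: S_def)
    then have "((\<lambda>x. u x + z * w x), (\<lambda>x. f' x + z * g' x)) \<in> L00 p Q r s"
      using pair_subspace_L00 unfolding pair_subspace_def by fast
    then show "((\<lambda>x. u x + z * w x), (\<lambda>x. f x + z * g x)) \<in> S" by (auto simp: S_def fg)
  qed
  obtain h k U F where h: "L2 h" "\<And>v g. (v, g) \<in> S \<Longrightarrow> L2_inner v h + L2_inner g k = 0"
    and U: "\<And>n. (U n, F n) \<in> S" "(\<lambda>n. L2_norm_sq (\<lambda>x. U n x - (v x - h x))) \<longlonglongrightarrow> 0"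
    by (rule projection[OF S v L2_zero]) (rule that, assumption+)
  have "L2_inner f (\<lambda>x. 0) = L2_inner u h" if "(u, f) \<in> L00 p Q r s" for u f
  proof -
    have "(u, \<lambda>x. 0) \<in> S" using that by (auto simp: S_def)
    from h(2)[OF this] show ?thesis by (simp add: L2_inner_def)
  qed
  then have "((\<lambda>x. 0), h) \<in> adjoint_op (L00 p Q r s)"
    using h(1) L2_zero by (auto simp: adjoint_op_def)
  then have 1: "((\<lambda>x. 0), h) \<in> Lmax p Q r s" by (simp only: adjoint_L00)
  have "((\<lambda>x. 0), (\<lambda>x. 0)) \<in> adjoint_op (L00 p Q r s)"
    using L2_zero by (auto simp: adjoint_op_def L2_inner_def)
  then have 2: "((\<lambda>x. 0), (\<lambda>x. 0)) \<in> Lmax p Q r s" by (simp only: adjoint_L00)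
  have h0: "AE x in lebesgue. h x = 0"
    using Lmax_single_valued 1 2 unfolding single_valued_op_def by fastforce
  have L2U: "L2 (U n)" for n using U(1)[of n] by (auto simp: S_def L00_iff)
  have "L2_norm_sq (\<lambda>x. U n x - (v x - h x)) = L2_norm_sq (\<lambda>x. U n x - v x)" for n
    by (rule L2_norm_sq_cong_AE) (use h0 in \<open>auto intro!: L2_diff L2U v h elim!: eventually_mono\<close>)
  with U(2) have "(\<lambda>n. L2_norm_sq (\<lambda>x. U n x - v x)) \<longlonglongrightarrow> 0" by simp
  moreover have "U n \<in> fst ` L00 p Q r s" for n using U(1)[of n] by (force simp: S_def)
  ultimately show "\<exists>U. (\<forall>n. U n \<in> fst ` L00 p Q r s) \<and> (\<lambda>n. L2_norm_sq (\<lambda>x. U n x - v x)) \<longlonglongrightarrow> 0" by blast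
qed

lemma closure_L00:
  assumes sym: "Lmax p Q r s \<subseteq> adjoint_op (Lmax p Q r s)"
  shows "closure_op (L00 p Q r s) = Lmax p Q r s"
proof
  show "closure_op (L00 p Q r s) \<subseteq> Lmax p Q r s"
    using limit_in_Lmax unfolding closure_op_def by blast
  show "Lmax p Q r s \<subseteq> closure_op (L00 p Q r s)"
  proof safe
    fix u f assume uf: "(u, f) \<in> Lmax p Q r s"
    then have L2: "L2 u" "L2 f" by (auto simp: Lmax_iff)
    obtain h k U F where hk: "L2 h" "L2 k" "\<And>v g. (v, g) \<in> L00 p Q r s \<Longrightarrow> L2_inner v h + L2_inner g k = 0"
      and UF: "\<And>n. (U n, F n) \<in> L00 p Q r s" and lim: "(\<lambda>n. L2_norm_sq (\<lambda>x. U n x - (u x - h x))) \<longlonglongrightarrow> 0"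
        "(\<lambda>n. L2_norm_sq (\<lambda>x. F n x - (f x - k x))) \<longlonglongrightarrow> 0"
      by (rule projection[OF pair_subspace_L00 L2]) (rule that, assumption+)
    \<comment> \<open>The projected part is a limit from the preminimal graph, hence in the maximal
      graph, and subtracting it from \<open>(u, f)\<close> will show that \<open>(h, k)\<close> is
      there too.\<close>
    have diff: "((\<lambda>x. u x - h x), (\<lambda>x. f x - k x)) \<in> Lmax p Q r s"
      by (rule limit_in_Lmax[OF UF L2_diff[OF L2(1) hk(1)] L2_diff[OF L2(2) hk(2)] lim])
    have "L2_inner g h = L2_inner v k" if vg: "(v, g) \<in> L00 p Q r s" for v g
    proof -
      have "L2 v" "L2 g" using vg by (auto simp: L00_iff)
      then show ?thesis
        using L00_symmetric[OF vg uf] L00_symmetric[OF vg diff] by (simp add: L2_inner_diff_right L2 hk)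
    qed
    then have "(h, k) \<in> adjoint_op (L00 p Q r s)" using hk by (auto simp: adjoint_op_def)
    then have h: "(h, k) \<in> Lmax p Q r s" by (simp only: adjoint_L00)
    have neg: "L2_inner v (\<lambda>x. - h x) = - L2_inner v h" for v
      by (simp add: L2_inner_def)
    \<comment> \<open>Orthogonality in the space of pairs, read as an adjoint relation, puts
      \<open>(k, - h)\<close> into the maximal graph.\<close>
    have "L2_inner g k = L2_inner v (\<lambda>x. - h x)" if "(v, g) \<in> L00 p Q r s" for v g
      using hk(3)[OF that] by (simp add: neg add_eq_0_iff)
    then have "(k, \<lambda>x. - h x) \<in> adjoint_op (L00 p Q r s)"
      using hk L2_cmult[OF hk(1), of "-1"] by (auto simp: adjoint_op_def)
    then have k: "(k, \<lambda>x. - h x) \<in> Lmax p Q r s" by (simp only: adjoint_L00)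
    have "L2_inner k k = L2_inner h (\<lambda>x. - h x)"
      using sym h k unfolding adjoint_op_def by blast
    then have "L2_norm_sq k = - L2_norm_sq h"
      unfolding neg L2_inner_self by (metis of_real_eq_iff of_real_minus)
    then have "L2_norm_sq h = 0" "L2_norm_sq k = 0"
      using L2_norm_sq_nonneg[of h] L2_norm_sq_nonneg[of k] by auto
    then have 0: "AE x in lebesgue. h x = 0" "AE x in lebesgue. k x = 0"
      using L2_norm_sq_zero_iff hk by auto
    have L2UF: "L2 (U n)" "L2 (F n)" for n using UF[of n] by (auto simp: L00_iff)
    have "L2_norm_sq (\<lambda>x. U n x - (u x - h x)) = L2_norm_sq (\<lambda>x. U n x - u x)"
      "L2_norm_sq (\<lambda>x. F n x - (f x - k x)) = L2_norm_sq (\<lambda>x. F n x - f x)" for n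
      by (rule L2_norm_sq_cong_AE; use 0 in \<open>auto intro!: L2_diff L2UF L2 hk elim!: eventually_mono\<close>)+
    with lim have "(\<lambda>n. L2_norm_sq (\<lambda>x. U n x - u x)) \<longlonglongrightarrow> 0" "(\<lambda>n. L2_norm_sq (\<lambda>x. F n x - f x)) \<longlonglongrightarrow> 0"
      by simp_all
    with L2 UF show "(u, f) \<in> closure_op (L00 p Q r s)" unfolding closure_op_def by blast
  qed
qed

end

theorem theorem2:
  fixes p Q r s :: "real \<Rightarrow> real" and a b :: "int \<Rightarrow> real" and C :: real
  assumes "standing_A p Q r s"
    and "bounded_below_op (L00 p Q r s)"
    and "\<And>n. a n < b n"
    and "filterlim b at_bot at_bot"
    and "filterlim a at_top at_top"
    and "C > 0"
    and "\<And>n. \<exists>pn. continuous_on {a n..b n} pn \<and>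
            (AE x in lebesgue. x \<in> {a n..b n} \<longrightarrow> pn x = p x) \<and>
            W12 (a n) (b n) pn \<and>
            (\<forall>x\<in>{a n..b n}. pn x > 0 \<and> pn x \<le> C * (b n - a n)\<^sup>2)"
  shows "essentially_self_adjoint (L00 p Q r s) \<and>
         adjoint_op (L00 p Q r s) = Lmax p Q r s \<and>
         Lmax p Q r s = adjoint_op (Lmax p Q r s)"
proof -
  interpret quasi_operator p Q r s by standard (rule assms(1))
  have "has_cutoffs (81 / 4 * C)"
  proof (rule has_cutoffsI[OF assms(3-6)])
    show "\<exists>pn. continuous_on {a n..b n} pn \<and> (AE x in lebesgue. x \<in> {a n..b n} \<longrightarrow> pn x = p x) \<and>
       (\<forall>x\<in>{a n..b n}. pn x > 0 \<and> pn x \<le> C * (b n - a n)\<^sup>2)" for n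
      using assms(7)[of n] by blast
  qed
  obtain \<gamma> where \<gamma>: "\<And>u f. (u, f) \<in> L00 p Q r s \<Longrightarrow> Re (L2_inner f u) \<ge> \<gamma> * L2_norm_sq u"
    using assms(2) unfolding bounded_below_op_def by blast
  \<comment> \<open>The shift is \<open>\<bar>\<gamma>\<bar>\<close> and not
    \<open>- \<gamma>\<close> because the energy estimate asks for a nonnegative one.\<close>
  have pos: "0 \<le> Re (form \<bar>\<gamma>\<bar> w k w)" if "(w, k) \<in> L00 p Q r s" for w k
  proof -
    have "Re (form \<bar>\<gamma>\<bar> w k w) = Re (L2_inner k w) + \<bar>\<gamma>\<bar> * L2_norm_sq w"
      by (simp add: form_def L2_inner_self)
    moreover have "- \<bar>\<gamma>\<bar> * L2_norm_sq w \<le> \<gamma> * L2_norm_sq w"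
      by (intro mult_right_mono L2_norm_sq_nonneg) simp
    ultimately show ?thesis using \<gamma>[OF that] by simp
  qed
  have sym: "Lmax p Q r s \<subseteq> adjoint_op (Lmax p Q r s)"
    by (rule Lmax_subset_adjoint_Lmax[OF pos _ _ \<open>has_cutoffs (81 / 4 * C)\<close>]) (use assms(6) in auto)
  \<comment> \<open>Taking adjoints reverses inclusions; since the right-hand side is the maximal
    graph, this is the converse of the symmetry just obtained.\<close>
  have "adjoint_op (Lmax p Q r s) \<subseteq> adjoint_op (L00 p Q r s)"
    using L00_subset_Lmax unfolding adjoint_op_def by blast
  with sym have sa: "Lmax p Q r s = adjoint_op (Lmax p Q r s)" by (simp only: adjoint_L00)
  have "densely_defined (Lmax p Q r s)"
    using densely_defined_L00 L00_subset_Lmax unfolding densely_defined_def by (meson image_mono subsetD)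
  then have "self_adjoint_op (closure_op (L00 p Q r s))"
    unfolding self_adjoint_op_def closure_L00[OF sym] using Lmax_single_valued sa by simp
  then show ?thesis
    unfolding essentially_self_adjoint_def using densely_defined_L00 adjoint_L00 sa by blast
qed

end
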